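(* Let $k\geq 2$. Fix $\boldsymbol{\alpha}=(\alpha_1,\ldots,\alpha_{k-1})\in\mathbb{R}^{k-1}$ and $\gamma_1,\ldots,\gamma_k\in\mathbb{R}$. If $k=2$, suppose that $\alpha_1$ is an irrational, non-Liouville number; if $k\geq 3$, suppose that $\omega^\times(\boldsymbol{\alpha})<\frac{k-1}{k-2}$. Let $\psi:\mathbb{N}\to\mathbb{R}_{>0}$ be non-increasing with $\sum_{n\geq 1}\psi(n)(\log n)^{k-1}=\infty$. Then for almost all $\alpha_k\in\mathbb{R}$ (with respect to Lebesgue measure) there are infinitely many $n\in\mathbb{N}$ such that \[\|n\alpha_1-\gamma_1\|\cdots\|n\alpha_k-\gamma_k\|<\psi(n).\]
   Context: $\|x\|$ denotes the distance from $x\in\mathbb{R}$ to the nearest integer. A Liouville number is an irrational $\alpha$ such that for every $w>0$ the inequality $\|n\alpha\|<n^{-w}$ holds for infinitely many $n\in\mathbb{N}$. The multiplicative exponent $\omega^\times(\boldsymbol{\alpha})$ of $\boldsymbol{\alpha}=(\alpha_1,\ldots,\alpha_d)\in\mathbb{R}^d$ is the supremum of all $w>0$ such that $\|n\alpha_1\|\cdots\|n\alpha_d\|<n^{-w}$ for infinitely many $n\in\mathbb{N}$. Here $\log x=\max(\ln x,1)$. *)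

theory Defs
  imports "HOL-Analysis.Analysis"
begin

definition dist_int :: "real \<Rightarrow> real" where
  "dist_int x = \<bar>x - of_int (round x)\<bar>"

definition liouville :: "real \<Rightarrow> bool" where
  "liouville \<alpha> \<longleftrightarrow> \<alpha> \<notin> \<rat> \<and>
     (\<forall>w>0. infinite {n::nat. n \<ge> 1 \<and> dist_int (real n * \<alpha>) < real n powr (- w)})"

(* The vector (\<alpha> 1, ..., \<alpha> d) is the restriction of \<alpha> to {1..d}. The supremum is taken
   in the extended reals because the exponent may be infinite. *)
definition mult_exponent :: "nat \<Rightarrow> (nat \<Rightarrow> real) \<Rightarrow> ereal" where
  "mult_exponent d \<alpha> =
     Sup {ereal w |w. w > 0 \<and>
       infinite {n::nat. n \<ge> 1 \<and> (\<Prod>i=1..d. dist_int (real n * \<alpha> i)) < real n powr (- w)}}"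

definition log1 :: "real \<Rightarrow> real" where
  "log1 x = max (ln x) 1"

end

theory Submission
  imports Defs
begin

text \<open>
  Write \<open>d = k - 1\<close> and \<open>\<rho> = \<Prod>i. 2 powr - j i\<close>. If \<open>n\<close> lies in the Bohr set given by \<open>\<parallel>n \<alpha> i - \<gamma> i\<parallel> \<le> 2 powr - j i\<close>
  and \<open>N \<le> n < 2 * N\<close>, then \<open>\<parallel>n x - \<gamma> k\<parallel> < \<psi>(2 N) / \<rho>\<close> suffices for \<open>x\<close>. With \<open>N = R ^ t\<close> and all \<open>j i\<close>
  between \<open>t\<close> and \<open>2 t\<close> there are \<open>t ^ d\<close> such Bohr sets, which accounts for the logarithms in the
  divergent series, and the limsup set is studied by the second moment method.

  Two events belonging to \<open>n\<close> and \<open>n'\<close> overlap in measure at most a constant times the product of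
  their measures, up to an error proportional to \<open>gcd n n'\<close>. The gcd sums over pairs of Bohr sets are
  bounded by equidistribution alone: the hypotheses make all nontrivial integer combinations
  \<open>h \<cdot> \<alpha>\<close> polynomially far from the integers. Writing \<open>n = g a\<close>, \<open>n' = g b\<close>, the dangerous large \<open>g\<close> contribute
  a sum over \<open>a\<close> of \<open>1 / a ^ (1 + d)\<close>, which converges as \<open>d \<ge> 1\<close>, so no coprimality condition on
  the numerators of the fractions is needed.

  This bounds the measure of the limsup set in the unit interval below by a constant depending only
  on \<open>d\<close> and on the Diophantine exponent. That is also true for \<open>D \<alpha>\<close> and \<open>\<psi>(D n)\<close> in place of \<open>\<alpha>\<close>
  and \<open>\<psi>(n)\<close>. Multiples of \<open>D\<close> give a set of period \<open>1 / D\<close>, so the same lower bound holds for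
  the relative measure in every interval \<open>[p / D, (p + 1) / D)\<close>, and the limsup set has full measure.
\<close>

section \<open>Distance to the nearest integer and exponential sums\<close>

text \<open>Counting uses trigonometric polynomials whose coefficients are nonnegative and add up to
  1, so the error is a single geometric sum, however many frequencies occur. The radii in block
  \<open>t\<close> are small powers of the block length, hence the Diophantine loss
  \<open>H ^ W\<close> stays below the main terms. The gcd error for two events of widths
  \<open>y\<close>, \<open>y'\<close> carries \<open>min (y / n) (y' / n')\<close>. A minimum is at
  most a geometric mean, so gcd sums have to be compared with the geometric mean of two cell
  volumes; this is why square roots of powers of two run through the estimates. The product of the
  volumes is the square of that mean, and its surplus factor, at most \<open>(1 / 2) ^ t\<close>,
  pays for harmonic sums of length proportional to \<open>t\<close> and for the number of cells. A
  small common divisor \<open>g\<close> is harmful only if \<open>g\<close> times some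
  \<open>h \<cdot> \<alpha>\<close> returns close to an integer, and such \<open>g\<close> are
  sparse. The resonant part decays geometrically in the distance of the blocks and in the mismatch
  of the radii. Distant blocks need only the trivial divisor bound. The constant
  \<open>\<kappa>\<close> of the Diophantine condition decides only where the usable blocks start.
  This is what makes the final constant invariant under dilation.\<close>

lemma dist_int_nonneg [simp]: "0 \<le> dist_int x"
  by (simp add: dist_int_def)

lemma dist_int_le: "dist_int x \<le> \<bar>x - of_int m\<bar>"
  unfolding dist_int_def by (rule round_diff_minimal)

lemma dist_int_le_half: "dist_int x \<le> 1 / 2"
  unfolding dist_int_def using of_int_round_abs_le[of x] by (simp add: abs_minus_commute)

lemma dist_int_obtain:
  obtains m :: int where "dist_int x = \<bar>x - of_int m\<bar>"
  by (simp add: dist_int_def)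

lemma dist_int_triangle: "dist_int (x + y) \<le> dist_int x + dist_int y"
proof -
  obtain m n where "dist_int x = \<bar>x - of_int m\<bar>" "dist_int y = \<bar>y - of_int n\<bar>"
    by (metis dist_int_obtain)
  then show ?thesis using dist_int_le[of "x + y" "m + n"] by simp
qed

lemma dist_int_of_int_mult: "dist_int (of_int k * x) \<le> \<bar>of_int k\<bar> * dist_int x"
proof -
  obtain m where "dist_int x = \<bar>x - of_int m\<bar>"
    by (rule dist_int_obtain)
  then show ?thesis using dist_int_le[of "of_int k * x" "k * m"]
    by (simp add: abs_mult[symmetric] algebra_simps)
qed

lemma dist_int_uminus [simp]: "dist_int (- x) = dist_int x"
  using dist_int_of_int_mult[of "-1" x] dist_int_of_int_mult[of "-1" "-x"] by simp

lemma dist_int_of_int [simp]: "dist_int (of_int m) = 0"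
  by (simp add: dist_int_def)

lemma dist_int_add_of_int [simp]: "dist_int (x + of_int m) = dist_int x"
  using dist_int_triangle[of x "of_int m"] dist_int_triangle[of "x + of_int m" "of_int (-m)"] by simp

lemma dist_int_sum: "dist_int (\<Sum>i\<in>A. f i) \<le> (\<Sum>i\<in>A. dist_int (f i))"
proof (induction A rule: infinite_finite_induct)
  case (insert a A)
  then show ?case using dist_int_triangle[of "f a" "sum f A"] by simp
qed (use dist_int_of_int[of 0] in simp_all)

lemma dist_int_of_nat_mult: "dist_int (of_nat k * x) \<le> of_nat k * dist_int x"
  using dist_int_of_int_mult[of "int k" x] by simp

lemma sin_sq_dist_int: "(sin (pi * x))\<^sup>2 = (sin (pi * dist_int x))\<^sup>2"
proof -
  obtain m where m: "dist_int x = \<bar>x - of_int m\<bar>"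
    by (rule dist_int_obtain)
  have "(sin (pi * dist_int x))\<^sup>2 = (sin (pi * (x - of_int m)))\<^sup>2"
    unfolding m by (cases "x \<ge> of_int m") (auto simp: abs_if algebra_simps sin_diff)
  also have "\<dots> = (sin (pi * x))\<^sup>2"
    by (simp add: right_diff_distrib sin_diff power_mult_distrib cos_squared_eq)
  finally show ?thesis ..
qed

lemma sin_lower_linear:
  assumes "0 \<le> x" "x \<le> 1 / 2" shows "2 * x \<le> sin (pi * x)"
proof -
  have "concave_on {0..pi/2} sin"
  proof (rule f''_le0_imp_concave[where f' = cos and f'' = "\<lambda>x. - sin x"])
    fix x :: real assume "x \<in> {0..pi/2}"
    then show "- sin x \<le> 0" using sin_ge_zero[of x] by auto
  qed (auto intro!: derivative_eq_intros)
  from concave_onD[OF this, of "2 * x" 0 "pi / 2"] show ?thesis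
    using assms by (simp add: mult.commute)
qed

lemma sin_ge_dist_int: "2 * dist_int x \<le> \<bar>sin (pi * x)\<bar>"
proof (rule power2_le_imp_le)
  have "2 * dist_int x \<le> sin (pi * dist_int x)"
    using dist_int_le_half[of x] by (intro sin_lower_linear) auto
  then have "(2 * dist_int x)\<^sup>2 \<le> (sin (pi * dist_int x))\<^sup>2"
    by (intro power_mono) auto
  then show "(2 * dist_int x)\<^sup>2 \<le> \<bar>sin (pi * x)\<bar>\<^sup>2"
    by (simp add: sin_sq_dist_int[of x])
qed simp

lemma sin_sq_le_dist_int: "(sin (pi * x))\<^sup>2 \<le> pi\<^sup>2 * (dist_int x)\<^sup>2"
proof -
  have "\<bar>sin (pi * dist_int x)\<bar> \<le> \<bar>pi * dist_int x\<bar>" using abs_sin_x_le_abs_x by blast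
  then show ?thesis
    unfolding sin_sq_dist_int[of x] power_mult_distrib[symmetric]
    by (metis abs_le_square_iff)
qed

section \<open>Additive characters and equidistribution of integer multiples\<close>

definition expi :: "real \<Rightarrow> complex" where "expi x = cis (2 * pi * x)"

lemma expi_add: "expi (x + y) = expi x * expi y"
  by (simp add: expi_def cis_mult distrib_left)

lemma expi_0 [simp]: "expi 0 = 1"
  by (simp add: expi_def)

lemma norm_expi [simp]: "norm (expi x) = 1"
  by (simp add: expi_def)

lemma expi_sum: "expi (\<Sum>i\<in>A. f i) = (\<Prod>i\<in>A. expi (f i))"
  by (induction A rule: infinite_finite_induct) (auto simp: expi_add)

lemma expi_of_nat_mult: "expi (real n * x) = expi x ^ n"
  by (simp add: expi_def Complex.DeMoivre algebra_simps)

lemma norm_1_minus_expi: "norm (1 - expi x) = 2 * \<bar>sin (pi * x)\<bar>"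
proof -
  have "(norm (1 - expi x))\<^sup>2 = (2 * \<bar>sin (pi * x)\<bar>)\<^sup>2"
    unfolding expi_def cmod_power2 
    using cos_double_sin[of "pi * x"] sin_cos_squared_add[of "2 * pi * x"]
    by (simp add: power2_eq_square algebra_simps)
  then show ?thesis by (metis abs_ge_zero mult_nonneg_nonneg norm_ge_zero power2_eq_imp_eq zero_le_numeral)
qed

text \<open>A geometric series whose ratio is at distance at least \<open>4 * \<epsilon>\<close>
  from 1. The bound depends neither on the length \<open>M\<close> nor on the starting point
  \<open>X\<close>.\<close>

lemma norm_sum_expi_le:
  assumes "dist_int \<theta> \<ge> \<epsilon>" "\<epsilon> > 0"
  shows "norm (\<Sum>m = X..<X + M. expi (real m * \<theta> + \<phi>)) \<le> 1 / (2 * \<epsilon>)"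
proof -
  have n: "norm (1 - expi \<theta>) \<ge> 4 * \<epsilon>"
    using sin_ge_dist_int[of \<theta>] assms by (simp add: norm_1_minus_expi)
  with \<open>\<epsilon> > 0\<close> have ne: "expi \<theta> \<noteq> 1" by auto
  have "(\<Sum>m = X..<X + M. expi (real m * \<theta> + \<phi>)) = (\<Sum>m<M. expi (real (m + X) * \<theta> + \<phi>))"
    by (rule sum.reindex_bij_witness[where i = "\<lambda>m. m + X" and j = "\<lambda>m. m - X"]) auto
  also have "\<dots> = expi (real X * \<theta> + \<phi>) * (\<Sum>m<M. expi \<theta> ^ m)"
    unfolding sum_distrib_left expi_of_nat_mult[symmetric] expi_add[symmetric]
    by (simp add: algebra_simps)
  also have "norm \<dots> = norm (1 - expi (real M * \<theta>)) / norm (1 - expi \<theta>)"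
    using ne by (simp add: norm_mult sum_gp_strict norm_divide expi_of_nat_mult)
  also have "\<dots> \<le> 2 / (4 * \<epsilon>)"
  proof (rule frac_le)
    show "norm (1 - expi (real M * \<theta>)) \<le> 2"
      using norm_triangle_ineq4[of 1 "expi (real M * \<theta>)"] by simp
  qed (use n \<open>\<epsilon> > 0\<close> in auto)
  finally show ?thesis by simp
qed

text \<open>Expanding the product means choosing one term \<open>\<omega> i\<close> in every factor.
  Choices with all frequencies zero give the main term, every other choice a geometric sum of size
  at most \<open>1 / (2 * \<epsilon>)\<close>. Since the weights are nonnegative with total 1, the
  errors average instead of adding up. Terms are indexed by an abstract type so that single
  frequencies and pairs of them are both covered.\<close>

lemma trig_sum_equidist:
  fixes c :: "'i \<Rightarrow> 'w \<Rightarrow> real" and k :: "'i \<Rightarrow> 'w \<Rightarrow> int" and \<phi> :: "'i \<Rightarrow> 'w \<Rightarrow> real" and \<theta> :: "'i \<Rightarrow> real"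
  assumes I: "finite I" and \<Omega>: "\<And>i. i \<in> I \<Longrightarrow> finite (\<Omega> i)"
    and c0: "\<And>i w. i \<in> I \<Longrightarrow> w \<in> \<Omega> i \<Longrightarrow> c i w \<ge> 0"
    and c1: "\<And>i. i \<in> I \<Longrightarrow> (\<Sum>w\<in>\<Omega> i. c i w) = 1"
    and small: "\<And>\<omega>. \<omega> \<in> Pi\<^sub>E I \<Omega> \<Longrightarrow> \<exists>i\<in>I. k i (\<omega> i) \<noteq> 0 \<Longrightarrow>
                 dist_int (\<Sum>i\<in>I. of_int (k i (\<omega> i)) * \<theta> i) \<ge> \<epsilon>"
    and \<epsilon>: "\<epsilon> > 0"
  shows "norm ((\<Sum>m = X..<X + M. \<Prod>i\<in>I. \<Sum>w\<in>\<Omega> i. of_real (c i w) * expi (of_int (k i w) * (real m * \<theta> i) + \<phi> i w))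
           - of_nat M * (\<Prod>i\<in>I. \<Sum>w\<in>{w \<in> \<Omega> i. k i w = 0}. of_real (c i w) * expi (\<phi> i w))) \<le> 1 / (2 * \<epsilon>)"
proof -
  define Z where "Z = Pi\<^sub>E I (\<lambda>i. {w \<in> \<Omega> i. k i w = 0})"
  define C where "C \<omega> = (\<Prod>i\<in>I. c i (\<omega> i))" for \<omega>
  define \<Theta> where "\<Theta> \<omega> = (\<Sum>i\<in>I. of_int (k i (\<omega> i)) * \<theta> i)" for \<omega>
  define \<Phi> where "\<Phi> \<omega> = (\<Sum>i\<in>I. \<phi> i (\<omega> i))" for \<omega>
  have fin: "finite (Pi\<^sub>E I \<Omega>)" using I \<Omega> by (rule finite_PiE)
  have ZP: "Z \<subseteq> Pi\<^sub>E I \<Omega>" unfolding Z_def by (rule PiE_mono) auto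
  have term1: "(\<Prod>i\<in>I. of_real (c i (\<omega> i)) * expi (of_int (k i (\<omega> i)) * (real m * \<theta> i) + \<phi> i (\<omega> i)))
     = of_real (C \<omega>) * expi (real m * \<Theta> \<omega> + \<Phi> \<omega>)" for m \<omega>
    unfolding C_def \<Theta>_def \<Phi>_def prod.distrib of_real_prod expi_sum[symmetric]
    by (simp add: sum.distrib sum_distrib_left algebra_simps)
  have "(\<Sum>m = X..<X + M. \<Prod>i\<in>I. \<Sum>w\<in>\<Omega> i. of_real (c i w) * expi (of_int (k i w) * (real m * \<theta> i) + \<phi> i w))
      = (\<Sum>\<omega>\<in>Pi\<^sub>E I \<Omega>. of_real (C \<omega>) * (\<Sum>m = X..<X + M. expi (real m * \<Theta> \<omega> + \<Phi> \<omega>)))"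
    by (simp add: prod_sum_PiE[OF I \<Omega>] term1 sum_distrib_left) (rule sum.swap)
  also have "\<dots> = (\<Sum>\<omega>\<in>Z. of_real (C \<omega>) * (\<Sum>m = X..<X + M. expi (real m * \<Theta> \<omega> + \<Phi> \<omega>)))
       + (\<Sum>\<omega>\<in>Pi\<^sub>E I \<Omega> - Z. of_real (C \<omega>) * (\<Sum>m = X..<X + M. expi (real m * \<Theta> \<omega> + \<Phi> \<omega>)))"
    using sum.subset_diff[OF ZP fin] by (simp add: add.commute)
  also have "(\<Sum>\<omega>\<in>Z. of_real (C \<omega>) * (\<Sum>m = X..<X + M. expi (real m * \<Theta> \<omega> + \<Phi> \<omega>)))
      = of_nat M * (\<Prod>i\<in>I. \<Sum>w\<in>{w \<in> \<Omega> i. k i w = 0}. of_real (c i w) * expi (\<phi> i w))"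
  proof -
    have "\<Theta> \<omega> = 0" if "\<omega> \<in> Z" for \<omega>
      unfolding \<Theta>_def using that by (intro sum.neutral) (auto simp: Z_def PiE_def)
    then have "(\<Sum>\<omega>\<in>Z. of_real (C \<omega>) * (\<Sum>m = X..<X + M. expi (real m * \<Theta> \<omega> + \<Phi> \<omega>)))
       = of_nat M * (\<Sum>\<omega>\<in>Z. of_real (C \<omega>) * expi (\<Phi> \<omega>))"
      by (simp add: sum_distrib_left algebra_simps)
    also have "(\<Sum>\<omega>\<in>Z. of_real (C \<omega>) * expi (\<Phi> \<omega>)) = 
        (\<Prod>i\<in>I. \<Sum>w\<in>{w \<in> \<Omega> i. k i w = 0}. of_real (c i w) * expi (\<phi> i w))"
      unfolding Z_def using I \<Omega> by (subst prod_sum_PiE) (auto simp: C_def \<Phi>_def expi_sum prod.distrib)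
    finally show ?thesis .
  qed
  finally have eq: "(\<Sum>m = X..<X + M. \<Prod>i\<in>I. \<Sum>w\<in>\<Omega> i. of_real (c i w) * expi (of_int (k i w) * (real m * \<theta> i) + \<phi> i w))
           - of_nat M * (\<Prod>i\<in>I. \<Sum>w\<in>{w \<in> \<Omega> i. k i w = 0}. of_real (c i w) * expi (\<phi> i w))
       = (\<Sum>\<omega>\<in>Pi\<^sub>E I \<Omega> - Z. of_real (C \<omega>) * (\<Sum>m = X..<X + M. expi (real m * \<Theta> \<omega> + \<Phi> \<omega>)))"
    by simp
  have C0: "C \<omega> \<ge> 0" if "\<omega> \<in> Pi\<^sub>E I \<Omega>" for \<omega>
    unfolding C_def using that c0 by (intro prod_nonneg) (auto simp: PiE_def Pi_def)
  have "norm (\<Sum>\<omega>\<in>Pi\<^sub>E I \<Omega> - Z. of_real (C \<omega>) * (\<Sum>m = X..<X + M. expi (real m * \<Theta> \<omega> + \<Phi> \<omega>)))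
      \<le> (\<Sum>\<omega>\<in>Pi\<^sub>E I \<Omega> - Z. C \<omega> * (1 / (2 * \<epsilon>)))"
  proof (rule sum_norm_le)
    fix \<omega> assume \<omega>: "\<omega> \<in> Pi\<^sub>E I \<Omega> - Z"
    then have "\<exists>i\<in>I. k i (\<omega> i) \<noteq> 0" by (auto simp: Z_def PiE_def Pi_def)
    then have "dist_int (\<Theta> \<omega>) \<ge> \<epsilon>" unfolding \<Theta>_def using \<omega> by (intro small) auto
    then have "norm (\<Sum>m = X..<X + M. expi (real m * \<Theta> \<omega> + \<Phi> \<omega>)) \<le> 1 / (2 * \<epsilon>)"
      using \<epsilon> by (rule norm_sum_expi_le)
    then show "norm (of_real (C \<omega>) * (\<Sum>m = X..<X + M. expi (real m * \<Theta> \<omega> + \<Phi> \<omega>))) \<le> C \<omega> * (1 / (2 * \<epsilon>))"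
      using mult_left_mono[of _ _ "C \<omega>"] C0[of \<omega>] \<omega> by (simp only: norm_mult) fastforce
  qed
  also have "\<dots> \<le> (\<Sum>\<omega>\<in>Pi\<^sub>E I \<Omega>. C \<omega> * (1 / (2 * \<epsilon>)))"
    using fin C0 \<epsilon> by (intro sum_mono2) auto
  also have "\<dots> = (\<Prod>i\<in>I. \<Sum>w\<in>\<Omega> i. c i w) * (1 / (2 * \<epsilon>))"
    by (simp add: prod_sum_PiE[OF I \<Omega>] C_def sum_divide_distrib)
  also have "\<dots> = 1 / (2 * \<epsilon>)" using c1 by simp
  finally show ?thesis unfolding eq .
qed


section \<open>The kernel \<open>cos (\<pi> x) ^ (2 * L)\<close>\<close>

text \<open>A periodic bump at the integers of width about \<open>L\<close> to the power -1/2. Its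
  Fourier coefficients are binomial probabilities: nonnegative, of total 1, and decreasing away from
  0. All three properties are needed below.\<close>

definition cos_ker :: "nat \<Rightarrow> real \<Rightarrow> real" where
  "cos_ker L x = cos (pi * x) ^ (2 * L)"

text \<open>The probability of \<open>L + h\<close> heads in \<open>2 * L\<close> fair coin tosses.
  For \<open>h < - L\<close> the function \<open>nat\<close> truncates and the value is
  \<open>1 / 4 ^ L\<close> instead of 0, so \<open>h\<close> has to be kept within the range from
  \<open>- L\<close> to \<open>L\<close>.\<close>

definition cos_coeff :: "nat \<Rightarrow> int \<Rightarrow> real" where
  "cos_coeff L h = real ((2 * L) choose nat (int L + h)) / 4 ^ L"

lemma cos_ker_nonneg [simp]: "cos_ker L x \<ge> 0"
  unfolding cos_ker_def power_mult by (rule zero_le_power[OF zero_le_power2])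

lemma cos_ker_le_1: "cos_ker L x \<le> 1"
  unfolding cos_ker_def power_mult by (rule power_le_one) (auto simp: abs_square_le_1)

lemma cos_ker_eq: "cos_ker L x = (1 - (sin (pi * x))\<^sup>2) ^ L"
  unfolding cos_ker_def power_mult by (simp add: cos_squared_eq)

lemma cos_coeff_nonneg [simp]: "cos_coeff L h \<ge> 0"
  by (simp add: cos_coeff_def)

lemma cos_ker_fourier:
  "complex_of_real (cos_ker L x) = (\<Sum>h = - int L..int L. of_real (cos_coeff L h) * expi (of_int h * x))"
proof -
  have "complex_of_real (cos (pi * x)) = (cis (pi * x) + cis (- (pi * x))) / 2"
    by (simp add: complex_eq_iff)
  then have "complex_of_real (cos_ker L x) = ((cis (pi * x) + cis (- (pi * x))) / 2) ^ (2 * L)"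
    unfolding cos_ker_def of_real_power by (rule arg_cong)
  also have "\<dots> = (\<Sum>k\<le>2 * L. of_nat ((2 * L) choose k) * cis (pi * x) ^ k * cis (- (pi * x)) ^ (2 * L - k)) / 4 ^ L"
    unfolding power_divide binomial_ring by (simp add: power_mult)
  also have "\<dots> = (\<Sum>k\<le>2 * L. of_real (cos_coeff L (int k - int L)) * expi (of_int (int k - int L) * x))"
    unfolding sum_divide_distrib
  proof (intro sum.cong refl)
    fix k assume "k \<in> {..2 * L}"
    then have "cis (pi * x) ^ k * cis (- (pi * x)) ^ (2 * L - k) = expi (of_int (int k - int L) * x)"
      by (simp add: Complex.DeMoivre cis_mult expi_def of_nat_diff algebra_simps)
    then show "of_nat ((2 * L) choose k) * cis (pi * x) ^ k * cis (- (pi * x)) ^ (2 * L - k) / 4 ^ L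
        = of_real (cos_coeff L (int k - int L)) * expi (of_int (int k - int L) * x)"
      by (simp add: cos_coeff_def mult.assoc)
  qed
  also have "\<dots> = (\<Sum>h = - int L..int L. of_real (cos_coeff L h) * expi (of_int h * x))"
    by (rule sum.reindex_bij_witness[where j = "\<lambda>k. int k - int L" and i = "\<lambda>h. nat (h + int L)"]) auto
  finally show ?thesis .
qed

lemma sum_cos_coeff: "(\<Sum>h = - int L..int L. cos_coeff L h) = 1"
proof -
  have "complex_of_real (\<Sum>h = - int L..int L. cos_coeff L h) = complex_of_real 1"
    using cos_ker_fourier[of L 0] by (simp add: cos_ker_def)
  then show ?thesis by (simp only: of_real_eq_iff)
qed

lemma cos_coeff_uminus:
  assumes "\<bar>h\<bar> \<le> int L" shows "cos_coeff L (- h) = cos_coeff L h"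
proof -
  have "2 * L - nat (int L + h) = nat (int L - h)" using assms by linarith
  then show ?thesis
    using binomial_symmetric[of "nat (int L + h)" "2 * L"] assms by (simp add: cos_coeff_def)
qed

lemma cos_coeff_antimono:
  assumes "\<bar>h\<bar> \<le> \<bar>h'\<bar>" "\<bar>h'\<bar> \<le> int L" shows "cos_coeff L h' \<le> cos_coeff L h"
proof -
  have "cos_coeff L \<bar>h'\<bar> \<le> cos_coeff L \<bar>h\<bar>"
    unfolding cos_coeff_def using assms by (intro divide_right_mono of_nat_mono binomial_antimono) auto
  then show ?thesis using assms cos_coeff_uminus[of h L] cos_coeff_uminus[of h' L] by (auto simp: abs_if split: if_splits)
qed

lemma cos_coeff_Suc_0: "cos_coeff (Suc L) 0 = cos_coeff L 0 * (2 * real L + 1) / (2 * real L + 2)"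
proof -
  have a: "real ((2 * n) choose n) = fact (2 * n) / (fact n * fact n)" for n
    by (subst binomial_fact) (auto simp: mult_2)
  have "fact (2 * Suc L) = (2 * real L + 2) * (2 * real L + 1) * fact (2 * L)"
    by (simp add: algebra_simps)
  then show ?thesis
    using a[of L] a[of "Suc L"]
    by (simp add: cos_coeff_def nat_add_distrib del: fact_Suc mult_Suc_right binomial_Suc_Suc)
      (simp add: divide_simps, simp add: algebra_simps)
qed

text \<open>By the recursion for the central coefficient, its square times \<open>2 * L + 1\<close>
  never increases with \<open>L\<close>, and it equals 1 for \<open>L = 0\<close>.\<close>

lemma cos_coeff_0_upper: "cos_coeff L 0 \<le> 1 / sqrt (2 * real L + 1)"
proof -
  have "(cos_coeff L 0)\<^sup>2 * (2 * real L + 1) \<le> 1"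
  proof (induction L)
    case (Suc L)
    have "(cos_coeff (Suc L) 0)\<^sup>2 * (2 * real (Suc L) + 1)
       = ((cos_coeff L 0)\<^sup>2 * (2 * real L + 1)) * ((2 * real L + 1) * (2 * real L + 3) / (2 * real L + 2)\<^sup>2)"
      unfolding cos_coeff_Suc_0 by (simp add: power_divide power_mult_distrib power2_eq_square algebra_simps)
    also have "\<dots> \<le> 1 * 1"
    proof (rule mult_mono)
      show "(2 * real L + 1) * (2 * real L + 3) / (2 * real L + 2)\<^sup>2 \<le> 1"
        by (subst divide_le_eq_1_pos) (auto simp: power2_eq_square algebra_simps intro!: add_pos_nonneg)
    qed (use Suc in auto)
    finally show ?case by simp
  qed (simp add: cos_coeff_def)
  then have "(cos_coeff L 0)\<^sup>2 \<le> 1 / (2 * real L + 1)" by (simp add: divide_simps)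
  then have "sqrt ((cos_coeff L 0)\<^sup>2) \<le> sqrt (1 / (2 * real L + 1))" by (rule real_sqrt_le_mono)
  then show ?thesis by (simp add: real_sqrt_divide)
qed

text \<open>The square of the central coefficient times \<open>L\<close> never decreases with
  \<open>L\<close>, and it equals 1/4 for \<open>L = 1\<close>.\<close>

lemma cos_coeff_0_lower:
  assumes "L \<ge> 1" shows "cos_coeff L 0 \<ge> 1 / (2 * sqrt (real L))"
proof -
  have "(cos_coeff L 0)\<^sup>2 * real L \<ge> 1 / 4"
    using assms
  proof (induction L rule: nat_induct_at_least)
    case base
    then show ?case by (simp add: cos_coeff_def power2_eq_square)
  next
    case (Suc L)
    have "(1::real) / 4 * 1 \<le> ((cos_coeff L 0)\<^sup>2 * real L) * ((2 * real L + 1)\<^sup>2 / (4 * real L * (real L + 1)))"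
    proof (rule mult_mono)
      show "1 \<le> (2 * real L + 1)\<^sup>2 / (4 * real L * (real L + 1))"
        using Suc(1) by (subst le_divide_eq_1_pos) (auto simp: power2_eq_square algebra_simps intro!: add_pos_pos)
    qed (use Suc in auto)
    also have "\<dots> = (cos_coeff (Suc L) 0)\<^sup>2 * real (Suc L)"
      using Suc(1) unfolding cos_coeff_Suc_0
      by (simp add: power_divide power_mult_distrib power2_eq_square divide_simps) (simp add: algebra_simps)
    finally show ?case by simp
  qed
  then have "(cos_coeff L 0)\<^sup>2 \<ge> 1 / (4 * real L)" using assms by (simp add: divide_simps mult.commute)
  then have "sqrt ((cos_coeff L 0)\<^sup>2) \<ge> sqrt (1 / (4 * real L))" by (rule real_sqrt_le_mono)
  then show ?thesis by (simp add: real_sqrt_divide real_sqrt_mult)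
qed

text \<open>The coefficients grow towards 0, so the one at a nonzero multiple \<open>h\<close> of
  \<open>b\<close> is at most each of those at the \<open>b\<close> integers met on the way from
  \<open>h\<close> towards 0. These runs are disjoint for different \<open>h\<close>, hence
  \<open>b\<close> times the sum over nonzero multiples is at most the total 1.\<close>

lemma sum_cos_coeff_multiples:
  fixes b :: nat assumes "b \<ge> 1"
  shows "(\<Sum>h | h \<in> {- int L..int L} \<and> int b dvd h. cos_coeff L h) \<le> cos_coeff L 0 + 1 / real b"
proof -
  define S where "S = {h \<in> {- int L..int L}. int b dvd h \<and> h \<noteq> 0}"
  have finS: "finite S" by (rule finite_subset[of _ "{- int L..int L}"]) (auto simp: S_def)
  have Sb: "\<bar>h\<bar> \<ge> int b" if "h \<in> S" for h
    using that zdvd_imp_le[of "int b" "\<bar>h\<bar>"] by (auto simp: S_def)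
  define f where "f = (\<lambda>(h, r). h - sgn h * int r)"
  have inj: "inj_on f (S \<times> {..<b})"
  proof (rule inj_onI)
    fix p p' assume p: "p \<in> S \<times> {..<b}" "p' \<in> S \<times> {..<b}" and eq: "f p = f p'"
    obtain h r h' r' where hr: "p = (h, r)" "p' = (h', r')" by (cases p, cases p')
    have hS: "h \<in> S" "h' \<in> S" "r < b" "r' < b" using p hr by auto
    have e: "h - sgn h * int r = h' - sgn h' * int r'" using eq hr by (simp add: f_def)
    \<comment> \<open>A run never reaches 0, because \<open>r < b\<close> while the absolute value
      of \<open>h\<close> is at least \<open>b\<close>; so a common point forces equal
      signs.\<close>
    have sg: "sgn h = sgn h'"
      using Sb[OF hS(1)] Sb[OF hS(2)] hS e assms by (auto simp: sgn_if split: if_splits)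
    have "int b dvd h - h'" using hS by (auto simp: S_def)
    moreover have "h - h' = sgn h * (int r - int r')" using e sg by (simp add: algebra_simps)
    ultimately have "int b dvd \<bar>sgn h * (int r - int r')\<bar>" by simp
    moreover have "\<bar>sgn h * (int r - int r')\<bar> < int b"
      using hS by (auto simp: sgn_if)
    ultimately have "\<bar>sgn h * (int r - int r')\<bar> = 0"
      using zdvd_imp_le by fastforce
    moreover have "sgn h \<noteq> 0" using hS by (auto simp: S_def sgn_if)
    ultimately have "r = r'" by simp
    then show "p = p'" using e sg hr by simp
  qed
  have fle: "\<bar>f (h, r)\<bar> \<le> \<bar>h\<bar>" if "h \<in> S" "r < b" for h r
    using Sb[OF that(1)] that(2) by (auto simp: f_def sgn_if split: if_splits)
  have "real b * (\<Sum>h\<in>S. cos_coeff L h) = (\<Sum>(h, r)\<in>S \<times> {..<b}. cos_coeff L h)"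
    by (simp add: sum.cartesian_product[symmetric] sum_distrib_left)
  also have "\<dots> \<le> (\<Sum>p\<in>S \<times> {..<b}. cos_coeff L (f p))"
  proof (rule sum_mono, clarify)
    fix h r assume "h \<in> S" "r < b"
    then show "cos_coeff L h \<le> cos_coeff L (f (h, r))"
      using fle[of h r] by (intro cos_coeff_antimono) (auto simp: S_def)
  qed
  also have "\<dots> = (\<Sum>j\<in>f ` (S \<times> {..<b}). cos_coeff L j)"
    by (simp add: sum.reindex[OF inj])
  also have "\<dots> \<le> (\<Sum>h = - int L..int L. cos_coeff L h)"
  proof (rule sum_mono2)
    show "f ` (S \<times> {..<b}) \<subseteq> {- int L..int L}"
    proof clarify
      fix h r assume "h \<in> S" "r < b"
      with fle[of h r] show "f (h, r) \<in> {- int L..int L}" by (auto simp: S_def)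
    qed
  qed auto
  finally have "(\<Sum>h\<in>S. cos_coeff L h) \<le> 1 / real b"
    using assms by (simp add: sum_cos_coeff divide_simps mult.commute)
  moreover have "{h \<in> {- int L..int L}. int b dvd h} = insert 0 S"
    by (auto simp: S_def)
  moreover have "0 \<notin> S" by (simp add: S_def)
  ultimately show ?thesis using finS by simp
qed

text \<open>By coprimality a solution has \<open>b\<close> dividing \<open>h\<close> and
  \<open>a\<close> dividing \<open>h'\<close>, and either entry determines the other. Bounding one
  coefficient by its central value leaves a sum over multiples for the other; doing this both ways
  yields the minimum.\<close>

lemma sum_cos_coeff_coprime:
  fixes a b :: nat assumes "a \<ge> 1" "b \<ge> 1" "coprime a b"
  shows "(\<Sum>(h, h') | h \<in> {- int L..int L} \<and> h' \<in> {- int L'..int L'} \<and> int a * h + int b * h' = 0. cos_coeff L h * cos_coeff L' h')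
     \<le> cos_coeff L 0 * cos_coeff L' 0 + min (cos_coeff L 0 / a) (cos_coeff L' 0 / b)"
proof -
  define A where "A = {(h, h'). h \<in> {- int L..int L} \<and> h' \<in> {- int L'..int L'} \<and> int a * h + int b * h' = 0}"
  have "A \<subseteq> {- int L..int L} \<times> {- int L'..int L'}" by (auto simp: A_def)
  then have finA: "finite A" by (rule finite_subset) auto
  have inj1: "inj_on fst A"
  proof (rule inj_onI, clarify)
    fix h h' g g' assume "(h, h') \<in> A" "(g, g') \<in> A" "fst (h, h') = fst (g, g')"
    then have "h = g" "int a * h + int b * h' = int a * g + int b * g'" by (simp_all add: A_def)
    then show "h = g \<and> h' = g'" using assms by simp
  qed
  have inj2: "inj_on snd A"
  proof (rule inj_onI, clarify)
    fix h h' g g' assume "(h, h') \<in> A" "(g, g') \<in> A" "snd (h, h') = snd (g, g')"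
    then have "h' = g'" "int a * h + int b * h' = int a * g + int b * g'" by (simp_all add: A_def)
    then show "h = g \<and> h' = g'" using assms by simp
  qed
  have b1: "int b dvd h" if "(h, h') \<in> A" for h h'
  proof -
    have "int b dvd int a * h" using that by (auto simp: A_def dvd_def) (metis add.inverse_unique mult_minus_right add.commute)
    then show ?thesis using assms(3) by (simp add: coprime_commute coprime_dvd_mult_right_iff)
  qed
  have a1: "int a dvd h'" if "(h, h') \<in> A" for h h'
  proof -
    have "int a dvd int b * h'" using that by (auto simp: A_def dvd_def) (metis add.inverse_unique mult_minus_right)
    then show ?thesis using assms(3) by (simp add: coprime_dvd_mult_right_iff)
  qed
  have "(\<Sum>(h, h')\<in>A. cos_coeff L h * cos_coeff L' h') \<le> (\<Sum>p\<in>A. cos_coeff L (fst p) * cos_coeff L' 0)"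
    by (rule sum_mono) (auto simp: A_def intro!: mult_left_mono cos_coeff_antimono)
  also have "\<dots> = (\<Sum>h\<in>fst ` A. cos_coeff L h) * cos_coeff L' 0"
    by (simp add: sum.reindex[OF inj1] sum_distrib_right)
  also have "\<dots> \<le> (cos_coeff L 0 + 1 / real b) * cos_coeff L' 0"
  proof (rule mult_right_mono)
    have "(\<Sum>h\<in>fst ` A. cos_coeff L h) \<le> (\<Sum>h | h \<in> {- int L..int L} \<and> int b dvd h. cos_coeff L h)"
      by (rule sum_mono2, rule finite_subset[of _ "{- int L..int L}"]) (auto dest: b1, auto simp: A_def)
    also have "\<dots> \<le> cos_coeff L 0 + 1 / real b" by (rule sum_cos_coeff_multiples[OF assms(2)])
    finally show "(\<Sum>h\<in>fst ` A. cos_coeff L h) \<le> cos_coeff L 0 + 1 / real b" .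
  qed simp
  finally have 1: "(\<Sum>(h, h')\<in>A. cos_coeff L h * cos_coeff L' h') \<le> cos_coeff L 0 * cos_coeff L' 0 + cos_coeff L' 0 / b"
    by (simp add: algebra_simps)
  have "(\<Sum>(h, h')\<in>A. cos_coeff L h * cos_coeff L' h') \<le> (\<Sum>p\<in>A. cos_coeff L 0 * cos_coeff L' (snd p))"
    by (rule sum_mono) (auto simp: A_def intro!: mult_right_mono cos_coeff_antimono)
  also have "\<dots> = cos_coeff L 0 * (\<Sum>h\<in>snd ` A. cos_coeff L' h)"
    by (simp add: sum.reindex[OF inj2] sum_distrib_left)
  also have "\<dots> \<le> cos_coeff L 0 * (cos_coeff L' 0 + 1 / real a)"
  proof (rule mult_left_mono)
    have "(\<Sum>h\<in>snd ` A. cos_coeff L' h) \<le> (\<Sum>h | h \<in> {- int L'..int L'} \<and> int a dvd h. cos_coeff L' h)"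
      by (rule sum_mono2, rule finite_subset[of _ "{- int L'..int L'}"]) (auto dest: a1, auto simp: A_def)
    also have "\<dots> \<le> cos_coeff L' 0 + 1 / real a" by (rule sum_cos_coeff_multiples[OF assms(1)])
    finally show "(\<Sum>h\<in>snd ` A. cos_coeff L' h) \<le> cos_coeff L' 0 + 1 / real a" .
  qed simp
  finally have "(\<Sum>(h, h')\<in>A. cos_coeff L h * cos_coeff L' h') \<le> cos_coeff L 0 * cos_coeff L' 0 + cos_coeff L 0 / a"
    by (simp add: algebra_simps)
  with 1 show ?thesis unfolding A_def by simp
qed

text \<open>With \<open>L\<close> about \<open>1 / (16 * y\<^sup>2)\<close> and
  \<open>pi\<^sup>2\<close> at most 12, the product of \<open>L\<close> and the squared sine is at
  most 3/4 on the interval, so Bernoulli's inequality keeps the kernel at least 1/4 there.\<close>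

lemma cos_ker_majorant:
  assumes "0 < y" "y \<le> 1 / 4"
  obtains L where "L \<ge> 1" "real L \<le> 1 / (16 * y\<^sup>2)" "cos_coeff L 0 \<le> 4 * y"
    "\<And>u. dist_int u \<le> y \<Longrightarrow> 1 \<le> 4 * cos_ker L u"
proof
  define L where "L = nat \<lfloor>1 / (16 * y\<^sup>2)\<rfloor>"
  have y2: "16 * y\<^sup>2 \<le> 1" "y\<^sup>2 > 0"
    using assms power_mono[of y "1/4" 2] by (auto simp: power2_eq_square)
  then have ge1: "1 / (16 * y\<^sup>2) \<ge> 1" by (simp add: divide_simps)
  then show "L \<ge> 1" unfolding L_def by linarith
  show Lle: "real L \<le> 1 / (16 * y\<^sup>2)" unfolding L_def using ge1 by linarith
  have "1 / (16 * y\<^sup>2) < 2 * real L + 1" unfolding L_def using ge1 by linarith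
  then have "1 / (2 * real L + 1) \<le> (4 * y)\<^sup>2"
    using y2 by (simp add: divide_simps power_mult_distrib) (simp add: algebra_simps)
  then have "sqrt (1 / (2 * real L + 1)) \<le> 4 * y"
    using assms by (intro real_le_lsqrt) auto
  then show "cos_coeff L 0 \<le> 4 * y"
    using cos_coeff_0_upper[of L] by (simp add: real_sqrt_divide)
  fix u assume u: "dist_int u \<le> y"
  have "pi\<^sup>2 \<le> (16 / 5)\<^sup>2" using pi_approx by (intro power_mono) auto
  then have pi2: "pi\<^sup>2 \<le> 12" by (simp add: power2_eq_square)
  have "(sin (pi * u))\<^sup>2 \<le> pi\<^sup>2 * (dist_int u)\<^sup>2" by (rule sin_sq_le_dist_int)
  also have "\<dots> \<le> 12 * y\<^sup>2" using u pi2 by (intro mult_mono power_mono) auto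
  finally have s: "(sin (pi * u))\<^sup>2 \<le> 12 * y\<^sup>2" .
  have "real L * (sin (pi * u))\<^sup>2 \<le> (1 / (16 * y\<^sup>2)) * (12 * y\<^sup>2)"
    using s Lle y2 by (intro mult_mono) auto
  also have "\<dots> = 3 / 4" using y2 by simp
  finally have "1 / 4 \<le> 1 + real L * (- (sin (pi * u))\<^sup>2)" by simp
  also have "\<dots> \<le> (1 + - (sin (pi * u))\<^sup>2) ^ L"
    by (rule Bernoulli_inequality) (simp add: abs_square_le_1)
  finally show "1 \<le> 4 * cos_ker L u" by (simp add: cos_ker_eq)
qed


section \<open>Counting multiples of a point in a box\<close>

lemma sum_prod_cos_ker:
  fixes \<theta> \<gamma> :: "'i \<Rightarrow> real" and L :: "'i \<Rightarrow> nat"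
  assumes I: "finite I" and \<epsilon>: "\<epsilon> > 0"
    and small: "\<And>h :: 'i \<Rightarrow> int. (\<And>i. i \<in> I \<Longrightarrow> \<bar>h i\<bar> \<le> int (L i)) \<Longrightarrow> \<exists>i\<in>I. h i \<noteq> 0 \<Longrightarrow>
                 dist_int (\<Sum>i\<in>I. of_int (h i) * \<theta> i) \<ge> \<epsilon>"
  shows "\<bar>(\<Sum>m = X..<X + M. \<Prod>i\<in>I. cos_ker (L i) (real m * \<theta> i - \<gamma> i)) - real M * (\<Prod>i\<in>I. cos_coeff (L i) 0)\<bar> \<le> 1 / (2 * \<epsilon>)"
proof -
  have "norm ((\<Sum>m = X..<X + M. \<Prod>i\<in>I. \<Sum>w\<in>{- int (L i)..int (L i)}. complex_of_real (cos_coeff (L i) w) *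
              expi (of_int w * (real m * \<theta> i) + (- of_int w * \<gamma> i)))
           - of_nat M * (\<Prod>i\<in>I. \<Sum>w\<in>{w \<in> {- int (L i)..int (L i)}. w = 0}. of_real (cos_coeff (L i) w) * expi (- of_int w * \<gamma> i))) \<le> 1 / (2 * \<epsilon>)"
  proof (rule trig_sum_equidist[OF I])
    fix \<omega> assume \<omega>: "\<omega> \<in> (\<Pi>\<^sub>E i\<in>I. {- int (L i)..int (L i)})" and ne: "\<exists>i\<in>I. \<omega> i \<noteq> 0"
    show "\<epsilon> \<le> dist_int (\<Sum>i\<in>I. real_of_int (\<omega> i) * \<theta> i)"
    proof (rule small[OF _ ne])
      fix i assume "i \<in> I"
      then show "\<bar>\<omega> i\<bar> \<le> int (L i)" using \<omega> by (auto simp: PiE_iff abs_le_iff)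
    qed
  qed (use \<epsilon> sum_cos_coeff in auto)
  also have "(\<lambda>i. \<Sum>w\<in>{w \<in> {- int (L i)..int (L i)}. w = 0}. complex_of_real (cos_coeff (L i) w) * expi (- of_int w * \<gamma> i))
      = (\<lambda>i. of_real (cos_coeff (L i) 0))"
  proof
    fix i
    have "{w \<in> {- int (L i)..int (L i)}. w = 0} = {0}" by auto
    then show "(\<Sum>w\<in>{w \<in> {- int (L i)..int (L i)}. w = 0}. complex_of_real (cos_coeff (L i) w) * expi (- of_int w * \<gamma> i)) = of_real (cos_coeff (L i) 0)"
      by simp
  qed
  also have "(\<lambda>m. \<Prod>i\<in>I. \<Sum>w\<in>{- int (L i)..int (L i)}. complex_of_real (cos_coeff (L i) w) *
              expi (of_int w * (real m * \<theta> i) + (- of_int w * \<gamma> i)))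
     = (\<lambda>m. of_real (\<Prod>i\<in>I. cos_ker (L i) (real m * \<theta> i - \<gamma> i)))"
    by (simp add: cos_ker_fourier algebra_simps)
  also have "(\<Sum>m = X..<X + M. complex_of_real (\<Prod>i\<in>I. cos_ker (L i) (real m * \<theta> i - \<gamma> i))) -
        of_nat M * (\<Prod>i\<in>I. of_real (cos_coeff (L i) 0))
     = of_real ((\<Sum>m = X..<X + M. \<Prod>i\<in>I. cos_ker (L i) (real m * \<theta> i - \<gamma> i)) - real M * (\<Prod>i\<in>I. cos_coeff (L i) 0))"
    by simp
  finally show ?thesis by (simp only: norm_of_real)
qed

text \<open>Multiples of \<open>a \<theta>\<close> and \<open>b \<theta>\<close> are not
  independent: besides \<open>h = h' = 0\<close>, all solutions of \<open>a * h + b * h' = 0\<close>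
  have frequency zero. These resonances produce the \<open>min\<close> term.\<close>

lemma sum_prod_cos_ker_pair:
  fixes \<theta> \<gamma> :: "'i \<Rightarrow> real" and L L' :: "'i \<Rightarrow> nat"
  assumes I: "finite I" and \<epsilon>: "\<epsilon> > 0" and ab: "a \<ge> 1" "b \<ge> 1" "coprime a b"
    and small: "\<And>h h' :: 'i \<Rightarrow> int. (\<And>i. i \<in> I \<Longrightarrow> \<bar>h i\<bar> \<le> int (L i)) \<Longrightarrow> (\<And>i. i \<in> I \<Longrightarrow> \<bar>h' i\<bar> \<le> int (L' i)) \<Longrightarrow>
        \<exists>i\<in>I. int a * h i + int b * h' i \<noteq> 0 \<Longrightarrow>
                 dist_int (\<Sum>i\<in>I. of_int (int a * h i + int b * h' i) * \<theta> i) \<ge> \<epsilon>"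
  shows "(\<Sum>m = X..<X + M. \<Prod>i\<in>I. cos_ker (L i) (real m * (real a * \<theta> i) - \<gamma> i) * cos_ker (L' i) (real m * (real b * \<theta> i) - \<gamma> i))
     \<le> real M * (\<Prod>i\<in>I. cos_coeff (L i) 0 * cos_coeff (L' i) 0 + min (cos_coeff (L i) 0 / a) (cos_coeff (L' i) 0 / b)) + 1 / (2 * \<epsilon>)"
proof -
  define \<Omega> where "\<Omega> i = {- int (L i)..int (L i)} \<times> {- int (L' i)..int (L' i)}" for i
  define c where "c i w = cos_coeff (L i) (fst w) * cos_coeff (L' i) (snd w)" for i w
  define k where "k i w = int a * fst w + int b * snd w" for i :: 'i and w
  define \<phi> where "\<phi> i w = - of_int (fst w + snd w) * \<gamma> i" for i w
  define Z where "Z i = (\<Sum>w\<in>{w \<in> \<Omega> i. k i w = 0}. complex_of_real (c i w) * expi (\<phi> i w))" for i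
  have main: "norm ((\<Sum>m = X..<X + M. \<Prod>i\<in>I. \<Sum>w\<in>\<Omega> i. complex_of_real (c i w) *
              expi (of_int (k i w) * (real m * \<theta> i) + \<phi> i w)) - of_nat M * (\<Prod>i\<in>I. Z i)) \<le> 1 / (2 * \<epsilon>)"
    unfolding Z_def
  proof (rule trig_sum_equidist[OF I])
    fix \<omega> assume \<omega>: "\<omega> \<in> Pi\<^sub>E I \<Omega>" and ne: "\<exists>i\<in>I. k i (\<omega> i) \<noteq> 0"
    show "\<epsilon> \<le> dist_int (\<Sum>i\<in>I. real_of_int (k i (\<omega> i)) * \<theta> i)"
      unfolding k_def
    proof (rule small)
      show "\<exists>i\<in>I. int a * fst (\<omega> i) + int b * snd (\<omega> i) \<noteq> 0" using ne by (simp add: k_def)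
    next
      fix i assume "i \<in> I"
      then have "\<omega> i \<in> \<Omega> i" using \<omega> by (auto simp: PiE_iff)
      then show "\<bar>fst (\<omega> i)\<bar> \<le> int (L i)" by (auto simp: \<Omega>_def abs_le_iff)
    next
      fix i assume "i \<in> I"
      then have "\<omega> i \<in> \<Omega> i" using \<omega> by (auto simp: PiE_iff)
      then show "\<bar>snd (\<omega> i)\<bar> \<le> int (L' i)" by (auto simp: \<Omega>_def abs_le_iff)
    qed
  next
    fix i
    have "(\<Sum>w\<in>\<Omega> i. c i w) = (\<Sum>h = - int (L i)..int (L i). cos_coeff (L i) h) * (\<Sum>h = - int (L' i)..int (L' i). cos_coeff (L' i) h)"
      unfolding \<Omega>_def c_def sum_product sum.cartesian_product by (simp add: case_prod_unfold)
    then show "(\<Sum>w\<in>\<Omega> i. c i w) = 1" by (simp add: sum_cos_coeff)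
  qed (use \<epsilon> in \<open>auto simp: \<Omega>_def c_def\<close>)
  define F where "F m = (\<Prod>i\<in>I. cos_ker (L i) (real m * (real a * \<theta> i) - \<gamma> i) * cos_ker (L' i) (real m * (real b * \<theta> i) - \<gamma> i))" for m
  have "(\<Sum>w\<in>\<Omega> i. complex_of_real (c i w) * expi (of_int (k i w) * (real m * \<theta> i) + \<phi> i w))
      = of_real (cos_ker (L i) (real m * (real a * \<theta> i) - \<gamma> i) * cos_ker (L' i) (real m * (real b * \<theta> i) - \<gamma> i))" for i m
  proof -
    have e: "expi (of_int (k i (h, h')) * (real m * \<theta> i) + \<phi> i (h, h')) =
        expi (of_int h * (real m * (real a * \<theta> i) - \<gamma> i)) * expi (of_int h' * (real m * (real b * \<theta> i) - \<gamma> i))" for h h'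
      unfolding expi_add[symmetric] by (simp add: k_def \<phi>_def algebra_simps)
    show ?thesis
      unfolding of_real_mult cos_ker_fourier sum_product \<Omega>_def sum.cartesian_product
    proof (rule sum.cong[OF refl], clarify)
      fix h h'
      show "complex_of_real (c i (h, h')) * expi (of_int (k i (h, h')) * (real m * \<theta> i) + \<phi> i (h, h'))
        = complex_of_real (cos_coeff (L i) h) * expi (of_int h * (real m * (real a * \<theta> i) - \<gamma> i)) *
          (complex_of_real (cos_coeff (L' i) h') * expi (of_int h' * (real m * (real b * \<theta> i) - \<gamma> i)))"
        unfolding e by (simp add: c_def)
    qed
  qed
  with main have main': "norm ((\<Sum>m = X..<X + M. complex_of_real (F m)) - of_nat M * (\<Prod>i\<in>I. Z i)) \<le> 1 / (2 * \<epsilon>)"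
    by (simp add: F_def)
  have F0: "F m \<ge> 0" for m by (auto simp: F_def intro!: prod_nonneg)
  have "(\<Sum>m = X..<X + M. F m) = norm (\<Sum>m = X..<X + M. complex_of_real (F m))"
    unfolding of_real_sum[symmetric] norm_of_real using F0 by (simp add: sum_nonneg)
  also have "\<dots> \<le> norm (of_nat M * (\<Prod>i\<in>I. Z i)) + 1 / (2 * \<epsilon>)"
    using main' norm_triangle_sub[of "\<Sum>m = X..<X + M. complex_of_real (F m)" "of_nat M * (\<Prod>i\<in>I. Z i)"] by linarith
  also have "norm (of_nat M * (\<Prod>i\<in>I. Z i)) = real M * (\<Prod>i\<in>I. norm (Z i))"
    by (simp add: norm_mult prod_norm)
  also have "\<dots> \<le> real M * (\<Prod>i\<in>I. cos_coeff (L i) 0 * cos_coeff (L' i) 0 + min (cos_coeff (L i) 0 / a) (cos_coeff (L' i) 0 / b))"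
  proof (intro mult_left_mono prod_mono conjI)
    fix i
    have "norm (Z i) \<le> (\<Sum>w\<in>{w \<in> \<Omega> i. k i w = 0}. c i w)"
      unfolding Z_def by (rule sum_norm_le) (simp add: norm_mult c_def)
    also have "\<dots> = (\<Sum>(h, h') | h \<in> {- int (L i)..int (L i)} \<and> h' \<in> {- int (L' i)..int (L' i)} \<and> int a * h + int b * h' = 0. cos_coeff (L i) h * cos_coeff (L' i) h')"
      by (rule sum.cong) (auto simp: \<Omega>_def k_def c_def)
    also have "\<dots> \<le> cos_coeff (L i) 0 * cos_coeff (L' i) 0 + min (cos_coeff (L i) 0 / a) (cos_coeff (L' i) 0 / b)"
      by (rule sum_cos_coeff_coprime[OF ab])
    finally show "norm (Z i) \<le> cos_coeff (L i) 0 * cos_coeff (L' i) 0 + min (cos_coeff (L i) 0 / a) (cos_coeff (L' i) 0 / b)" .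
  qed auto
  finally show ?thesis by (simp add: F_def)
qed

lemma card_le_sum:
  fixes F :: "'a \<Rightarrow> real"
  assumes "finite A" "\<And>m. m \<in> A \<Longrightarrow> F m \<ge> 0" "\<And>m. m \<in> A \<Longrightarrow> P m \<Longrightarrow> F m \<ge> 1"
  shows "real (card {m \<in> A. P m}) \<le> (\<Sum>m\<in>A. F m)"
proof -
  have "real (card {m \<in> A. P m}) = (\<Sum>m\<in>{m \<in> A. P m}. 1)" by simp
  also have "\<dots> \<le> (\<Sum>m\<in>{m \<in> A. P m}. F m)" by (rule sum_mono) (use assms in auto)
  also have "\<dots> \<le> (\<Sum>m\<in>A. F m)" by (rule sum_mono2) (use assms in auto)
  finally show ?thesis .
qed

lemma cos_ker_majorant_family:
  fixes \<rho> :: "'i \<Rightarrow> real"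
  assumes "\<And>i. i \<in> I \<Longrightarrow> 0 < \<rho> i \<and> \<rho> i \<le> 1 / 4"
  obtains L where "\<And>i. i \<in> I \<Longrightarrow> real (L i) \<le> 1 / (16 * (\<rho> i)\<^sup>2)" "\<And>i. i \<in> I \<Longrightarrow> cos_coeff (L i) 0 \<le> 4 * \<rho> i"
    "\<And>i u. i \<in> I \<Longrightarrow> dist_int u \<le> \<rho> i \<Longrightarrow> 1 \<le> 4 * cos_ker (L i) u"
proof -
  have "\<forall>i\<in>I. \<exists>L. real L \<le> 1 / (16 * (\<rho> i)\<^sup>2) \<and> cos_coeff L 0 \<le> 4 * \<rho> i \<and> (\<forall>u. dist_int u \<le> \<rho> i \<longrightarrow> 1 \<le> 4 * cos_ker L u)"
    by (metis cos_ker_majorant assms)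
  from bchoice[OF this] obtain L where L: "\<forall>i\<in>I. real (L i) \<le> 1 / (16 * (\<rho> i)\<^sup>2) \<and> cos_coeff (L i) 0 \<le> 4 * \<rho> i
      \<and> (\<forall>u. dist_int u \<le> \<rho> i \<longrightarrow> 1 \<le> 4 * cos_ker (L i) u)" ..
  show ?thesis by (rule that[of L]) (use L in auto)
qed

text \<open>Each coordinate condition is majorised by four times its kernel, and the degrees of the
  kernels explain the range of frequencies for which \<open>small\<close> is required.\<close>

lemma card_box_le:
  fixes \<theta> \<gamma> \<rho> :: "'i \<Rightarrow> real"
  assumes I: "finite I" and \<epsilon>: "\<epsilon> > 0" and \<rho>: "\<And>i. i \<in> I \<Longrightarrow> 0 < \<rho> i \<and> \<rho> i \<le> 1 / 4"
    and small: "\<And>h :: 'i \<Rightarrow> int. (\<And>i. i \<in> I \<Longrightarrow> real_of_int \<bar>h i\<bar> \<le> 1 / (16 * (\<rho> i)\<^sup>2)) \<Longrightarrow> \<exists>i\<in>I. h i \<noteq> 0 \<Longrightarrow>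
                 dist_int (\<Sum>i\<in>I. of_int (h i) * \<theta> i) \<ge> \<epsilon>"
  shows "real (card {m \<in> {X..<X + M}. \<forall>i\<in>I. dist_int (real m * \<theta> i - \<gamma> i) \<le> \<rho> i})
     \<le> 4 ^ card I * (real M * (\<Prod>i\<in>I. 4 * \<rho> i) + 1 / (2 * \<epsilon>))"
proof -
  obtain L where L: "\<And>i. i \<in> I \<Longrightarrow> real (L i) \<le> 1 / (16 * (\<rho> i)\<^sup>2)" "\<And>i. i \<in> I \<Longrightarrow> cos_coeff (L i) 0 \<le> 4 * \<rho> i"
    "\<And>i u. i \<in> I \<Longrightarrow> dist_int u \<le> \<rho> i \<Longrightarrow> 1 \<le> 4 * cos_ker (L i) u"
    by (rule cos_ker_majorant_family[of I \<rho>]) (use \<rho> in auto)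
  have "real (card {m \<in> {X..<X + M}. \<forall>i\<in>I. dist_int (real m * \<theta> i - \<gamma> i) \<le> \<rho> i})
     \<le> (\<Sum>m = X..<X + M. \<Prod>i\<in>I. 4 * cos_ker (L i) (real m * \<theta> i - \<gamma> i))"
    by (rule card_le_sum) (auto intro!: prod_nonneg prod_ge_1 L(3))
  also have "\<dots> = 4 ^ card I * (\<Sum>m = X..<X + M. \<Prod>i\<in>I. cos_ker (L i) (real m * \<theta> i - \<gamma> i))"
    by (simp add: prod.distrib sum_distrib_left)
  also have "\<dots> \<le> 4 ^ card I * (real M * (\<Prod>i\<in>I. cos_coeff (L i) 0) + 1 / (2 * \<epsilon>))"
  proof -
    have "\<bar>(\<Sum>m = X..<X + M. \<Prod>i\<in>I. cos_ker (L i) (real m * \<theta> i - \<gamma> i)) - real M * (\<Prod>i\<in>I. cos_coeff (L i) 0)\<bar> \<le> 1 / (2 * \<epsilon>)"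
    proof (rule sum_prod_cos_ker[OF I \<epsilon>])
      fix h assume h: "\<And>i. i \<in> I \<Longrightarrow> \<bar>h i\<bar> \<le> int (L i)" "\<exists>i\<in>I. h i \<noteq> 0"
      show "\<epsilon> \<le> dist_int (\<Sum>i\<in>I. real_of_int (h i) * \<theta> i)"
      proof (rule small[OF _ h(2)])
        fix i assume i: "i \<in> I"
        have "real_of_int \<bar>h i\<bar> \<le> real (L i)" using h(1)[OF i] by linarith
        with L(1)[OF i] show "real_of_int \<bar>h i\<bar> \<le> 1 / (16 * (\<rho> i)\<^sup>2)" by linarith
      qed
    qed
    then show ?thesis by (intro mult_left_mono) auto
  qed
  also have "\<dots> \<le> 4 ^ card I * (real M * (\<Prod>i\<in>I. 4 * \<rho> i) + 1 / (2 * \<epsilon>))"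
    by (intro mult_left_mono add_right_mono prod_mono) (auto intro: L)
  finally show ?thesis .
qed

lemma card_box_pair_le:
  fixes \<theta> \<gamma> \<rho> \<rho>' :: "'i \<Rightarrow> real"
  assumes I: "finite I" and \<epsilon>: "\<epsilon> > 0" and ab: "a \<ge> 1" "b \<ge> 1" "coprime a b"
    and \<rho>: "\<And>i. i \<in> I \<Longrightarrow> 0 < \<rho> i \<and> \<rho> i \<le> 1 / 4" and \<rho>': "\<And>i. i \<in> I \<Longrightarrow> 0 < \<rho>' i \<and> \<rho>' i \<le> 1 / 4"
    and small: "\<And>h h' :: 'i \<Rightarrow> int. (\<And>i. i \<in> I \<Longrightarrow> real_of_int \<bar>h i\<bar> \<le> 1 / (16 * (\<rho> i)\<^sup>2)) \<Longrightarrow> 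
        (\<And>i. i \<in> I \<Longrightarrow> real_of_int \<bar>h' i\<bar> \<le> 1 / (16 * (\<rho>' i)\<^sup>2)) \<Longrightarrow> \<exists>i\<in>I. int a * h i + int b * h' i \<noteq> 0 \<Longrightarrow>
                 dist_int (\<Sum>i\<in>I. of_int (int a * h i + int b * h' i) * \<theta> i) \<ge> \<epsilon>"
  shows "real (card {m \<in> {X..<X + M}. \<forall>i\<in>I. dist_int (real m * (real a * \<theta> i) - \<gamma> i) \<le> \<rho> i \<and> 
              dist_int (real m * (real b * \<theta> i) - \<gamma> i) \<le> \<rho>' i})
     \<le> 16 ^ card I * (real M * (\<Prod>i\<in>I. 16 * \<rho> i * \<rho>' i + min (4 * \<rho> i / a) (4 * \<rho>' i / b)) + 1 / (2 * \<epsilon>))"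
proof -
  obtain L where L: "\<And>i. i \<in> I \<Longrightarrow> real (L i) \<le> 1 / (16 * (\<rho> i)\<^sup>2)" "\<And>i. i \<in> I \<Longrightarrow> cos_coeff (L i) 0 \<le> 4 * \<rho> i"
    "\<And>i u. i \<in> I \<Longrightarrow> dist_int u \<le> \<rho> i \<Longrightarrow> 1 \<le> 4 * cos_ker (L i) u"
    by (rule cos_ker_majorant_family[of I \<rho>]) (use \<rho> in auto)
  obtain L' where L': "\<And>i. i \<in> I \<Longrightarrow> real (L' i) \<le> 1 / (16 * (\<rho>' i)\<^sup>2)" "\<And>i. i \<in> I \<Longrightarrow> cos_coeff (L' i) 0 \<le> 4 * \<rho>' i"
    "\<And>i u. i \<in> I \<Longrightarrow> dist_int u \<le> \<rho>' i \<Longrightarrow> 1 \<le> 4 * cos_ker (L' i) u"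
    by (rule cos_ker_majorant_family[of I \<rho>']) (use \<rho>' in auto)
  have "real (card {m \<in> {X..<X + M}. \<forall>i\<in>I. dist_int (real m * (real a * \<theta> i) - \<gamma> i) \<le> \<rho> i \<and> 
              dist_int (real m * (real b * \<theta> i) - \<gamma> i) \<le> \<rho>' i})
     \<le> (\<Sum>m = X..<X + M. \<Prod>i\<in>I. (4 * cos_ker (L i) (real m * (real a * \<theta> i) - \<gamma> i)) * (4 * cos_ker (L' i) (real m * (real b * \<theta> i) - \<gamma> i)))"
  proof (rule card_le_sum)
    fix m assume "\<forall>i\<in>I. dist_int (real m * (real a * \<theta> i) - \<gamma> i) \<le> \<rho> i \<and> dist_int (real m * (real b * \<theta> i) - \<gamma> i) \<le> \<rho>' i"
    then have "1 * 1 \<le> (4 * cos_ker (L i) (real m * (real a * \<theta> i) - \<gamma> i)) * (4 * cos_ker (L' i) (real m * (real b * \<theta> i) - \<gamma> i))" if "i \<in> I" for i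
      using that by (intro mult_mono L(3) L'(3)) auto
    then show "1 \<le> (\<Prod>i\<in>I. (4 * cos_ker (L i) (real m * (real a * \<theta> i) - \<gamma> i)) * (4 * cos_ker (L' i) (real m * (real b * \<theta> i) - \<gamma> i)))"
      by (intro prod_ge_1) auto
  qed (auto intro!: prod_nonneg)
  also have "\<dots> = (\<Sum>m = X..<X + M. \<Prod>i\<in>I. 16 * (cos_ker (L i) (real m * (real a * \<theta> i) - \<gamma> i) * cos_ker (L' i) (real m * (real b * \<theta> i) - \<gamma> i)))"
    by (simp add: algebra_simps)
  also have "\<dots> = 16 ^ card I * (\<Sum>m = X..<X + M. \<Prod>i\<in>I. cos_ker (L i) (real m * (real a * \<theta> i) - \<gamma> i) * cos_ker (L' i) (real m * (real b * \<theta> i) - \<gamma> i))"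
    by (simp add: prod.distrib sum_distrib_left)
  also have "\<dots> \<le> 16 ^ card I * (real M * (\<Prod>i\<in>I. cos_coeff (L i) 0 * cos_coeff (L' i) 0 + min (cos_coeff (L i) 0 / a) (cos_coeff (L' i) 0 / b)) + 1 / (2 * \<epsilon>))"
  proof (rule mult_left_mono, rule sum_prod_cos_ker_pair[OF I \<epsilon> ab])
    fix h h' assume h: "\<And>i. i \<in> I \<Longrightarrow> \<bar>h i\<bar> \<le> int (L i)" "\<And>i. i \<in> I \<Longrightarrow> \<bar>h' i\<bar> \<le> int (L' i)"
      "\<exists>i\<in>I. int a * h i + int b * h' i \<noteq> 0"
    show "\<epsilon> \<le> dist_int (\<Sum>i\<in>I. real_of_int (int a * h i + int b * h' i) * \<theta> i)"
    proof (rule small[OF _ _ h(3)])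
      fix i assume i: "i \<in> I"
      have "real_of_int \<bar>h i\<bar> \<le> real (L i)" using h(1)[OF i] by linarith
      with L(1)[OF i] show "real_of_int \<bar>h i\<bar> \<le> 1 / (16 * (\<rho> i)\<^sup>2)" by linarith
    next
      fix i assume i: "i \<in> I"
      have "real_of_int \<bar>h' i\<bar> \<le> real (L' i)" using h(2)[OF i] by linarith
      with L'(1)[OF i] show "real_of_int \<bar>h' i\<bar> \<le> 1 / (16 * (\<rho>' i)\<^sup>2)" by linarith
    qed
  qed auto
  also have "\<dots> \<le> 16 ^ card I * (real M * (\<Prod>i\<in>I. 16 * \<rho> i * \<rho>' i + min (4 * \<rho> i / a) (4 * \<rho>' i / b)) + 1 / (2 * \<epsilon>))"
  proof (intro mult_left_mono add_right_mono prod_mono conjI)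
    fix i assume i: "i \<in> I"
    have "cos_coeff (L i) 0 * cos_coeff (L' i) 0 \<le> (4 * \<rho> i) * (4 * \<rho>' i)"
      using L(2)[OF i] L'(2)[OF i] \<rho>[OF i] by (intro mult_mono) auto
    moreover have "min (cos_coeff (L i) 0 / a) (cos_coeff (L' i) 0 / b) \<le> min (4 * \<rho> i / a) (4 * \<rho>' i / b)"
      using L(2)[OF i] L'(2)[OF i] by (intro min.mono divide_right_mono) auto
    ultimately show "cos_coeff (L i) 0 * cos_coeff (L' i) 0 + min (cos_coeff (L i) 0 / a) (cos_coeff (L' i) 0 / b) \<le> 16 * \<rho> i * \<rho>' i + min (4 * \<rho> i / a) (4 * \<rho>' i / b)"
      by linarith
  qed auto
  finally show ?thesis .
qed

text \<open>A lower bound needs a minorant of the box. Subtracting from the product kernel, for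
  every coordinate, the kernel times the squared sine over \<open>4 * (\<rho> i)\<^sup>2\<close>
  makes the value nonpositive outside the box. Kernel times squared sine is the difference of the
  kernels for \<open>L i\<close> and \<open>L i + 1\<close>, so the minorant remains a combination
  of product kernels.\<close>

lemma card_box_ge:
  fixes \<theta> \<gamma> \<rho> :: "'i \<Rightarrow> real"
  assumes I: "finite I" "card I \<ge> 1" and \<epsilon>: "\<epsilon> > 0" and \<rho>: "\<And>i. i \<in> I \<Longrightarrow> 0 < \<rho> i \<and> \<rho> i \<le> 1 / 4"
    and small: "\<And>h :: 'i \<Rightarrow> int. (\<And>i. i \<in> I \<Longrightarrow> real_of_int \<bar>h i\<bar> \<le> 2 * card I / (\<rho> i)\<^sup>2) \<Longrightarrow> \<exists>i\<in>I. h i \<noteq> 0 \<Longrightarrow>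
                 dist_int (\<Sum>i\<in>I. of_int (h i) * \<theta> i) \<ge> \<epsilon>"
  shows "real (card {m \<in> {X..<X + M}. \<forall>i\<in>I. dist_int (real m * \<theta> i - \<gamma> i) \<le> \<rho> i})
     \<ge> real M / 2 * (\<Prod>i\<in>I. \<rho> i / (2 * sqrt (2 * card I))) - (1 + (\<Sum>i\<in>I. 1 / (\<rho> i)\<^sup>2)) / \<epsilon>"
proof -
  define L where "L i = nat \<lceil>card I / (\<rho> i)\<^sup>2\<rceil>" for i
  define P where "P K m = (\<Prod>i\<in>I. cos_ker (K i) (real m * \<theta> i - \<gamma> i))" for K m
  define A where "A K = (\<Sum>m = X..<X + M. P K m)" for K
  define Pr where "Pr = (\<Prod>i\<in>I. cos_coeff (L i) 0)"
  \<comment> \<open>The minorant: at most 1 inside the box, at most 0 as soon as one coordinate is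
    too far away.\<close>
  define Q where "Q m = P L m - (\<Sum>i\<in>I. (P L m - P (L(i := Suc (L i))) m) / (4 * (\<rho> i)\<^sup>2))" for m
  have L1: "real (L i) \<ge> card I / (\<rho> i)\<^sup>2" "real (L i) + 1 \<le> 2 * card I / (\<rho> i)\<^sup>2" "L i \<ge> 1" if "i \<in> I" for i
  proof -
    have "(\<rho> i)\<^sup>2 \<le> (1 / 4)\<^sup>2" using \<rho>[OF that] by (intro power_mono) auto
    then have "(\<rho> i)\<^sup>2 \<le> 1 / 16" "0 < (\<rho> i)\<^sup>2" using \<rho>[OF that] by (auto simp: power2_eq_square)
    then have "real (card I) / (\<rho> i)\<^sup>2 \<ge> 16" using I by (simp add: divide_simps)
    then show "real (L i) \<ge> card I / (\<rho> i)\<^sup>2" "real (L i) + 1 \<le> 2 * card I / (\<rho> i)\<^sup>2" "L i \<ge> 1"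
      unfolding L_def by linarith+
  qed
  have P0: "P K m \<ge> 0" for K m by (auto simp: P_def intro!: prod_nonneg)
  have P1: "P K m \<le> 1" for K m by (auto simp: P_def cos_ker_le_1 intro!: prod_le_1)
  have PSuc: "P (K(i := Suc (K i))) m = P K m * (cos (pi * (real m * \<theta> i - \<gamma> i)))\<^sup>2" if "i \<in> I" for K i m
  proof -
    have "P (K(i := Suc (K i))) m = cos_ker (Suc (K i)) (real m * \<theta> i - \<gamma> i) * (\<Prod>j\<in>I - {i}. cos_ker (K j) (real m * \<theta> j - \<gamma> j))"
      unfolding P_def using I that by (subst prod.remove[of I i]) auto
    also have "cos_ker (Suc (K i)) (real m * \<theta> i - \<gamma> i) = cos_ker (K i) (real m * \<theta> i - \<gamma> i) * (cos (pi * (real m * \<theta> i - \<gamma> i)))\<^sup>2"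
      by (simp add: cos_ker_def power2_eq_square)
    finally show ?thesis
      unfolding P_def using I that by (subst prod.remove[of I i]) auto
  qed
  then have Pdiff: "P L m - P (L(i := Suc (L i))) m = P L m * (sin (pi * (real m * \<theta> i - \<gamma> i)))\<^sup>2" if "i \<in> I" for i m
    using that by (simp add: cos_squared_eq algebra_simps)
  have Q: "Q m \<le> (if \<forall>i\<in>I. dist_int (real m * \<theta> i - \<gamma> i) \<le> \<rho> i then 1 else 0)" for m
  proof (cases "\<forall>i\<in>I. dist_int (real m * \<theta> i - \<gamma> i) \<le> \<rho> i")
    case True
    have "(\<Sum>i\<in>I. (P L m - P (L(i := Suc (L i))) m) / (4 * (\<rho> i)\<^sup>2)) \<ge> 0"
      by (intro sum_nonneg) (simp add: Pdiff P0)
    with P1[of L m] True show ?thesis by (simp add: Q_def)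
  next
    case False
    then obtain i where i: "i \<in> I" "dist_int (real m * \<theta> i - \<gamma> i) > \<rho> i" by force
    have "(2 * \<rho> i)\<^sup>2 \<le> \<bar>sin (pi * (real m * \<theta> i - \<gamma> i))\<bar>\<^sup>2"
      using sin_ge_dist_int[of "real m * \<theta> i - \<gamma> i"] i \<rho>[of i] by (intro power_mono) auto
    then have "1 \<le> (sin (pi * (real m * \<theta> i - \<gamma> i)))\<^sup>2 / (4 * (\<rho> i)\<^sup>2)"
      using \<rho>[OF i(1)] by (simp add: power_mult_distrib)
    then have "P L m * 1 \<le> P L m * ((sin (pi * (real m * \<theta> i - \<gamma> i)))\<^sup>2 / (4 * (\<rho> i)\<^sup>2))"
      using P0 by (intro mult_left_mono) auto
    also have "\<dots> = (P L m - P (L(i := Suc (L i))) m) / (4 * (\<rho> i)\<^sup>2)"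
      using i by (simp add: Pdiff)
    also have "\<dots> \<le> (\<Sum>i\<in>I. (P L m - P (L(i := Suc (L i))) m) / (4 * (\<rho> i)\<^sup>2))"
      using I i by (intro member_le_sum) (simp_all add: Pdiff P0)
    finally show ?thesis using False by (simp add: Q_def)
  qed
  have est: "\<bar>A K - real M * (\<Prod>i\<in>I. cos_coeff (K i) 0)\<bar> \<le> 1 / (2 * \<epsilon>)" if K: "\<And>i. i \<in> I \<Longrightarrow> K i \<le> Suc (L i)" for K
    unfolding A_def P_def
  proof (rule sum_prod_cos_ker[OF I(1) \<epsilon>])
    fix h assume h: "\<And>i. i \<in> I \<Longrightarrow> \<bar>h i\<bar> \<le> int (K i)" "\<exists>i\<in>I. h i \<noteq> 0"
    show "\<epsilon> \<le> dist_int (\<Sum>i\<in>I. real_of_int (h i) * \<theta> i)"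
    proof (rule small[OF _ h(2)])
      fix i assume i: "i \<in> I"
      have "real_of_int \<bar>h i\<bar> \<le> real (L i) + 1" using h(1)[OF i] K[OF i] by linarith
      with L1(2)[OF i] show "real_of_int \<bar>h i\<bar> \<le> 2 * card I / (\<rho> i)\<^sup>2" by linarith
    qed
  qed
  have AL: "\<bar>A L - real M * Pr\<bar> \<le> 1 / (2 * \<epsilon>)" unfolding Pr_def by (rule est) auto
  have Pr0: "Pr \<ge> 0" by (auto simp: Pr_def intro!: prod_nonneg)
  \<comment> \<open>Raising \<open>L i\<close> by one lowers the mean by the proportion
    \<open>1 / (2 * L i + 2)\<close>. The choice of \<open>L i\<close> of size at least
    \<open>card I / (\<rho> i)\<^sup>2\<close> makes each correction at most
    \<open>1 / (8 * card I)\<close> of the main term, hence an eighth altogether.\<close>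
  have AD: "(A L - A (L(i := Suc (L i)))) / (4 * (\<rho> i)\<^sup>2) \<le> real M * Pr / (8 * card I) + (1 / \<epsilon>) / (4 * (\<rho> i)\<^sup>2)" if i: "i \<in> I" for i
  proof -
    have rp: "(\<rho> i)\<^sup>2 > 0" using \<rho>[OF i] by auto
    have "(\<Prod>j\<in>I. cos_coeff ((L(i := Suc (L i))) j) 0) = cos_coeff (Suc (L i)) 0 * (\<Prod>j\<in>I - {i}. cos_coeff (L j) 0)"
      using I i by (subst prod.remove[of I i]) auto
    also have "\<dots> = Pr * ((2 * real (L i) + 1) / (2 * real (L i) + 2))"
      unfolding cos_coeff_Suc_0 Pr_def using prod.remove[OF I(1) i, of "\<lambda>i. cos_coeff (L i) 0"] by simp
    finally have eq: "(\<Prod>j\<in>I. cos_coeff ((L(i := Suc (L i))) j) 0) = Pr - Pr / (2 * real (L i) + 2)"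
      by (simp add: divide_simps) (simp add: algebra_simps)
    have "\<bar>A (L(i := Suc (L i))) - real M * (Pr - Pr / (2 * real (L i) + 2))\<bar> \<le> 1 / (2 * \<epsilon>)"
      unfolding eq[symmetric] by (rule est) auto
    with AL have "A L - A (L(i := Suc (L i))) \<le> real M * Pr / (2 * real (L i) + 2) + 1 / \<epsilon>"
      by (simp add: algebra_simps abs_le_iff)
    also have "real M * Pr / (2 * real (L i) + 2) \<le> real M * Pr / (2 * (card I / (\<rho> i)\<^sup>2))"
      using L1(1)[OF i] Pr0 I rp by (intro divide_left_mono) (auto intro!: mult_pos_pos add_pos_pos divide_pos_pos)
    finally have "(A L - A (L(i := Suc (L i)))) / (4 * (\<rho> i)\<^sup>2) \<le> (real M * Pr / (2 * (card I / (\<rho> i)\<^sup>2)) + 1 / \<epsilon>) / (4 * (\<rho> i)\<^sup>2)"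
      using rp by (intro divide_right_mono) auto
    also have "\<dots> = real M * Pr / (8 * card I) + (1 / \<epsilon>) / (4 * (\<rho> i)\<^sup>2)"
      using rp I by (simp add: add_divide_distrib)
    finally show ?thesis .
  qed
  have "(\<Sum>i\<in>I. (A L - A (L(i := Suc (L i)))) / (4 * (\<rho> i)\<^sup>2)) \<le> (\<Sum>i\<in>I. real M * Pr / (8 * card I) + (1 / \<epsilon>) / (4 * (\<rho> i)\<^sup>2))"
    by (rule sum_mono) (rule AD)
  also have "\<dots> = real M * Pr / 8 + (\<Sum>i\<in>I. 1 / (\<rho> i)\<^sup>2) / (4 * \<epsilon>)"
    using I by (cases "I = {}") (auto simp: sum.distrib sum_divide_distrib mult_ac)
  finally have S: "(\<Sum>i\<in>I. (A L - A (L(i := Suc (L i)))) / (4 * (\<rho> i)\<^sup>2)) \<le> real M * Pr / 8 + (\<Sum>i\<in>I. 1 / (\<rho> i)\<^sup>2) / (4 * \<epsilon>)" .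
  have sumQ: "(\<Sum>m = X..<X + M. Q m) = A L - (\<Sum>i\<in>I. (A L - A (L(i := Suc (L i)))) / (4 * (\<rho> i)\<^sup>2))"
    unfolding Q_def A_def sum_subtractf
    by (subst sum.swap) (simp only: sum_divide_distrib[symmetric] sum_subtractf)
  have "(\<Prod>i\<in>I. \<rho> i / (2 * sqrt (2 * card I))) \<le> Pr"
    unfolding Pr_def
  proof (intro prod_mono conjI)
    fix i assume i: "i \<in> I"
    have r: "\<rho> i > 0" using \<rho>[OF i] by simp
    have "real (L i) \<le> 2 * card I / (\<rho> i)\<^sup>2" using L1(2)[OF i] by linarith
    then have "sqrt (real (L i)) \<le> sqrt (2 * card I / (\<rho> i)\<^sup>2)" by (rule real_sqrt_le_mono)
    also have "\<dots> = sqrt (2 * card I) / \<rho> i" using r by (simp add: real_sqrt_divide)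
    finally have "1 / (2 * (sqrt (2 * card I) / \<rho> i)) \<le> 1 / (2 * sqrt (real (L i)))"
      using L1(3)[OF i] r I by (intro divide_left_mono) (auto intro!: mult_pos_pos divide_pos_pos)
    also have "\<dots> \<le> cos_coeff (L i) 0" by (rule cos_coeff_0_lower[OF L1(3)[OF i]])
    finally show "\<rho> i / (2 * sqrt (2 * card I)) \<le> cos_coeff (L i) 0" by simp
    show "0 \<le> \<rho> i / (2 * sqrt (2 * card I))" using r by simp
  qed
  then have "real M / 2 * (\<Prod>i\<in>I. \<rho> i / (2 * sqrt (2 * card I))) \<le> real M / 2 * Pr"
    by (intro mult_left_mono) auto
  moreover have "real M * Pr \<ge> 0" using Pr0 by simp
  moreover have "(\<Sum>i\<in>I. 1 / (\<rho> i)\<^sup>2) / (4 * \<epsilon>) \<le> (\<Sum>i\<in>I. 1 / (\<rho> i)\<^sup>2) / \<epsilon>"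
    using \<epsilon> by (intro divide_left_mono sum_nonneg) auto
  moreover have "1 / (2 * \<epsilon>) \<le> 1 / \<epsilon>" using \<epsilon> by (simp add: divide_simps)
  ultimately have "real M / 2 * (\<Prod>i\<in>I. \<rho> i / (2 * sqrt (2 * card I))) - (1 + (\<Sum>i\<in>I. 1 / (\<rho> i)\<^sup>2)) / \<epsilon>
      \<le> (\<Sum>m = X..<X + M. Q m)"
    unfolding sumQ add_divide_distrib using S AL by linarith
  also have "\<dots> \<le> (\<Sum>m = X..<X + M. if \<forall>i\<in>I. dist_int (real m * \<theta> i - \<gamma> i) \<le> \<rho> i then 1 else 0)"
    by (rule sum_mono) (rule Q)
  also have "\<dots> = real (card {m \<in> {X..<X + M}. \<forall>i\<in>I. dist_int (real m * \<theta> i - \<gamma> i) \<le> \<rho> i})"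
    by (subst sum.inter_filter[symmetric]) auto
  finally show ?thesis .
qed


section \<open>Measures of periodic sets\<close>

lemma borel_measurable_dist_int [measurable]: "dist_int \<in> borel_measurable borel"
  unfolding dist_int_def [abs_def] round_def by measurable

lemma has_integral_expi:
  "((\<lambda>x. expi (of_int k * x + \<phi>)) has_integral (if k = 0 then expi \<phi> else 0)) {0..1}"
proof (cases "k = 0")
  case True
  then show ?thesis using has_integral_const_real[of "expi \<phi>" 0 1] by simp
next
  case False
  define a where "a = \<i> * of_real (2 * pi * of_int k)"
  have a0: "a \<noteq> 0" using False by (simp add: a_def)
  have e: "expi (of_int k * x + \<phi>) = expi \<phi> * exp (a * of_real x)" for x
    by (simp add: expi_def a_def cis_conv_exp distrib_left exp_add algebra_simps)
  have "\<And>t. t \<in> {0..1} \<Longrightarrow> ((\<lambda>x. expi \<phi> * (exp (a * x) / a)) has_vector_derivative expi \<phi> * exp (a * t)) (at t within {0..1})"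
    using a0
    by (intro derivative_eq_intros has_complex_derivative_imp_has_vector_derivative [unfolded o_def] | simp)+
  then have "((\<lambda>t. expi \<phi> * exp (a * of_real t)) has_integral
     expi \<phi> * (exp (a * complex_of_real 1) / a) - expi \<phi> * (exp (a * complex_of_real 0) / a)) {0..1}"
    by (rule fundamental_theorem_of_calculus[rotated]) simp_all
  moreover have "exp (a * complex_of_real 1) = 1"
  proof -
    have "exp (a * complex_of_real 1) = expi (of_int k * 1)" using e[of 1] by (simp add: expi_def cis_conv_exp a_def algebra_simps)
    also have "\<dots> = 1" by (simp add: expi_def cis_multiple_2pi)
    finally show ?thesis .
  qed
  ultimately show ?thesis using False by (simp add: e)
qed

text \<open>The analogue of the pair count with an integral over \<open>x\<close> in place of a sum
  over \<open>m\<close>. Orthogonality is exact here, and the common factor \<open>g\<close> does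
  not affect which frequencies vanish.\<close>

lemma integral_cos_ker_pair:
  fixes a b :: nat
  assumes ab: "a \<ge> 1" "b \<ge> 1" "coprime a b" and g: "g \<ge> 1"
  shows "((\<lambda>x. cos_ker L (real (g * a) * x - \<gamma>) * cos_ker L' (real (g * b) * x - \<gamma>)) has_integral 
           integral {0..1} (\<lambda>x. cos_ker L (real (g * a) * x - \<gamma>) * cos_ker L' (real (g * b) * x - \<gamma>))) {0..1}" (is ?A)
    and "integral {0..1} (\<lambda>x. cos_ker L (real (g * a) * x - \<gamma>) * cos_ker L' (real (g * b) * x - \<gamma>))
       \<le> cos_coeff L 0 * cos_coeff L' 0 + min (cos_coeff L 0 / a) (cos_coeff L' 0 / b)" (is ?B)
proof -
  define F where "F x = cos_ker L (real (g * a) * x - \<gamma>) * cos_ker L' (real (g * b) * x - \<gamma>)" for x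
  define \<Omega> where "\<Omega> = {- int L..int L} \<times> {- int L'..int L'}"
  define c where "c w = cos_coeff L (fst w) * cos_coeff L' (snd w)" for w
  define k where "k w = int g * (int a * fst w + int b * snd w)" for w
  define \<phi> where "\<phi> w = - of_int (fst w + snd w) * \<gamma>" for w
  have "continuous_on {0..1} F"
    unfolding F_def cos_ker_def by (intro continuous_intros)
  then have "F integrable_on {0..1}" by (rule integrable_continuous_real)
  then have 1: "(F has_integral integral {0..1} F) {0..1}" by (rule integrable_integral)
  then show ?A unfolding F_def .
  have "((\<lambda>x. complex_of_real (F x)) has_integral of_real (integral {0..1} F)) {0..1}"
    using has_integral_linear[OF 1 bounded_linear_of_real] by (simp add: o_def)
  moreover have "complex_of_real (F x) = (\<Sum>w\<in>\<Omega>. of_real (c w) * expi (of_int (k w) * x + \<phi> w))" for x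
  proof -
    have e: "expi (of_int (k (h, h')) * x + \<phi> (h, h')) =
        expi (of_int h * (real (g * a) * x - \<gamma>)) * expi (of_int h' * (real (g * b) * x - \<gamma>))" for h h'
      unfolding expi_add[symmetric] by (simp add: k_def \<phi>_def algebra_simps)
    show ?thesis
      unfolding F_def of_real_mult cos_ker_fourier sum_product \<Omega>_def sum.cartesian_product
    proof (rule sum.cong[OF refl], clarify)
      fix h h'
      show "complex_of_real (cos_coeff L h) * expi (of_int h * (real (g * a) * x - \<gamma>)) *
          (complex_of_real (cos_coeff L' h') * expi (of_int h' * (real (g * b) * x - \<gamma>))) = 
          complex_of_real (c (h, h')) * expi (of_int (k (h, h')) * x + \<phi> (h, h'))"
        unfolding e by (simp add: c_def)
    qed
  qed
  moreover have "((\<lambda>x. \<Sum>w\<in>\<Omega>. of_real (c w) * expi (of_int (k w) * x + \<phi> w)) has_integral 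
      (\<Sum>w\<in>\<Omega>. of_real (c w) * (if k w = 0 then expi (\<phi> w) else 0))) {0..1}"
    by (intro has_integral_sum has_integral_mult_right has_integral_expi) (simp add: \<Omega>_def)
  ultimately have eq: "complex_of_real (integral {0..1} F) = (\<Sum>w\<in>\<Omega>. of_real (c w) * (if k w = 0 then expi (\<phi> w) else 0))"
    by (simp add: has_integral_unique)
  have "integral {0..1} F \<le> norm (complex_of_real (integral {0..1} F))" by simp
  also have "\<dots> \<le> (\<Sum>w\<in>\<Omega>. c w * (if k w = 0 then 1 else 0))"
    unfolding eq by (rule sum_norm_le) (simp add: norm_mult c_def)
  also have "\<dots> = (\<Sum>(h, h') | h \<in> {- int L..int L} \<and> h' \<in> {- int L'..int L'} \<and> int a * h + int b * h' = 0. cos_coeff L h * cos_coeff L' h')"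
    using g by (intro sum.mono_neutral_cong_right) (auto simp: \<Omega>_def k_def c_def)
  also have "\<dots> \<le> cos_coeff L 0 * cos_coeff L' 0 + min (cos_coeff L 0 / a) (cos_coeff L' 0 / b)"
    by (rule sum_cos_coeff_coprime[OF ab])
  finally show ?B unfolding F_def .
qed

text \<open>The first term is the product of the measures up to a constant. The second is the
  resonance term for \<open>a = n / g\<close> and \<open>b = n' / g\<close>, where passing from
  \<open>a\<close>, \<open>b\<close> back to \<open>n\<close>, \<open>n'\<close> brings out the
  factor \<open>gcd n n'\<close>.\<close>

lemma measure_pair_le:
  fixes n n' :: nat
  assumes n: "n \<ge> 1" "n' \<ge> 1" and y: "0 < y" "y \<le> 1 / 4" and y': "0 < y'" "y' \<le> 1 / 4"
  shows "measure lborel {x \<in> {0..<1}. dist_int (real n * x - \<gamma>) < y \<and> dist_int (real n' * x - \<gamma>) < y'}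
     \<le> 256 * y * y' + 64 * real (gcd n n') * min (y / n) (y' / n')"
proof -
  define S where "S = {x \<in> {0..<1}. dist_int (real n * x - \<gamma>) < y \<and> dist_int (real n' * x - \<gamma>) < y'}"
  obtain L where L: "cos_coeff L 0 \<le> 4 * y" "\<And>u. dist_int u \<le> y \<Longrightarrow> 1 \<le> 4 * cos_ker L u"
    using cos_ker_majorant[OF y] by metis
  obtain L' where L': "cos_coeff L' 0 \<le> 4 * y'" "\<And>u. dist_int u \<le> y' \<Longrightarrow> 1 \<le> 4 * cos_ker L' u"
    using cos_ker_majorant[OF y'] by metis
  define g where "g = gcd n n'"
  have g: "g \<ge> 1" using n by (simp add: g_def Suc_le_eq)
  obtain a b where ab: "n = g * a" "n' = g * b" "coprime a b"
    unfolding g_def by (metis gcd_coprime_exists gcd_eq_0_iff mult.commute n(1) not_one_le_zero)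
  have ab1: "a \<ge> 1" "b \<ge> 1" using ab n g by (auto simp: Suc_le_eq)
  define F where "F x = cos_ker L (real (g * a) * x - \<gamma>) * cos_ker L' (real (g * b) * x - \<gamma>)" for x
  note int = integral_cos_ker_pair[OF ab1 ab(3) g, of L \<gamma> L', folded F_def]
  have Sm: "S \<in> sets lborel" unfolding S_def by measurable
  have "emeasure lborel S \<le> emeasure lborel {0..1::real}"
    by (rule emeasure_mono) (auto simp: S_def)
  also have "\<dots> < \<infinity>" by simp
  finally have "((\<lambda>x. 1) has_integral measure lborel S) S"
    using Sm by (intro has_integral_measure_lborel) auto
  then have 1: "((\<lambda>x. if x \<in> S then 1 else 0) has_integral measure lborel S) {0..1}"
    by (subst has_integral_restrict) (auto simp: S_def)
  have 2: "((\<lambda>x. 16 * F x) has_integral 16 * integral {0..1} F) {0..1}"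
    by (rule has_integral_mult_right) (rule int)
  have "measure lborel S \<le> 16 * integral {0..1} F"
  proof (rule has_integral_le[OF 1 2])
    fix x :: real
    show "(if x \<in> S then 1 else 0) \<le> 16 * F x"
    proof (cases "x \<in> S")
      case True
      then have "1 * 1 \<le> (4 * cos_ker L (real n * x - \<gamma>)) * (4 * cos_ker L' (real n' * x - \<gamma>))"
        by (intro mult_mono L L') (auto simp: S_def)
      with True show ?thesis by (simp add: F_def ab)
    qed (simp add: F_def)
  qed
  also have "\<dots> \<le> 16 * (cos_coeff L 0 * cos_coeff L' 0 + min (cos_coeff L 0 / a) (cos_coeff L' 0 / b))"
    using int(2) by simp
  also have "\<dots> \<le> 16 * ((4 * y) * (4 * y') + min (4 * y / a) (4 * y' / b))"
    using L L' y y' by (intro mult_left_mono add_mono mult_mono min.mono divide_right_mono) auto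
  also have "\<dots> = 256 * y * y' + 64 * min (y / a) (y' / b)" by (simp add: min_def)
  also have "min (y / a) (y' / b) = real g * min (y / n) (y' / n')"
    using g ab by (simp add: min_mult_distrib_left)
  finally show ?thesis by (simp add: S_def g_def)
qed

section \<open>Affine images of sets of period 1\<close>

lemma measure_lborel_affine:
  fixes c t :: real
  assumes "A \<in> sets borel" "c \<noteq> 0"
  shows "measure lborel {x. t + c * x \<in> A} = measure lborel A / \<bar>c\<bar>"
proof -
  have m: "{x. t + c * x \<in> A} \<in> sets borel"
    using measurable_sets[of "\<lambda>x. t + c * x" borel borel A] assms by (simp add: vimage_def)
  have "emeasure lborel A = (\<integral>\<^sup>+x. indicator A x \<partial>lborel)" using assms by simp
  also have "\<dots> = \<bar>c\<bar> * (\<integral>\<^sup>+x. indicator A (t + c * x) \<partial>lborel)"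
    using assms by (intro nn_integral_real_affine) auto
  also have "(\<integral>\<^sup>+x. indicator A (t + c * x) \<partial>lborel) = (\<integral>\<^sup>+x. indicator {x. t + c * x \<in> A} x \<partial>lborel)"
    by (intro nn_integral_cong) (simp add: indicator_def)
  also have "\<dots> = emeasure lborel {x. t + c * x \<in> A}" using m by simp
  finally show ?thesis using assms by (simp add: measure_def enn2real_mult)
qed

context
  fixes V :: "real set"
  assumes V: "V \<in> sets borel" and per: "\<And>x. x + 1 \<in> V \<longleftrightarrow> x \<in> V"
begin

lemma measure_periodic_shift: "measure lborel (V \<inter> {a + 1..<b + 1}) = measure lborel (V \<inter> {a..<b})"
proof -
  have "measure lborel {x. 1 + 1 * x \<in> V \<inter> {a + 1..<b + 1}} = measure lborel (V \<inter> {a + 1..<b + 1}) / \<bar>1\<bar>"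
    using V by (intro measure_lborel_affine) auto
  moreover have "{x. 1 + 1 * x \<in> V \<inter> {a + 1..<b + 1}} = V \<inter> {a..<b}"
    using per by (auto simp: add.commute)
  ultimately show ?thesis by simp
qed

lemma fmeasurable_periodic: "V \<inter> {a..<b} \<in> fmeasurable lborel"
proof (rule fmeasurableI2[of "{a..b}"])
  show "{a..b} \<in> fmeasurable lborel" by (rule fmeasurableI) (auto simp: emeasure_lborel_Icc_eq)
qed (use V in auto)

lemma measure_periodic_split:
  assumes "a \<le> b" "b \<le> c"
  shows "measure lborel (V \<inter> {a..<c}) = measure lborel (V \<inter> {a..<b}) + measure lborel (V \<inter> {b..<c})"
proof -
  have "V \<inter> {a..<c} = (V \<inter> {a..<b}) \<union> (V \<inter> {b..<c})" using assms by auto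
  then show ?thesis
    by (simp add: measure_Un2[OF fmeasurable_periodic fmeasurable_periodic]) (rule arg_cong[of _ _ "measure lborel"], auto)
qed

lemma measure_periodic_unit: "measure lborel (V \<inter> {a..<a + 1}) = measure lborel (V \<inter> {0..<1})"
proof -
  have int: "measure lborel (V \<inter> {a + of_int m..<b + of_int m}) = measure lborel (V \<inter> {a..<b})" for m :: int and a b
  proof (induction m rule: int_induct[where k = 0])
    case (step1 i)
    then show ?case using measure_periodic_shift[of "a + of_int i" "b + of_int i"] by (simp add: algebra_simps)
  next
    case (step2 i)
    then show ?case using measure_periodic_shift[of "a + of_int i - 1" "b + of_int i - 1"] by (simp add: algebra_simps)
  qed simp
  define f where "f = frac a"
  have f: "0 \<le> f" "f \<le> 1" using frac_lt_1[of a] by (auto simp: f_def)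
  have "measure lborel (V \<inter> {a..<a + 1}) = measure lborel (V \<inter> {f..<f + 1})"
    using int[of f "\<lfloor>a\<rfloor>" "f + 1"] by (simp add: f_def frac_def)
  also have "\<dots> = measure lborel (V \<inter> {f..<1}) + measure lborel (V \<inter> {1..<f + 1})"
    using f by (intro measure_periodic_split) auto
  also have "measure lborel (V \<inter> {1..<f + 1}) = measure lborel (V \<inter> {0..<f})"
    using measure_periodic_shift[of 0 f] by simp
  also have "measure lborel (V \<inter> {f..<1}) + \<dots> = measure lborel (V \<inter> {0..<1})"
    using f by (subst add.commute, intro measure_periodic_split[symmetric]) auto
  finally show ?thesis .
qed

lemma measure_periodic_length: "measure lborel (V \<inter> {a..<a + real n}) = real n * measure lborel (V \<inter> {0..<1})"
proof (induction n)
  case (Suc n)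
  have "measure lborel (V \<inter> {a..<a + real (Suc n)}) = measure lborel (V \<inter> {a..<a + real n}) + measure lborel (V \<inter> {a + real n..<a + real n + 1})"
    by (subst measure_periodic_split[of a "a + real n"]) (auto simp: algebra_simps)
  then show ?case using Suc measure_periodic_unit[of "a + real n"] by (simp add: algebra_simps)
qed simp

lemma measure_periodic_scale:
  assumes "n \<ge> 1"
  shows "measure lborel {x \<in> {0..<1}. real n * x - \<gamma> \<in> V} = measure lborel (V \<inter> {0..<1})"
proof -
  have "{x \<in> {0..<1}. real n * x - \<gamma> \<in> V} = {x. - \<gamma> + real n * x \<in> V \<inter> {- \<gamma>..<- \<gamma> + real n}}"
    using assms by (auto simp: mult_less_cancel_left1 zero_le_mult_iff)
  also have "measure lborel \<dots> = measure lborel (V \<inter> {- \<gamma>..<- \<gamma> + real n}) / \<bar>real n\<bar>"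
    using V assms by (intro measure_lborel_affine) auto
  also have "\<dots> = measure lborel (V \<inter> {0..<1})"
    using assms by (subst measure_periodic_length) simp
  finally show ?thesis .
qed

lemma measure_periodic_cell:
  assumes "n \<ge> 1"
  shows "measure lborel {x \<in> {p / real n..<(p + 1) / real n}. real n * x \<in> V} = measure lborel (V \<inter> {0..<1}) / real n"
proof -
  have "{x \<in> {p / real n..<(p + 1) / real n}. real n * x \<in> V} = {x. 0 + real n * x \<in> V \<inter> {p..<p + 1}}"
    using assms by (auto simp: field_simps)
  also have "measure lborel \<dots> = measure lborel (V \<inter> {p..<p + 1}) / \<bar>real n\<bar>"
    using V assms by (intro measure_lborel_affine) auto
  finally show ?thesis by (simp add: measure_periodic_unit)
qed

end

lemma measure_dist_int_less_ge:
  assumes "n \<ge> 1" "0 < y" "y \<le> 1 / 2"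
  shows "measure lborel {x \<in> {0..<1}. dist_int (real n * x - \<gamma>) < y} \<ge> y"
proof -
  define V where "V = {u. dist_int u < y}"
  have V: "V \<in> sets borel" unfolding V_def by measurable
  have per: "x + 1 \<in> V \<longleftrightarrow> x \<in> V" for x
    using dist_int_add_of_int[of x 1] by (simp add: V_def)
  \<comment> \<open>Only the points to the right of 0 are counted, which costs at most a factor
    2.\<close>
  have "y = measure lborel {0..<y}" using assms by simp
  also have "\<dots> \<le> measure lborel (V \<inter> {0..<1})"
  proof (rule measure_mono_fmeasurable)
    show "{0..<y} \<subseteq> V \<inter> {0..<1}"
    proof
      fix u assume "u \<in> {0..<y}"
      then show "u \<in> V \<inter> {0..<1}" using dist_int_le[of u 0] assms by (auto simp: V_def)
    qed
  qed (use fmeasurable_periodic[OF V per] in auto)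
  also have "\<dots> = measure lborel {x \<in> {0..<1}. real n * x - \<gamma> \<in> V}"
    using measure_periodic_scale[OF V per assms(1)] by simp
  finally show ?thesis by (simp add: V_def)
qed


section \<open>Sums of greatest common divisors over Bohr sets\<close>

definition bohr :: "nat set \<Rightarrow> (nat \<Rightarrow> real) \<Rightarrow> (nat \<Rightarrow> real) \<Rightarrow> (nat \<Rightarrow> real) \<Rightarrow> nat \<Rightarrow> nat set" where
  "bohr I \<alpha> \<gamma> \<rho> N = {n \<in> {N..<2 * N}. \<forall>i\<in>I. dist_int (real n * \<alpha> i - \<gamma> i) \<le> \<rho> i}"

lemma finite_bohr [simp]: "finite (bohr I \<alpha> \<gamma> \<rho> N)"
  by (simp add: bohr_def)

lemma interval_multiples:
  assumes "g \<ge> (1::nat)"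
  obtains X M where "real M \<le> real N / real g + 1" "\<And>m. N \<le> g * m \<Longrightarrow> g * m < 2 * N \<Longrightarrow> m \<in> {X..<X + M}"
proof
  define X where "X = nat \<lceil>real N / real g\<rceil>"
  define M where "M = nat (\<lceil>real (2 * N) / real g\<rceil> - \<lceil>real N / real g\<rceil>)"
  have le: "\<lceil>real N / real g\<rceil> \<le> \<lceil>real (2 * N) / real g\<rceil>"
    by (intro ceiling_mono divide_right_mono) auto
  have c0: "0 \<le> \<lceil>real N / real g\<rceil>"
    by (smt (verit) divide_nonneg_nonneg ceiling_mono ceiling_zero of_nat_0_le_iff)
  have "real M = of_int \<lceil>real (2 * N) / real g\<rceil> - of_int \<lceil>real N / real g\<rceil>"
    using le by (simp add: M_def)
  also have "\<dots> \<le> (real (2 * N) / real g + 1) - real N / real g"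
    by (intro diff_mono) (auto simp: le_of_int_ceiling of_int_ceiling_le_add_one)
  finally show "real M \<le> real N / real g + 1" by (simp add: field_simps)
  fix m assume m: "N \<le> g * m" "g * m < 2 * N"
  have "real N \<le> real g * real m" "real g * real m < real (2 * N)"
    using m by (metis of_nat_le_iff of_nat_mult, metis of_nat_less_iff of_nat_mult)
  then have "real N / real g \<le> real m" "real m < real (2 * N) / real g"
    using assms by (simp_all add: field_simps)
  then have "\<lceil>real N / real g\<rceil> \<le> int m" "int m < \<lceil>real (2 * N) / real g\<rceil>"
    by (auto simp: ceiling_le_iff less_ceiling_iff)
  moreover have "int X = \<lceil>real N / real g\<rceil>" "int (X + M) = \<lceil>real (2 * N) / real g\<rceil>"
    using c0 le by (auto simp: X_def M_def)
  ultimately show "m \<in> {X..<X + M}" by auto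
qed

lemma harmonic_pow2_le: "(\<Sum>g = 1..2 ^ k. 1 / real g) \<le> real k + 1"
proof (induction k)
  case (Suc k)
  have "{1..2 ^ Suc k} = {1..2 ^ k} \<union> {2 ^ k + 1..(2::nat) ^ Suc k}" by auto
  then have "(\<Sum>g = 1..2 ^ Suc k. 1 / real g) = (\<Sum>g = 1..2 ^ k. 1 / real g) + (\<Sum>g = 2 ^ k + 1..2 ^ Suc k. 1 / real g)"
    by (simp add: sum.union_disjoint)
  also have "(\<Sum>g = 2 ^ k + 1..2 ^ Suc k. 1 / real g) \<le> (\<Sum>g = (2::nat) ^ k + 1..2 ^ Suc k. 1 / 2 ^ k)"
  proof (rule sum_mono)
    fix g :: nat assume "g \<in> {2 ^ k + 1..2 ^ Suc k}"
    then have "2 ^ k \<le> g" by simp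
    then have "(2::real) ^ k \<le> real g" by (metis of_nat_le_iff of_nat_numeral of_nat_power)
    then show "1 / real g \<le> 1 / 2 ^ k" by (intro divide_left_mono mult_pos_pos) (auto intro: less_le_trans[rotated])
  qed
  also have "\<dots> = 1" by (simp add: of_nat_diff)
  finally show ?case using Suc by simp
qed simp

text \<open>Two integers where \<open>\<theta>\<close> returns close to zero are at least \<open>Q\<close> apart.\<close>
lemma harmonic_returns_le:
  fixes \<theta> \<sigma> :: real
  assumes Q: "Q \<ge> 1" and far: "\<And>s. 1 \<le> s \<Longrightarrow> s < Q \<Longrightarrow> dist_int (real s * \<theta>) \<ge> 2 * \<sigma>" and "\<sigma> > 0"
  shows "(\<Sum>g | g \<in> {1..X} \<and> dist_int (real g * \<theta>) < \<sigma>. 1 / real g) \<le> (\<Sum>g = 1..X. 1 / real g) / real Q"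
proof -
  define B where "B = {g \<in> {1..X}. dist_int (real g * \<theta>) < \<sigma>}"
  have BQ: "Q \<le> g" if "g \<in> B" for g
    using that far[of g] \<open>\<sigma> > 0\<close> by (force simp: B_def)
  have apart: "g + Q \<le> g'" if "g \<in> B" "g' \<in> B" "g < g'" for g g'
  proof (rule ccontr)
    assume "\<not> g + Q \<le> g'"
    then have "dist_int (real (g' - g) * \<theta>) \<ge> 2 * \<sigma>" using that by (intro far) auto
    moreover have "real (g' - g) * \<theta> = real g' * \<theta> + - (real g * \<theta>)"
      using that by (simp add: of_nat_diff algebra_simps)
    then have "dist_int (real (g' - g) * \<theta>) \<le> dist_int (real g' * \<theta>) + dist_int (real g * \<theta>)"
      using dist_int_triangle[of "real g' * \<theta>" "- (real g * \<theta>)"] by simp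
    ultimately show False using that by (simp add: B_def)
  qed
  \<comment> \<open>Elements at distance at least \<open>Q\<close> have different quotients by
    \<open>Q\<close>, so comparing \<open>1 / g\<close> with \<open>1 / (Q * (g div Q))\<close> maps
    the sum injectively into the full harmonic sum divided by \<open>Q\<close>.\<close>
  have inj: "inj_on (\<lambda>g. g div Q) B"
  proof (rule inj_onI)
    fix g g' assume g: "g \<in> B" "g' \<in> B" "g div Q = g' div Q"
    have False if "h \<in> B" "h' \<in> B" "h div Q = h' div Q" "h < h'" for h h'
    proof -
      have "(h + Q) div Q \<le> h' div Q" using apart[of h h'] that by (intro div_le_mono) auto
      then show False using that Q by simp
    qed
    then show "g = g'" using g by (metis nat_neq_iff)
  qed
  have "(\<Sum>g\<in>B. 1 / real g) \<le> (\<Sum>g\<in>B. (1 / real (g div Q)) / real Q)"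
  proof (rule sum_mono)
    fix g assume "g \<in> B"
    then have "g div Q \<ge> 1" using BQ[of g] Q by (simp add: Suc_le_eq div_greater_zero_iff)
    moreover have "real (g div Q) * real Q \<le> real g"
      by (metis div_times_less_eq_dividend of_nat_le_iff of_nat_mult)
    ultimately show "1 / real g \<le> (1 / real (g div Q)) / real Q"
      using Q by (simp add: divide_simps)
  qed
  also have "\<dots> = (\<Sum>j\<in>(\<lambda>g. g div Q) ` B. 1 / real j) / real Q"
    by (simp add: sum.reindex[OF inj] sum_divide_distrib)
  also have "\<dots> \<le> (\<Sum>g = 1..X. 1 / real g) / real Q"
  proof (intro divide_right_mono sum_mono2)
    show "(\<lambda>g. g div Q) ` B \<subseteq> {1..X}"
    proof clarify
      fix g assume "g \<in> B"
      then have "g div Q \<le> X" by (intro le_trans[OF div_le_dividend]) (simp add: B_def)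
      moreover note \<open>g \<in> B\<close>
      ultimately show "g div Q \<in> {1..X}" using BQ[of g] Q
        by (simp add: Suc_le_eq div_greater_zero_iff)
    qed
  qed auto
  finally show ?thesis by (simp add: B_def)
qed

text \<open>Relaxing the condition that the gcd equals \<open>g\<close> to divisibility of both
  numbers by \<open>g\<close> decouples the two counts.\<close>

lemma sum_gcd_le:
  assumes "finite C" "finite C'" "0 \<notin> C"
  shows "(\<Sum>(n, n') | n \<in> C \<and> n' \<in> C' \<and> gcd n n' \<le> G. real (gcd n n'))
     \<le> (\<Sum>g = 1..G. real g * (real (card {n \<in> C. g dvd n}) * real (card {n \<in> C'. g dvd n})))"
proof -
  define P where "P = {(n, n'). n \<in> C \<and> n' \<in> C' \<and> gcd n n' \<le> G}"
  have "P \<subseteq> C \<times> C'" by (auto simp: P_def)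
  then have finP: "finite P" using assms by (meson finite_SigmaI finite_subset)
  have "(\<Sum>(n, n')\<in>P. real (gcd n n')) = (\<Sum>g = 1..G. \<Sum>p | p \<in> P \<and> gcd (fst p) (snd p) = g. real (gcd (fst p) (snd p)))"
    unfolding case_prod_unfold
  proof (rule sum.group[symmetric])
    show "(\<lambda>x. gcd (fst x) (snd x)) ` P \<subseteq> {1..G}"
    proof clarify
      fix n n' assume "(n, n') \<in> P"
      then have "n \<noteq> 0" "gcd n n' \<le> G" using assms by (auto simp: P_def intro: ccontr)
      then show "gcd (fst (n, n')) (snd (n, n')) \<in> {1..G}" by (simp add: Suc_le_eq)
    qed
  qed (use finP in auto)
  also have "\<dots> \<le> (\<Sum>g = 1..G. real g * (real (card {n \<in> C. g dvd n}) * real (card {n \<in> C'. g dvd n})))"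
  proof (rule sum_mono)
    fix g
    have "(\<Sum>p | p \<in> P \<and> gcd (fst p) (snd p) = g. real (gcd (fst p) (snd p))) = real g * real (card {p \<in> P. gcd (fst p) (snd p) = g})"
      by simp
    also have "card {p \<in> P. gcd (fst p) (snd p) = g} \<le> card ({n \<in> C. g dvd n} \<times> {n \<in> C'. g dvd n})"
      using assms by (intro card_mono) (auto simp: P_def)
    finally show "(\<Sum>p | p \<in> P \<and> gcd (fst p) (snd p) = g. real (gcd (fst p) (snd p)))
       \<le> real g * (real (card {n \<in> C. g dvd n}) * real (card {n \<in> C'. g dvd n}))"
      by (simp add: card_cartesian_product mult_left_mono flip: of_nat_mult)
  qed
  finally show ?thesis by (simp add: P_def)
qed

lemma card_multiples_le:
  assumes "1 \<le> g" "g \<le> 2 * N"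
  shows "real (card {n \<in> bohr I \<alpha> \<gamma> \<rho> N. g dvd n}) \<le> 3 * real N / real g"
proof -
  obtain X M where XM: "real M \<le> real N / real g + 1" "\<And>m. N \<le> g * m \<Longrightarrow> g * m < 2 * N \<Longrightarrow> m \<in> {X..<X + M}"
    using interval_multiples[OF assms(1), of N] by blast
  have "{n \<in> bohr I \<alpha> \<gamma> \<rho> N. g dvd n} \<subseteq> (\<lambda>m. g * m) ` {X..<X + M}"
    using XM(2) by (force simp: bohr_def)
  then have "card {n \<in> bohr I \<alpha> \<gamma> \<rho> N. g dvd n} \<le> card {X..<X + M}"
    by (intro order_trans[OF card_mono card_image_le]) auto
  then have "real (card {n \<in> bohr I \<alpha> \<gamma> \<rho> N. g dvd n}) \<le> real N / real g + 1" using XM(1) by simp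
  also have "\<dots> \<le> 3 * real N / real g" using assms by (simp add: field_simps)
  finally show ?thesis .
qed

text \<open>Writing \<open>n = g * m\<close> turns the count into a box count for the point
  \<open>g \<alpha>\<close>. The assumption \<open>err\<close> says that the equidistribution error
  does not exceed the expected number.\<close>

lemma card_multiples_box_le:
  assumes I: "finite I" and g: "1 \<le> g" "g \<le> N" and \<rho>: "\<And>i. i \<in> I \<Longrightarrow> 0 < \<rho> i \<and> \<rho> i \<le> 1 / 4" and \<sigma>: "\<sigma> > 0"
    and far: "\<And>h :: nat \<Rightarrow> int. (\<And>i. i \<in> I \<Longrightarrow> real_of_int \<bar>h i\<bar> \<le> 1 / (16 * (\<rho> i)\<^sup>2)) \<Longrightarrow> \<exists>i\<in>I. h i \<noteq> 0 \<Longrightarrow>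
                 dist_int (real g * (\<Sum>i\<in>I. of_int (h i) * \<alpha> i)) \<ge> \<sigma>"
    and err: "1 / (2 * \<sigma>) \<le> (\<Prod>i\<in>I. \<rho> i) * (real N / real g)"
  shows "real (card {n \<in> bohr I \<alpha> \<gamma> \<rho> N. g dvd n}) \<le> 3 * 16 ^ card I * (\<Prod>i\<in>I. \<rho> i) * (real N / real g)"
proof -
  obtain X M where XM: "real M \<le> real N / real g + 1" "\<And>m. N \<le> g * m \<Longrightarrow> g * m < 2 * N \<Longrightarrow> m \<in> {X..<X + M}"
    using interval_multiples[OF g(1), of N] by blast
  let ?S = "{m \<in> {X..<X + M}. \<forall>i\<in>I. dist_int (real m * (real g * \<alpha> i) - \<gamma> i) \<le> \<rho> i}"
  have "{n \<in> bohr I \<alpha> \<gamma> \<rho> N. g dvd n} \<subseteq> (\<lambda>m. g * m) ` ?S"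
  proof
    fix n assume n: "n \<in> {n \<in> bohr I \<alpha> \<gamma> \<rho> N. g dvd n}"
    then obtain m where m: "n = g * m" by (auto simp: dvd_def)
    have "m \<in> ?S" using n XM(2)[of m] by (auto simp: m bohr_def mult_ac)
    then show "n \<in> (\<lambda>m. g * m) ` ?S" using m by blast
  qed
  then have "card {n \<in> bohr I \<alpha> \<gamma> \<rho> N. g dvd n} \<le> card ?S"
    by (intro order_trans[OF card_mono card_image_le]) auto
  then have "real (card {n \<in> bohr I \<alpha> \<gamma> \<rho> N. g dvd n}) \<le> real (card ?S)" by simp
  also have "\<dots> \<le> 4 ^ card I * (real M * (\<Prod>i\<in>I. 4 * \<rho> i) + 1 / (2 * \<sigma>))"
  proof (rule card_box_le[OF I \<sigma> \<rho>])
    fix h :: "nat \<Rightarrow> int" assume h: "\<And>i. i \<in> I \<Longrightarrow> real_of_int \<bar>h i\<bar> \<le> 1 / (16 * (\<rho> i)\<^sup>2)" "\<exists>i\<in>I. h i \<noteq> 0"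
    show "\<sigma> \<le> dist_int (\<Sum>i\<in>I. real_of_int (h i) * (real g * \<alpha> i))"
      using far[OF h] by (simp add: sum_distrib_left mult_ac)
  qed auto
  also have "\<dots> \<le> 4 ^ card I * ((2 * (real N / real g)) * (4 ^ card I * (\<Prod>i\<in>I. \<rho> i)) + (\<Prod>i\<in>I. \<rho> i) * (real N / real g))"
  proof (intro mult_left_mono add_mono err mult_mono)
    show "real M \<le> 2 * (real N / real g)" using XM(1) g by (simp add: field_simps)
    show "0 \<le> (\<Prod>i\<in>I. 4 * \<rho> i)" using \<rho> by (force intro!: prod_nonneg)
  qed (auto simp: prod.distrib)
  also have "\<dots> = (2 * 16 ^ card I + 4 ^ card I) * ((\<Prod>i\<in>I. \<rho> i) * (real N / real g))"
  proof -
    have "(16::real) ^ card I = 4 ^ card I * 4 ^ card I" by (simp flip: power_mult_distrib)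
    then show ?thesis by (simp only: ring_distribs mult_ac)
  qed
  also have "\<dots> \<le> (3 * 16 ^ card I) * ((\<Prod>i\<in>I. \<rho> i) * (real N / real g))"
  proof (rule mult_right_mono)
    have "(4::real) ^ card I \<le> 16 ^ card I" by (intro power_mono) auto
    then show "2 * 16 ^ card I + 4 ^ card I \<le> (3 * 16 ^ card I :: real)" by simp
    show "0 \<le> (\<Prod>i\<in>I. \<rho> i) * (real N / real g)"
      using \<rho> by (intro mult_nonneg_nonneg prod_nonneg) (auto intro: less_imp_le)
  qed
  finally show ?thesis by (simp add: mult.assoc)
qed

text \<open>Call \<open>g\<close> bad if \<open>g\<close> times some admissible nonzero combination
  \<open>h \<cdot> \<alpha>\<close> is within \<open>\<sigma>\<close> of an integer. For other
  \<open>g\<close> both divisor counts have the expected size. For bad \<open>g\<close> the trivial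
  count must do, but by \<open>far\<close> the bad \<open>g\<close> belonging to one
  \<open>h\<close> are at least \<open>Q\<close> apart, so their harmonic sum is smaller by the
  factor \<open>Q\<close>; the power of \<open>2 * \<Lambda> + 1\<close> is the number of vectors
  \<open>h\<close>.\<close>

lemma sum_gcd_small:
  fixes \<Lambda> :: nat
  assumes I: "finite I" and N: "1 \<le> G" "G \<le> N" "N \<le> N'"
    and \<rho>: "\<And>i. i \<in> I \<Longrightarrow> 0 < \<rho> i \<and> \<rho> i \<le> 1 / 4" and \<rho>': "\<And>i. i \<in> I \<Longrightarrow> 0 < \<rho>' i \<and> \<rho>' i \<le> 1 / 4" 
    and \<Lambda>: "\<And>i. i \<in> I \<Longrightarrow> 1 / (16 * (\<rho> i)\<^sup>2) \<le> real \<Lambda>" and \<Lambda>': "\<And>i. i \<in> I \<Longrightarrow> 1 / (16 * (\<rho>' i)\<^sup>2) \<le> real \<Lambda>"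
    and \<sigma>: "\<sigma> > 0" and Q: "Q \<ge> 1"
    and far: "\<And>(h :: nat \<Rightarrow> int) s. (\<And>i. i \<in> I \<Longrightarrow> \<bar>h i\<bar> \<le> int \<Lambda>) \<Longrightarrow> \<exists>i\<in>I. h i \<noteq> 0 \<Longrightarrow> 1 \<le> s \<Longrightarrow> s < Q \<Longrightarrow>
                 dist_int (real s * (\<Sum>i\<in>I. of_int (h i) * \<alpha> i)) \<ge> 2 * \<sigma>"
    and err: "1 / (2 * \<sigma>) \<le> (\<Prod>i\<in>I. \<rho> i) * (real N / real G)" "1 / (2 * \<sigma>) \<le> (\<Prod>i\<in>I. \<rho>' i) * (real N / real G)"
  shows "(\<Sum>(n, n') | n \<in> bohr I \<alpha> \<gamma> \<rho> N \<and> n' \<in> bohr I \<alpha> \<gamma> \<rho>' N' \<and> gcd n n' \<le> G. real (gcd n n'))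
     \<le> real N * real N' * (\<Sum>g = 1..G. 1 / real g) *
        (9 * 256 ^ card I * ((\<Prod>i\<in>I. \<rho> i) * (\<Prod>i\<in>I. \<rho>' i)) + 9 * (2 * real \<Lambda> + 1) ^ card I / real Q)"
proof -
  define C C' where "C = bohr I \<alpha> \<gamma> \<rho> N" and "C' = bohr I \<alpha> \<gamma> \<rho>' N'"
  define D D' where "D g = real (card {n \<in> C. g dvd n})" and "D' g = real (card {n \<in> C'. g dvd n})" for g
  define P P' where "P = (\<Prod>i\<in>I. \<rho> i)" and "P' = (\<Prod>i\<in>I. \<rho>' i)"
  define Hs where "Hs = {h \<in> (\<Pi>\<^sub>E i\<in>I. {- int \<Lambda>..int \<Lambda>}). \<exists>i\<in>I. h i \<noteq> 0}"
  define \<Theta> where "\<Theta> h = (\<Sum>i\<in>I. of_int (h i) * \<alpha> i)" for h :: "nat \<Rightarrow> int"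
  define bad where "bad g \<longleftrightarrow> (\<exists>h\<in>Hs. dist_int (real g * \<Theta> h) < \<sigma>)" for g :: nat
  define E where "E = (\<Sum>g = 1..G. 1 / real g)"
  have E0: "E \<ge> 0" by (auto simp: E_def intro!: sum_nonneg)
  have P0: "P \<ge> 0" "P' \<ge> 0" unfolding P_def P'_def using \<rho> \<rho>' by (force intro!: prod_nonneg)+
  have finPi: "finite (\<Pi>\<^sub>E i\<in>I. {- int \<Lambda>..int \<Lambda>})" using I by (intro finite_PiE) auto
  then have finHs: "finite Hs" by (simp add: Hs_def)
  have "card Hs \<le> card (\<Pi>\<^sub>E i\<in>I. {- int \<Lambda>..int \<Lambda>})"
    using finPi by (intro card_mono) (auto simp: Hs_def)
  also have "\<dots> = (2 * \<Lambda> + 1) ^ card I"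
  proof -
    have "card {- int \<Lambda>..int \<Lambda>} = 2 * \<Lambda> + 1" by simp
    then show ?thesis using I by (simp only: card_PiE prod_constant)
  qed
  finally have "real (card Hs) \<le> real ((2 * \<Lambda> + 1) ^ card I)" by (simp only: of_nat_le_iff)
  then have cardHs: "real (card Hs) \<le> (2 * real \<Lambda> + 1) ^ card I" by (simp add: add.commute)
  have notbad: "\<sigma> \<le> dist_int (real g * (\<Sum>i\<in>I. of_int (h i) * \<alpha> i))"
    if g: "\<not> bad g" and h: "\<And>i. i \<in> I \<Longrightarrow> \<bar>h i\<bar> \<le> int \<Lambda>" "\<exists>i\<in>I. h i \<noteq> 0" for g and h :: "nat \<Rightarrow> int"
  proof -
    have "restrict h I \<in> Hs" using h by (auto simp: Hs_def abs_le_iff minus_le_iff)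
    moreover have "\<Theta> (restrict h I) = (\<Sum>i\<in>I. of_int (h i) * \<alpha> i)" by (simp add: \<Theta>_def)
    ultimately show ?thesis using g by (force simp: bad_def)
  qed
  have int_le: "\<bar>k\<bar> \<le> int \<Lambda>" if "real_of_int \<bar>k\<bar> \<le> x" "x \<le> real \<Lambda>" for k x
    using that by linarith
  have good: "D g \<le> 3 * 16 ^ card I * P * (real N / real g) \<and> D' g \<le> 3 * 16 ^ card I * P' * (real N' / real g)"
    if g: "1 \<le> g" "g \<le> G" "\<not> bad g" for g
  proof
    have mono: "real N / real G \<le> real N / real g" "real N / real g \<le> real N' / real g"
      using g N by (auto intro!: divide_left_mono divide_right_mono mult_pos_pos)
    show "D g \<le> 3 * 16 ^ card I * P * (real N / real g)"
      unfolding D_def C_def P_def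
    proof (rule card_multiples_box_le[OF I])
      show "1 / (2 * \<sigma>) \<le> prod \<rho> I * (real N / real g)"
        using err(1) mult_left_mono[OF mono(1) P0(1)] by (simp add: P_def)
      fix h :: "nat \<Rightarrow> int" assume h: "\<And>i. i \<in> I \<Longrightarrow> real_of_int \<bar>h i\<bar> \<le> 1 / (16 * (\<rho> i)\<^sup>2)" "\<exists>i\<in>I. h i \<noteq> 0"
      then show "\<sigma> \<le> dist_int (real g * (\<Sum>i\<in>I. real_of_int (h i) * \<alpha> i))"
        using \<Lambda> int_le by (intro notbad[OF g(3)]) blast+
    qed (use g N \<rho> \<sigma> in auto)
    show "D' g \<le> 3 * 16 ^ card I * P' * (real N' / real g)"
      unfolding D'_def C'_def P'_def
    proof (rule card_multiples_box_le[OF I])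
      show "1 / (2 * \<sigma>) \<le> prod \<rho>' I * (real N' / real g)"
        using err(2) mult_left_mono[OF mono(1) P0(2)] mult_left_mono[OF mono(2) P0(2)] by (simp add: P'_def)
      fix h :: "nat \<Rightarrow> int" assume h: "\<And>i. i \<in> I \<Longrightarrow> real_of_int \<bar>h i\<bar> \<le> 1 / (16 * (\<rho>' i)\<^sup>2)" "\<exists>i\<in>I. h i \<noteq> 0"
      then show "\<sigma> \<le> dist_int (real g * (\<Sum>i\<in>I. real_of_int (h i) * \<alpha> i))"
        using \<Lambda>' int_le by (intro notbad[OF g(3)]) blast+
    qed (use g N \<rho>' \<sigma> in auto)
  qed
  have "(\<Sum>(n, n') | n \<in> C \<and> n' \<in> C' \<and> gcd n n' \<le> G. real (gcd n n')) \<le> (\<Sum>g = 1..G. real g * (D g * D' g))"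
    unfolding D_def D'_def by (rule sum_gcd_le) (use N in \<open>auto simp: C_def C'_def bohr_def\<close>)
  also have "\<dots> \<le> (\<Sum>g = 1..G. real N * real N' * (9 * 256 ^ card I * (P * P')) * (1 / real g) + 
        (if bad g then 9 * (real N * real N') * (1 / real g) else 0))"
  proof (rule sum_mono)
    fix g assume g: "g \<in> {1..G}"
    show "real g * (D g * D' g) \<le> real N * real N' * (9 * 256 ^ card I * (P * P')) * (1 / real g) + 
        (if bad g then 9 * (real N * real N') * (1 / real g) else 0)"
    proof (cases "bad g")
      case True
      have "D g * D' g \<le> (3 * real N / real g) * (3 * real N' / real g)"
        unfolding D_def D'_def C_def C'_def using g N by (intro mult_mono card_multiples_le) auto
      then have "real g * (D g * D' g) \<le> real g * ((3 * real N / real g) * (3 * real N' / real g))"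
        by (rule mult_left_mono) simp
      also have "\<dots> = 9 * (real N * real N') * (1 / real g)" using g by simp
      also have "\<dots> \<le> real N * real N' * (9 * 256 ^ card I * (P * P')) * (1 / real g) + 9 * (real N * real N') * (1 / real g)"
        using P0 by simp
      finally show ?thesis using True by simp
    next
      case False
      have "D g * D' g \<le> (3 * 16 ^ card I * P * (real N / real g)) * (3 * 16 ^ card I * P' * (real N' / real g))"
        using good[of g] g False P0 by (intro mult_mono) (auto simp: D'_def)
      then have "real g * (D g * D' g) \<le> real g * ((3 * 16 ^ card I * P * (real N / real g)) * (3 * 16 ^ card I * P' * (real N' / real g)))"
        by (rule mult_left_mono) simp
      also have "\<dots> = real N * real N' * (9 * (16 ^ card I * 16 ^ card I) * (P * P')) * (1 / real g)" using g by simp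
      also have "(16::real) ^ card I * 16 ^ card I = 256 ^ card I" by (simp flip: power_mult_distrib)
      finally show ?thesis using False by simp
    qed
  qed
  also have "\<dots> = real N * real N' * (9 * 256 ^ card I * (P * P')) * E + 9 * (real N * real N') * (\<Sum>g | g \<in> {1..G} \<and> bad g. 1 / real g)"
    unfolding sum.distrib E_def sum_distrib_left
    by (simp add: sum.inter_filter[symmetric])
  also have "\<dots> \<le> real N * real N' * (9 * 256 ^ card I * (P * P')) * E + 9 * (real N * real N') * ((2 * real \<Lambda> + 1) ^ card I * (E / real Q))"
  proof (intro add_left_mono mult_left_mono)
    \<comment> \<open>A union bound over the frequency vectors that can make \<open>g\<close>
      bad.\<close>
    have "(\<Sum>g | g \<in> {1..G} \<and> bad g. 1 / real g) \<le> (\<Sum>g\<in>{1..G}. \<Sum>h\<in>Hs. if dist_int (real g * \<Theta> h) < \<sigma> then 1 / real g else 0)"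
    proof (subst sum.inter_filter, simp, rule sum_mono)
      fix g assume "g \<in> {1..G}"
      show "(if bad g then 1 / real g else 0) \<le> (\<Sum>h\<in>Hs. if dist_int (real g * \<Theta> h) < \<sigma> then 1 / real g else 0)"
      proof (cases "bad g")
        case True
        then obtain h where h: "h \<in> Hs" "dist_int (real g * \<Theta> h) < \<sigma>" by (auto simp: bad_def)
        have "(if dist_int (real g * \<Theta> h) < \<sigma> then 1 / real g else 0) \<le> (\<Sum>h\<in>Hs. if dist_int (real g * \<Theta> h) < \<sigma> then 1 / real g else 0)"
          using finHs by (intro member_le_sum[OF h(1)]) auto
        with h True show ?thesis by simp
      qed (auto intro!: sum_nonneg)
    qed
    also have "\<dots> = (\<Sum>h\<in>Hs. \<Sum>g | g \<in> {1..G} \<and> dist_int (real g * \<Theta> h) < \<sigma>. 1 / real g)"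
      by (subst sum.swap, subst sum.inter_filter) auto
    also have "\<dots> \<le> (\<Sum>h\<in>Hs. E / real Q)"
    proof (rule sum_mono)
      fix h assume h: "h \<in> Hs"
      have hb: "\<bar>h i\<bar> \<le> int \<Lambda>" if "i \<in> I" for i using h that by (auto simp: Hs_def PiE_iff abs_le_iff)
      show "(\<Sum>g | g \<in> {1..G} \<and> dist_int (real g * \<Theta> h) < \<sigma>. 1 / real g) \<le> E / real Q"
        unfolding E_def by (rule harmonic_returns_le[OF Q _ \<sigma>]) (use h far[OF hb] in \<open>auto simp: \<Theta>_def Hs_def\<close>)
    qed
    also have "\<dots> \<le> (2 * real \<Lambda> + 1) ^ card I * (E / real Q)"
      using cardHs E0 by (simp add: mult_right_mono divide_right_mono)
    finally show "(\<Sum>g | g \<in> {1..G} \<and> bad g. 1 / real g) \<le> (2 * real \<Lambda> + 1) ^ card I * (E / real Q)" .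
  qed simp
  finally show ?thesis
    by (simp add: C_def C'_def P_def P'_def E_def algebra_simps)
qed

text \<open>As a polynomial in \<open>s\<close> with nonnegative coefficients the left side is
  convex, so it lies below its chord on the unit interval; the induction proves this chord bound.
  With \<open>s = 1 / a\<close> it separates a main term without \<open>s\<close> from a correction
  carrying one factor \<open>1 / a\<close>.\<close>

lemma prod_add_scaled_le:
  fixes A B :: "'a \<Rightarrow> real"
  assumes "finite I" "\<And>i. i \<in> I \<Longrightarrow> A i \<ge> 0" "\<And>i. i \<in> I \<Longrightarrow> B i \<ge> 0" "0 \<le> s" "s \<le> 1"
    and "I \<noteq> {}"
  shows "(\<Prod>i\<in>I. A i + s * B i) \<le> (\<Prod>i\<in>I. A i) + s * (\<Prod>i\<in>I. A i + B i)"
proof -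
  have "(\<Prod>i\<in>I. A i + s * B i) \<le> (\<Prod>i\<in>I. A i) + s * ((\<Prod>i\<in>I. A i + B i) - (\<Prod>i\<in>I. A i))"
    using assms(1-5)
  proof (induction I rule: finite_induct)
    case (insert j I)
    define P R where "P = (\<Prod>i\<in>I. A i)" and "R = (\<Prod>i\<in>I. A i + B i)"
    have "P \<le> R" unfolding P_def R_def using insert by (intro prod_mono) auto
    have "(A j + s * B j) * (\<Prod>i\<in>I. A i + s * B i) \<le> (A j + s * B j) * (P + s * (R - P))"
      using insert by (intro mult_left_mono) (auto simp: P_def R_def)
    also have "\<dots> = A j * P + s * (A j * (R - P) + B j * P + s * (B j * (R - P)))"
      by (simp add: algebra_simps)
    also have "\<dots> \<le> A j * P + s * (A j * (R - P) + B j * P + 1 * (B j * (R - P)))"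
      using insert \<open>P \<le> R\<close> by (intro add_left_mono mult_left_mono mult_right_mono) auto
    also have "\<dots> = A j * P + s * ((A j + B j) * R - A j * P)"
      by (simp add: algebra_simps)
    finally show ?case using insert by (simp add: P_def R_def)
  qed simp
  moreover have "0 \<le> (\<Prod>i\<in>I. A i)" using assms by (intro prod_nonneg) auto
  then have "0 \<le> s * (\<Prod>i\<in>I. A i)" using assms(4) by (rule mult_nonneg_nonneg[rotated])
  ultimately show ?thesis unfolding right_diff_distrib by linarith
qed

lemma sum_inverse_squares_le: "(\<Sum>a = 1..n. 1 / (real a)\<^sup>2) \<le> 2"
proof (cases "n \<ge> 1")
  case True
  then have "(\<Sum>a = 1..n. 1 / (real a)\<^sup>2) \<le> 2 - 1 / real n"
  proof (induction n rule: nat_induct_at_least)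
    case (Suc k)
    have "1 / (real (Suc k))\<^sup>2 \<le> 1 / (real k * real (Suc k))"
      using Suc(1) by (intro divide_left_mono) (auto simp: power2_eq_square)
    also have "\<dots> = 1 / real k - 1 / real (Suc k)" using Suc(1) by (simp add: field_simps)
    finally show ?case using Suc by simp
  qed simp
  also have "\<dots> \<le> 2" by simp
  finally show ?thesis .
qed simp

text \<open>Sort the pairs by their reduced form \<open>(a, b)\<close>, where a large gcd makes
  \<open>a\<close> small. For fixed \<open>(a, b)\<close> the common factor runs through a box count
  for \<open>a \<alpha>\<close> and \<open>b \<alpha>\<close>, and the gcd is at most
  \<open>2 * N / a\<close>. Summing over fewer than \<open>2 * a * T\<close> values of
  \<open>b\<close> leaves one series in \<open>1 / a\<close>, with the small product of volumes in
  front, and a convergent one in \<open>1 / a\<^sup>2\<close> for the resonances.\<close>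

lemma sum_gcd_large:
  fixes A T :: nat
  assumes I: "finite I" "I \<noteq> {}" and N: "1 \<le> N" "N' = T * N" "1 \<le> T" "2 * N \<le> G * A" "A \<le> N"
    and \<rho>: "\<And>i. i \<in> I \<Longrightarrow> 0 < \<rho> i \<and> \<rho> i \<le> 1 / 4" and \<rho>': "\<And>i. i \<in> I \<Longrightarrow> 0 < \<rho>' i \<and> \<rho>' i \<le> 1 / 4" 
    and \<epsilon>: "\<epsilon> > 0"
    and far: "\<And>(h :: nat \<Rightarrow> int) h' a b. (\<And>i. i \<in> I \<Longrightarrow> real_of_int \<bar>h i\<bar> \<le> 1 / (16 * (\<rho> i)\<^sup>2)) \<Longrightarrow>
       (\<And>i. i \<in> I \<Longrightarrow> real_of_int \<bar>h' i\<bar> \<le> 1 / (16 * (\<rho>' i)\<^sup>2)) \<Longrightarrow> 1 \<le> a \<Longrightarrow> a \<le> A \<Longrightarrow> 1 \<le> b \<Longrightarrow> b \<le> 2 * A * T \<Longrightarrow>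
       \<exists>i\<in>I. int a * h i + int b * h' i \<noteq> 0 \<Longrightarrow>
                 dist_int (\<Sum>i\<in>I. of_int (int a * h i + int b * h' i) * \<alpha> i) \<ge> \<epsilon>"
  shows "(\<Sum>(n, n') | n \<in> bohr I \<alpha> \<gamma> \<rho> N \<and> n' \<in> bohr I \<alpha> \<gamma> \<rho>' N' \<and> G < gcd n n'. real (gcd n n'))
     \<le> 16 ^ card I * (8 * real N * real N' * ((\<Sum>a = 1..A. 1 / real a) * (\<Prod>i\<in>I. 16 * \<rho> i * \<rho>' i)
          + 2 * (\<Prod>i\<in>I. 16 * \<rho> i * \<rho>' i + 8 * min (\<rho> i) (\<rho>' i / real T))) + 2 * real N' * real A / \<epsilon>)"
proof -
  define C C' where "C = bohr I \<alpha> \<gamma> \<rho> N" and "C' = bohr I \<alpha> \<gamma> \<rho>' N'"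
  define P where "P = {(n, n'). n \<in> C \<and> n' \<in> C' \<and> G < gcd n n'}"
  define AB where "AB = (SIGMA a:{1..A}. {1..<2 * a * T})"
  define PA PB where "PA = (\<Prod>i\<in>I. 16 * \<rho> i * \<rho>' i)" and "PB = (\<Prod>i\<in>I. 16 * \<rho> i * \<rho>' i + 8 * min (\<rho> i) (\<rho>' i / real T))"
  define gc where "gc p = gcd (fst p) (snd p)" for p :: "nat \<times> nat"
  define key where "key p = (fst p div gc p, snd p div gc p)" for p
  have "P \<subseteq> C \<times> C'" by (auto simp: P_def)
  then have finP: "finite P" by (rule finite_subset) (simp add: C_def C'_def)
  have key: "key p = (a, b) \<Longrightarrow> p = (gc p * a, gc p * b) \<and> coprime a b" if "p \<in> P" for p a b
  proof -
    assume k: "key p = (a, b)"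
    have n0: "fst p \<noteq> 0" using that N by (auto simp: P_def C_def bohr_def)
    have "coprime (fst p div gc p) (snd p div gc p)"
      unfolding gc_def by (rule div_gcd_coprime) (use n0 in simp)
    moreover have "gc p * (fst p div gc p) = fst p" "gc p * (snd p div gc p) = snd p"
      by (simp_all add: gc_def)
    moreover have "a = fst p div gc p" "b = snd p div gc p" using k by (simp_all add: key_def)
    ultimately show "p = (gc p * a, gc p * b) \<and> coprime a b" by (simp add: prod_eq_iff)
  qed
  \<comment> \<open>As the numbers lie in \<open>{N..<2 * N}\<close> and
    \<open>{N'..<2 * N'}\<close> with \<open>N' = T * N\<close>, the ratio \<open>b / a\<close> is
    between \<open>T / 2\<close> and \<open>2 * T\<close>.\<close>
  have bounds: "1 \<le> a \<and> a \<le> A \<and> 1 \<le> b \<and> b < 2 * a * T \<and> a * T < 2 * b \<and> gc p * a < 2 * N" if p: "p \<in> P" "key p = (a, b)" for p a b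
  proof -
    define g where "g = gc p"
    have k: "p = (g * a, g * b)" "coprime a b" using key[OF p] by (auto simp: g_def)
    have g: "G < g" using p by (auto simp: P_def g_def gc_def)
    have r: "N \<le> g * a" "g * a < 2 * N" "N' \<le> g * b" "g * b < 2 * N'"
      using p(1) unfolding P_def C_def C'_def bohr_def k(1) by auto
    have a1: "1 \<le> a" "1 \<le> b" using r N by (auto simp: Suc_le_eq intro!: Nat.gr0I)
    have "G * a \<le> g * a" using g by simp
    also have "\<dots> < G * A" using r N by simp
    finally have aA: "a \<le> A" by simp
    have "g * b < 2 * (T * N)" using r N by simp
    also have "\<dots> \<le> 2 * (T * (g * a))" using r by simp
    also have "\<dots> = g * (2 * a * T)" by simp
    finally have b2: "b < 2 * a * T" by simp
    have "g * (a * T) < 2 * N * T" using r N by (simp add: mult.assoc[symmetric])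
    also have "\<dots> \<le> g * (2 * b)" using r N by (simp add: mult_ac)
    finally have "a * T < 2 * b" by simp
    with a1 aA b2 r show ?thesis by (simp add: g_def)
  qed
  have "(\<Sum>(n, n')\<in>P. real (gcd n n')) = (\<Sum>ab\<in>AB. \<Sum>p | p \<in> P \<and> key p = ab. real (gc p))"
    unfolding case_prod_unfold gc_def[symmetric]
  proof (rule sum.group[symmetric])
    show "key ` P \<subseteq> AB"
    proof
      fix ab assume "ab \<in> key ` P"
      then obtain p where p: "p \<in> P" "key p = ab" by auto
      then show "ab \<in> AB" using bounds[OF p(1), of "fst ab" "snd ab"] by (cases ab) (auto simp: AB_def)
    qed
  qed (use finP in \<open>auto simp: AB_def\<close>)
  also have "\<dots> \<le> (\<Sum>(a, b)\<in>AB. (2 * real N / real a) * (16 ^ card I * ((2 * real N / real a) * (PA + (1 / real a) * PB) + 1 / (2 * \<epsilon>))))"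
    unfolding case_prod_unfold
  proof (rule sum_mono)
    fix ab assume ab: "ab \<in> AB"
    obtain a b where ab_eq: "ab = (a, b)" by (cases ab)
    have a: "1 \<le> a" "a \<le> A" "1 \<le> b" "b < 2 * a * T" using ab by (auto simp: AB_def ab_eq)
    let ?F = "{p \<in> P. key p = (a, b)}"
    let ?R = "(2 * real N / real a) * (16 ^ card I * ((2 * real N / real a) * (PA + (1 / real a) * PB) + 1 / (2 * \<epsilon>)))"
    have PAB0: "PA \<ge> 0" "PB \<ge> 0"
      unfolding PA_def PB_def using \<rho> \<rho>' by (force intro!: prod_nonneg add_nonneg_nonneg simp: min_def)+
    then have R0: "0 \<le> ?R" using \<epsilon> by simp
    have "(\<Sum>p\<in>?F. real (gc p)) \<le> ?R"
    proof (cases "?F = {}")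
      case False
      then obtain p0 where p0: "p0 \<in> P" "key p0 = (a, b)" by auto
      have cop: "coprime a b" and aT: "a * T < 2 * b" using key[OF p0] bounds[OF p0] by auto
      obtain X M where XM: "real M \<le> real N / real a + 1" "\<And>m. N \<le> a * m \<Longrightarrow> a * m < 2 * N \<Longrightarrow> m \<in> {X..<X + M}"
        using interval_multiples[OF a(1), of N] by blast
      let ?S = "{m \<in> {X..<X + M}. \<forall>i\<in>I. dist_int (real m * (real a * \<alpha> i) - \<gamma> i) \<le> \<rho> i \<and> dist_int (real m * (real b * \<alpha> i) - \<gamma> i) \<le> \<rho>' i}"
      have sub: "?F \<subseteq> (\<lambda>m. (m * a, m * b)) ` ?S"
      proof
        fix p assume "p \<in> ?F"
        then have p: "p \<in> P" "key p = (a, b)" by auto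
        define g where "g = gc p"
        have k: "p = (g * a, g * b)" using key[OF p] by (simp add: g_def)
        have "g \<in> ?S" using p(1) XM(2)[of g] unfolding P_def C_def C'_def bohr_def k by (auto simp: mult_ac)
        then show "p \<in> (\<lambda>m. (m * a, m * b)) ` ?S" using k by blast
      qed
      have F: "(\<Sum>p\<in>?F. real (gc p)) \<le> (\<Sum>p\<in>?F. 2 * real N / real a)"
      proof (rule sum_mono)
        fix p assume "p \<in> ?F"
        then have "gc p * a < 2 * N" using bounds by auto
        then have "real (gc p * a) \<le> real (2 * N)" by (simp only: of_nat_le_iff)
        then show "real (gc p) \<le> 2 * real N / real a" using a by (simp add: field_simps)
      qed
      have "card ?F \<le> card ?S"
        by (rule order_trans[OF card_mono[OF _ sub] card_image_le]) auto
      then have "real (card ?F) \<le> real (card ?S)" by simp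
      also have "\<dots> \<le> 16 ^ card I * (real M * (\<Prod>i\<in>I. 16 * \<rho> i * \<rho>' i + min (4 * \<rho> i / a) (4 * \<rho>' i / b)) + 1 / (2 * \<epsilon>))"
      proof (rule card_box_pair_le[OF I(1) \<epsilon> a(1) a(3) cop \<rho> \<rho>'])
        fix h h' :: "nat \<Rightarrow> int" 
        assume h: "\<And>i. i \<in> I \<Longrightarrow> real_of_int \<bar>h i\<bar> \<le> 1 / (16 * (\<rho> i)\<^sup>2)" "\<And>i. i \<in> I \<Longrightarrow> real_of_int \<bar>h' i\<bar> \<le> 1 / (16 * (\<rho>' i)\<^sup>2)"
          "\<exists>i\<in>I. int a * h i + int b * h' i \<noteq> 0"
        have "2 * a * T \<le> 2 * A * T" using a by simp
        then have "b \<le> 2 * A * T" using a by linarith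
        then show "\<epsilon> \<le> dist_int (\<Sum>i\<in>I. real_of_int (int a * h i + int b * h' i) * \<alpha> i)"
          using a by (intro far[OF h(1) h(2) _ _ _ _ h(3)]) auto
      qed auto
      also have "\<dots> \<le> 16 ^ card I * ((2 * real N / real a) * (PA + (1 / real a) * PB) + 1 / (2 * \<epsilon>))"
      proof (intro mult_left_mono add_right_mono mult_mono)
        show "real M \<le> 2 * real N / real a" using XM(1) a N by (simp add: field_simps)
        \<comment> \<open>The inequality \<open>a * T < 2 * b\<close> replaces \<open>1 / b\<close>
          by \<open>2 / (a * T)\<close>, after which both entries of the minimum carry the factor
          \<open>1 / a\<close>.\<close>
        have "(\<Prod>i\<in>I. 16 * \<rho> i * \<rho>' i + min (4 * \<rho> i / a) (4 * \<rho>' i / b)) 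
           \<le> (\<Prod>i\<in>I. 16 * \<rho> i * \<rho>' i + (1 / real a) * (8 * min (\<rho> i) (\<rho>' i / real T)))"
        proof (intro prod_mono conjI add_left_mono)
          fix i assume i: "i \<in> I"
          have "real (a * T) \<le> real (2 * b)" using aT by (simp only: of_nat_le_iff)
          then have "4 * \<rho>' i / b \<le> 8 * \<rho>' i / (real a * real T)"
            using a N \<rho>'[OF i] by (simp add: field_simps)
          moreover have "4 * \<rho> i / a \<le> 8 * \<rho> i / a" using \<rho>[OF i] by (simp add: divide_right_mono)
          moreover have "(1 / real a) * (8 * min (\<rho> i) (\<rho>' i / real T)) = min (8 * \<rho> i / a) (8 * \<rho>' i / (real a * real T))"
            by (simp add: min_mult_distrib_left min_divide_distrib_right mult_ac)
          ultimately show "min (4 * \<rho> i / a) (4 * \<rho>' i / b) \<le> (1 / real a) * (8 * min (\<rho> i) (\<rho>' i / real T))"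
            by (simp only: min.mono)
          show "0 \<le> 16 * \<rho> i * \<rho>' i + min (4 * \<rho> i / a) (4 * \<rho>' i / b)"
            using \<rho>[OF i] \<rho>'[OF i] by (simp add: min_def)
        qed
        also have "\<dots> \<le> PA + (1 / real a) * PB"
          unfolding PA_def PB_def using I \<rho> \<rho>' a
          by (intro prod_add_scaled_le) (force simp: min_def)+
        finally show "(\<Prod>i\<in>I. 16 * \<rho> i * \<rho>' i + min (4 * \<rho> i / a) (4 * \<rho>' i / b)) \<le> PA + (1 / real a) * PB" .
        show "0 \<le> (\<Prod>i\<in>I. 16 * \<rho> i * \<rho>' i + min (4 * \<rho> i / a) (4 * \<rho>' i / b))"
          using \<rho> \<rho>' by (force intro!: prod_nonneg add_nonneg_nonneg simp: min_def)
      qed auto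
      finally have "(2 * real N / real a) * real (card ?F) \<le> ?R" by (rule mult_left_mono) simp
      with F show ?thesis by (simp add: mult.commute)
    next
      case True
      show ?thesis unfolding True using R0 by simp
    qed
    then show "(\<Sum>p | p \<in> P \<and> key p = ab. real (gc p)) \<le> (2 * real N / real (fst ab)) * (16 ^ card I * ((2 * real N / real (fst ab)) * (PA + (1 / real (fst ab)) * PB) + 1 / (2 * \<epsilon>)))"
      by (simp only: ab_eq fst_conv)
  qed
  also have "\<dots> = (\<Sum>a = 1..A. \<Sum>b \<in> {1..<2 * a * T}. (2 * real N / real a) * (16 ^ card I * ((2 * real N / real a) * (PA + (1 / real a) * PB) + 1 / (2 * \<epsilon>))))"
    unfolding AB_def by (rule sum.Sigma[symmetric]) auto
  also have "\<dots> \<le> (\<Sum>a = 1..A. 16 ^ card I * (8 * real N * real N' * ((1 / real a) * PA + (1 / (real a)\<^sup>2) * PB) + 2 * real N' / \<epsilon>))"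
  proof (rule sum_mono)
    fix a assume a: "a \<in> {1..A}"
    have PAB0: "PA \<ge> 0" "PB \<ge> 0"
      unfolding PA_def PB_def using \<rho> \<rho>' by (force intro!: prod_nonneg add_nonneg_nonneg simp: min_def)+
    have "(\<Sum>b \<in> {1..<2 * a * T}. (2 * real N / real a) * (16 ^ card I * ((2 * real N / real a) * (PA + (1 / real a) * PB) + 1 / (2 * \<epsilon>))))
       = real (2 * a * T - 1) * ((2 * real N / real a) * (16 ^ card I * ((2 * real N / real a) * (PA + (1 / real a) * PB) + 1 / (2 * \<epsilon>))))"
      by simp
    \<comment> \<open>The number of values of \<open>b\<close> cancels one of the two factors
      \<open>1 / a\<close> from the gcd and the length of the progression.\<close>
    also have "\<dots> \<le> real (2 * a * T) * ((2 * real N / real a) * (16 ^ card I * ((2 * real N / real a) * (PA + (1 / real a) * PB) + 1 / (2 * \<epsilon>))))"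
    proof (rule mult_right_mono)
      show "real (2 * a * T - 1) \<le> real (2 * a * T)" by (simp only: of_nat_le_iff diff_le_self)
    qed (use PAB0 \<epsilon> in auto)
    also have "\<dots> = 16 ^ card I * (8 * real N * real N' * ((1 / real a) * PA + (1 / (real a)\<^sup>2) * PB) + 2 * real N' / \<epsilon>)"
      using a N(2) \<epsilon> by (simp add: field_simps power2_eq_square)
    finally show "(\<Sum>b \<in> {1..<2 * a * T}. (2 * real N / real a) * (16 ^ card I * ((2 * real N / real a) * (PA + (1 / real a) * PB) + 1 / (2 * \<epsilon>))))
       \<le> 16 ^ card I * (8 * real N * real N' * ((1 / real a) * PA + (1 / (real a)\<^sup>2) * PB) + 2 * real N' / \<epsilon>)" .
  qed
  also have "\<dots> = 16 ^ card I * (8 * real N * real N' * ((\<Sum>a = 1..A. 1 / real a) * PA + (\<Sum>a = 1..A. 1 / (real a)\<^sup>2) * PB) + 2 * real N' * real A / \<epsilon>)"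
    unfolding sum_distrib_left[symmetric] sum.distrib sum_distrib_right[symmetric] by simp
  also have "\<dots> \<le> 16 ^ card I * (8 * real N * real N' * ((\<Sum>a = 1..A. 1 / real a) * PA + 2 * PB) + 2 * real N' * real A / \<epsilon>)"
  proof -
    have "PB \<ge> 0"
      unfolding PB_def using \<rho> \<rho>' by (force intro!: prod_nonneg add_nonneg_nonneg simp: min_def)
    then show ?thesis by (intro mult_left_mono add_mono mult_right_mono sum_inverse_squares_le) (auto intro!: sum_nonneg)
  qed
  finally show ?thesis by (simp add: P_def C_def C'_def PA_def PB_def)
qed


section \<open>Blocks, cells and their correlations\<close>

text \<open>Radii are powers of 1/2, so powers of this number express geometric means of
  radii.\<close>

definition sqrt_half :: real where "sqrt_half = sqrt (1 / 2)"

lemma sqrt_half_pos: "0 < sqrt_half" and sqrt_half_le_1: "sqrt_half \<le> 1" and sqrt_half_sq: "sqrt_half * sqrt_half = 1 / 2"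
  by (auto simp: sqrt_half_def)

lemma sqrt_half_even: "sqrt_half ^ (2 * n) = (1 / 2) ^ n"
  by (simp add: power_mult power2_eq_square sqrt_half_sq)

lemma sqrt_half_power_sq: "sqrt_half ^ n * sqrt_half ^ n = (1 / 2) ^ n"
  by (simp add: sqrt_half_sq flip: power_mult_distrib)

lemma sqrt_half_mono: "a \<le> b \<Longrightarrow> sqrt_half ^ b \<le> sqrt_half ^ a"
  using sqrt_half_pos sqrt_half_le_1 by (intro power_decreasing) auto

text \<open>\<open>N\<^sub>t = 2 ^ (m * t)\<close> is the length of block \<open>t\<close>, \<open>2 ^ (u * t)\<close> is a
  small power of it, and blocks \<open>t \<le> t'\<close> interact only if \<open>z * (t' - t) \<le> t\<close>.\<close>
definition par_u :: "nat \<Rightarrow> nat \<Rightarrow> nat" where "par_u d W = (12 * d + 9) * W + 4 * d + 4"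
definition par_z :: "nat \<Rightarrow> nat \<Rightarrow> nat" where "par_z d W = 12 * W + 3 * d + 3"
definition par_m :: "nat \<Rightarrow> nat \<Rightarrow> nat" where "par_m d W = par_u d W * par_z d W"

text \<open>All that the measure estimates know about \<open>\<alpha>\<close>. The exponent
  \<open>W\<close> and the factor \<open>\<kappa>\<close> are kept apart because dilation of
  \<open>\<alpha>\<close> changes only \<open>\<kappa>\<close>, and the constants obtained below
  must survive it.\<close>

locale dioph =
  fixes I :: "nat set" and \<alpha> :: "nat \<Rightarrow> real" and W :: nat and \<kappa> :: real
  assumes finI: "finite I" and neI: "I \<noteq> {}" and kappa: "0 < \<kappa>" "\<kappa> \<le> 1"
    and far: "\<And>(h :: nat \<Rightarrow> int) H. (\<And>i. i \<in> I \<Longrightarrow> real_of_int \<bar>h i\<bar> \<le> H) \<Longrightarrow> 1 \<le> H \<Longrightarrow> \<exists>i\<in>I. h i \<noteq> 0 \<Longrightarrow>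
       dist_int (\<Sum>i\<in>I. of_int (h i) * \<alpha> i) \<ge> \<kappa> / H ^ W"
begin

abbreviation "d \<equiv> card I"
abbreviation "u \<equiv> par_u d W"
abbreviation "z \<equiv> par_z d W"
abbreviation "m \<equiv> par_m d W"
abbreviation rad :: "(nat \<Rightarrow> nat) \<Rightarrow> nat \<Rightarrow> real" where "rad J i \<equiv> (1 / 2) ^ J i"
abbreviation cells :: "nat \<Rightarrow> (nat \<Rightarrow> nat) set" where "cells t \<equiv> (\<Pi>\<^sub>E i\<in>I. {t..<2 * t})"

definition cell :: "(nat \<Rightarrow> real) \<Rightarrow> nat \<Rightarrow> (nat \<Rightarrow> nat) \<Rightarrow> nat set" where
  "cell \<gamma> t J = bohr I \<alpha> \<gamma> (rad J) (2 ^ (m * t))"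

text \<open>The geometric mean of the volumes of the two boxes, up to the factor
  \<open>2 ^ card I\<close> that both share.\<close>

definition vol2 :: "(nat \<Rightarrow> nat) \<Rightarrow> (nat \<Rightarrow> nat) \<Rightarrow> real" where
  "vol2 J J' = (\<Prod>i\<in>I. sqrt_half ^ (J i + J' i))"

text \<open>What remains of the resonance product of \<open>sum_gcd_large\<close> for
  \<open>T = 2 ^ s\<close> after \<open>vol2 J J'\<close> is taken out. The last factor decays in
  the mismatch of \<open>J i\<close> and \<open>J' i + s\<close>, which keeps sums over all
  \<open>J\<close> or all \<open>J'\<close> bounded.\<close>

definition interaction :: "nat \<Rightarrow> (nat \<Rightarrow> nat) \<Rightarrow> (nat \<Rightarrow> nat) \<Rightarrow> real" where
  "interaction s J J' = (\<Prod>i\<in>I. 16 * sqrt_half ^ (J i + J' i) + 8 * sqrt_half ^ s * sqrt_half ^ nat \<bar>int (J' i) + int s - int (J i)\<bar>)"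

lemma d_ge_1: "d \<ge> 1"
  using finI neI by (simp add: Suc_le_eq card_gt_0_iff)

lemma vol2_sq: "vol2 J J' * vol2 J J' = (\<Prod>i\<in>I. rad J i) * (\<Prod>i\<in>I. rad J' i)"
  unfolding vol2_def prod.distrib[symmetric] sqrt_half_power_sq by (simp add: power_add)

lemma vol2_pos: "vol2 J J' > 0"
  unfolding vol2_def by (intro prod_pos) (simp add: sqrt_half_pos)

lemma vol2_le:
  assumes "J \<in> cells t" "J' \<in> cells t'" "t \<le> t'"
  shows "vol2 J J' \<le> (1 / 2) ^ t"
proof -
  obtain j where j: "j \<in> I" using neI by auto
  have "vol2 J J' = sqrt_half ^ (J j + J' j) * (\<Prod>i\<in>I - {j}. sqrt_half ^ (J i + J' i))"
    unfolding vol2_def using j finI by (intro prod.remove) auto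
  also have "\<dots> \<le> sqrt_half ^ (J j + J' j) * 1"
    using sqrt_half_pos sqrt_half_le_1 by (intro mult_left_mono prod_le_1) (auto intro!: power_le_one)
  also have "\<dots> \<le> sqrt_half ^ (2 * t)"
    unfolding mult_1_right using assms j by (intro sqrt_half_mono) (fastforce simp: PiE_iff)
  finally show ?thesis by (simp only: sqrt_half_even)
qed

lemma vol2_ge:
  assumes "J \<in> cells t" "J' \<in> cells t'" "t' \<le> 2 * t"
  shows "vol2 J J' \<ge> (1 / 2) ^ (3 * d * t)"
proof -
  have "(1 / 2) ^ (3 * d * t) = sqrt_half ^ (2 * (3 * d * t))" by (simp only: sqrt_half_even)
  also have "\<dots> = (\<Prod>i\<in>I. sqrt_half ^ (6 * t))"
    by (simp add: power_mult[symmetric] mult_ac)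
  also have "\<dots> \<le> vol2 J J'"
    unfolding vol2_def
  proof (intro prod_mono conjI)
    fix i assume "i \<in> I"
    then have "J i < 2 * t" "J' i < 2 * t'" using assms by (auto simp: PiE_iff)
    then show "sqrt_half ^ (6 * t) \<le> sqrt_half ^ (J i + J' i)" using assms by (intro sqrt_half_mono) auto
  qed (simp add: sqrt_half_pos less_imp_le)
  finally show ?thesis .
qed

lemma prod_rad_ge:
  assumes "J \<in> cells t"
  shows "(\<Prod>i\<in>I. rad J i) \<ge> (1 / 2) ^ (2 * t * d)"
proof -
  have "(1 / 2) ^ (2 * t * d) = (\<Prod>i\<in>I. (1 / 2 :: real) ^ (2 * t))" by (simp add: power_mult)
  also have "\<dots> \<le> (\<Prod>i\<in>I. rad J i)"
    using assms by (intro prod_mono conjI power_decreasing) (force simp: PiE_iff)+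
  finally show ?thesis .
qed

lemma rad_bounds:
  assumes "J \<in> cells t" "2 \<le> t" "i \<in> I"
  shows "0 < rad J i" "rad J i \<le> 1 / 4" "1 / (16 * (rad J i)\<^sup>2) \<le> 2 ^ (4 * t)" "1 / (rad J i)\<^sup>2 \<le> 2 ^ (4 * t)"
proof -
  have J: "t \<le> J i" "J i < 2 * t" using assms by (auto simp: PiE_iff)
  show "0 < rad J i" by simp
  have "rad J i \<le> (1 / 2) ^ 2" using J assms by (intro power_decreasing) auto
  then show "rad J i \<le> 1 / 4" by (simp add: power2_eq_square)
  have "1 / (rad J i)\<^sup>2 = 2 ^ (2 * J i)" by (simp add: power_divide power_mult[symmetric] mult.commute)
  also have "\<dots> \<le> 2 ^ (4 * t)" using J by (intro power_increasing) auto
  finally show 1: "1 / (rad J i)\<^sup>2 \<le> 2 ^ (4 * t)" .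
  have "1 / (16 * (rad J i)\<^sup>2) \<le> 1 / (rad J i)\<^sup>2" by (intro divide_left_mono) auto
  with 1 show "1 / (16 * (rad J i)\<^sup>2) \<le> 2 ^ (4 * t)" by simp
qed

text \<open>A minimum of two powers of 1/2 has the larger exponent, and
  \<open>2 * max x y = x + y + \<bar>y - x\<bar>\<close> splits it into a geometric mean and a
  decaying factor.\<close>

lemma interaction_eq:
  "(\<Prod>i\<in>I. 16 * rad J i * rad J' i + 8 * min (rad J i) (rad J' i / real (2 ^ s))) = vol2 J J' * interaction s J J'"
  unfolding vol2_def interaction_def prod.distrib[symmetric]
proof (rule prod.cong[OF refl])
  fix i
  define x y where "x = J i" and "y = J' i + s"
  have "min (rad J i) (rad J' i / real (2 ^ s)) = min (sqrt_half ^ (2 * x)) (sqrt_half ^ (2 * y))"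
    unfolding sqrt_half_even x_def y_def by (simp add: power_add power_divide)
  also have "\<dots> = sqrt_half ^ (2 * max x y)"
    using sqrt_half_mono[of "2 * x" "2 * y"] sqrt_half_mono[of "2 * y" "2 * x"] by (cases "x \<le> y") (auto simp: max_def)
  also have "2 * max x y = x + y + nat \<bar>int y - int x\<bar>" by (auto simp: max_def)
  finally have "min (rad J i) (rad J' i / real (2 ^ s)) = sqrt_half ^ (x + y + nat \<bar>int y - int x\<bar>)" .
  moreover have "rad J i * rad J' i = sqrt_half ^ (J i + J' i) * sqrt_half ^ (J i + J' i)"
    unfolding sqrt_half_power_sq by (simp add: power_add)
  ultimately show "16 * rad J i * rad J' i + 8 * min (rad J i) (rad J' i / real (2 ^ s))
      = sqrt_half ^ (J i + J' i) * (16 * sqrt_half ^ (J i + J' i) + 8 * sqrt_half ^ s * sqrt_half ^ nat \<bar>int (J' i) + int s - int (J i)\<bar>)"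
    by (simp add: x_def y_def power_add algebra_simps)
qed

text \<open>The Bohr conditions are ignored and only multiples of \<open>g\<close> in the two blocks
  are counted. For distant blocks the ratio of their lengths makes up for this.\<close>

lemma sum_gcd_far_blocks:
  assumes "t \<le> t'"
  shows "(\<Sum>n\<in>cell \<gamma> t J. \<Sum>n'\<in>cell \<gamma> t' J'. real (gcd n n')) \<le> 9 * 2 ^ (m * t) * 2 ^ (m * t') * (real (m * t) + 2)"
proof -
  define N N' :: nat where "N = 2 ^ (m * t)" and "N' = 2 ^ (m * t')"
  have NN: "N \<le> N'" unfolding N_def N'_def using assms by (intro power_increasing) auto
  have c: "cell \<gamma> t J = bohr I \<alpha> \<gamma> (rad J) N" "cell \<gamma> t' J' = bohr I \<alpha> \<gamma> (rad J') N'"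
    by (simp_all add: cell_def N_def N'_def)
  have "(\<Sum>n\<in>cell \<gamma> t J. \<Sum>n'\<in>cell \<gamma> t' J'. real (gcd n n'))
     = (\<Sum>(n, n') | n \<in> cell \<gamma> t J \<and> n' \<in> cell \<gamma> t' J' \<and> gcd n n' \<le> 2 * N. real (gcd n n'))"
  proof -
    have "gcd n n' \<le> 2 * N" if "n \<in> cell \<gamma> t J" for n n'
    proof -
      have "0 < n" "n < 2 * N" using that by (auto simp: c bohr_def N_def intro: gr0I)
      moreover from \<open>0 < n\<close> have "gcd n n' \<le> n" by (intro dvd_imp_le) auto
      ultimately show ?thesis by linarith
    qed
    then have "{(n, n'). n \<in> cell \<gamma> t J \<and> n' \<in> cell \<gamma> t' J' \<and> gcd n n' \<le> 2 * N} = cell \<gamma> t J \<times> cell \<gamma> t' J'" by auto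
    then show ?thesis by (simp add: sum.cartesian_product)
  qed
  also have "\<dots> \<le> (\<Sum>g = 1..2 * N. real g * (real (card {n \<in> cell \<gamma> t J. g dvd n}) * real (card {n \<in> cell \<gamma> t' J'. g dvd n})))"
    by (rule sum_gcd_le) (auto simp: c bohr_def N_def)
  also have "\<dots> \<le> (\<Sum>g = 1..2 * N. 9 * real N * real N' * (1 / real g))"
  proof (rule sum_mono)
    fix g assume g: "g \<in> {1..2 * N}"
    have "real (card {n \<in> cell \<gamma> t J. g dvd n}) * real (card {n \<in> cell \<gamma> t' J'. g dvd n}) \<le> (3 * real N / real g) * (3 * real N' / real g)"
      unfolding c using g NN by (intro mult_mono card_multiples_le) auto
    then have "real g * (real (card {n \<in> cell \<gamma> t J. g dvd n}) * real (card {n \<in> cell \<gamma> t' J'. g dvd n})) \<le> real g * ((3 * real N / real g) * (3 * real N' / real g))"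
      by (rule mult_left_mono) simp
    then show "real g * (real (card {n \<in> cell \<gamma> t J. g dvd n}) * real (card {n \<in> cell \<gamma> t' J'. g dvd n})) \<le> 9 * real N * real N' * (1 / real g)"
      using g by simp
  qed
  also have "\<dots> = 9 * real N * real N' * (\<Sum>g = 1..2 ^ (m * t + 1). 1 / real g)"
    by (simp add: sum_distrib_left N_def)
  also have "\<dots> \<le> 9 * real N * real N' * (real (m * t + 1) + 1)"
    by (intro mult_left_mono harmonic_pow2_le) auto
  finally show ?thesis by (simp add: N_def N'_def add.commute)
qed

text \<open>Divisors up to \<open>G\<close> go to \<open>sum_gcd_small\<close>, the others to
  \<open>sum_gcd_large\<close>. Nearness of the blocks, \<open>z * (t' - t) \<le> t\<close>, keeps
  the length ratio \<open>T\<close> at most \<open>2 ^ (u * t)\<close>, so that all frequencies in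
  the second estimate remain small powers of the block length.\<close>

lemma sum_gcd_near_blocks:
  assumes t: "2 \<le> t" "t \<le> t'" "z * (t' - t) \<le> t" and \<kappa>t: "1 / \<kappa> \<le> 2 ^ t" and J: "J \<in> cells t" "J' \<in> cells t'"
  shows "(\<Sum>n\<in>cell \<gamma> t J. \<Sum>n'\<in>cell \<gamma> t' J'. real (gcd n n')) 
     \<le> 2 ^ (m * t) * 2 ^ (m * t') * vol2 J J' * (32 * 256 ^ d) * 
        ((real (m * t) + 2) * (1 / 2) ^ t + interaction (m * (t' - t)) J J')"
proof -
  \<comment> \<open>\<open>\<Lambda>\<close> bounds the frequencies of both cells, as
    \<open>4 * t' \<le> 8 * t\<close>. The exponent of \<open>Q\<close> is \<open>9 * d\<close> for
    the number of frequency vectors, \<open>3 * d\<close> for the lower bound of \<open>E\<close>,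
    and 1 for a gain of \<open>(1 / 2) ^ t\<close>. \<open>A\<close> is determined by
    \<open>G * A = 2 * N\<close>.\<close>
  define N N' G Q \<Lambda> A T :: nat where "N = 2 ^ (m * t)" and "N' = 2 ^ (m * t')" and "G = 2 ^ ((m - u) * t)"
    and "Q = 2 ^ ((12 * d + 1) * t)" and "\<Lambda> = 2 ^ (8 * t)" and "A = 2 ^ (u * t + 1)" and "T = 2 ^ (m * (t' - t))"
  define P P' where "P = (\<Prod>i\<in>I. rad J i)" and "P' = (\<Prod>i\<in>I. rad J' i)"
  define E where "E = vol2 J J'"
  note d1 = d_ge_1
  have u4: "u \<ge> 4" by (simp add: par_u_def)
  have z3: "z \<ge> 3" by (simp add: par_z_def)
  have um: "2 * u \<le> m" using z3 by (simp add: par_m_def mult.commute)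
  have mu: "m \<ge> u" using um by simp
  have ut: "1 \<le> u * t" using u4 t by (simp add: Suc_le_eq)
  have "1 * (t' - t) \<le> z * (t' - t)" using z3 by (intro mult_right_mono) auto
  then have t2: "t' \<le> 2 * t" using t by linarith
  have NN': "N' = T * N" unfolding N_def N'_def T_def power_add[symmetric] using t by (simp add: algebra_simps)
  have GA: "2 * N = G * A"
    using mu by (simp add: N_def G_def A_def power_add[symmetric] diff_mult_distrib)
  have "G \<le> N" unfolding G_def N_def by (intro power_increasing mult_right_mono) auto
  have "A \<le> N" unfolding A_def N_def
  proof (intro power_increasing)
    have "u * t + 1 \<le> 2 * u * t" using ut by simp
    also have "\<dots> \<le> m * t" using um by (intro mult_right_mono) auto
    finally show "u * t + 1 \<le> m * t" .
  qed auto
  have T: "1 \<le> T" by (simp add: T_def)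
  have NG: "real N / real G = 2 ^ (u * t)"
  proof -
    have "real (2 * N) = real (G * A)" using GA by simp
    then show ?thesis by (simp add: A_def G_def field_simps)
  qed
  have E0: "E > 0" by (simp add: E_def vol2_pos)
  have E1: "E \<le> (1 / 2) ^ t" unfolding E_def by (rule vol2_le[OF J t(2)])
  have E2: "(1 / 2) ^ (3 * d * t) \<le> E" unfolding E_def by (rule vol2_ge[OF J t2])
  have PP: "P * P' = E * E" unfolding P_def P'_def E_def by (rule vol2_sq[symmetric])
  \<comment> \<open>One factor \<open>E\<close> is required in the result; the other one supplies
    the \<open>(1 / 2) ^ t\<close> that outweighs the harmonic sums.\<close>
  then have PPE: "P * P' \<le> E * (1 / 2) ^ t" using E0 E1 by simp
  have \<rho>: "0 < rad J i \<and> rad J i \<le> 1 / 4" "1 / (16 * (rad J i)\<^sup>2) \<le> real \<Lambda>" if "i \<in> I" for i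
  proof -
    show "0 < rad J i \<and> rad J i \<le> 1 / 4" using rad_bounds[OF J(1) t(1) that] by auto
    have "(2::real) ^ (4 * t) \<le> 2 ^ (8 * t)" by (intro power_increasing) auto
    then show "1 / (16 * (rad J i)\<^sup>2) \<le> real \<Lambda>"
      unfolding \<Lambda>_def of_nat_power of_nat_numeral using rad_bounds(3)[OF J(1) t(1) that] by linarith
  qed
  have \<rho>': "0 < rad J' i \<and> rad J' i \<le> 1 / 4" "1 / (16 * (rad J' i)\<^sup>2) \<le> real \<Lambda>" if "i \<in> I" for i
  proof -
    have t': "2 \<le> t'" using t by simp
    show "0 < rad J' i \<and> rad J' i \<le> 1 / 4" using rad_bounds[OF J(2) t' that] by auto
    have "(2::real) ^ (4 * t') \<le> 2 ^ (8 * t)" using t2 by (intro power_increasing) auto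
    then show "1 / (16 * (rad J' i)\<^sup>2) \<le> real \<Lambda>"
      unfolding \<Lambda>_def of_nat_power of_nat_numeral using rad_bounds(3)[OF J(2) t' that] by linarith
  qed
  let ?S1 = "\<Sum>(n, n') | n \<in> bohr I \<alpha> \<gamma> (rad J) N \<and> n' \<in> bohr I \<alpha> \<gamma> (rad J') N' \<and> gcd n n' \<le> G. real (gcd n n')"
  let ?S2 = "\<Sum>(n, n') | n \<in> bohr I \<alpha> \<gamma> (rad J) N \<and> n' \<in> bohr I \<alpha> \<gamma> (rad J') N' \<and> G < gcd n n'. real (gcd n n')"
  have split: "(\<Sum>n\<in>cell \<gamma> t J. \<Sum>n'\<in>cell \<gamma> t' J'. real (gcd n n')) = ?S1 + ?S2"
  proof -
    let ?C = "cell \<gamma> t J \<times> cell \<gamma> t' J'"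
    have fin: "finite ?C" by (simp add: cell_def)
    have "(\<Sum>n\<in>cell \<gamma> t J. \<Sum>n'\<in>cell \<gamma> t' J'. real (gcd n n')) = (\<Sum>p\<in>?C. case p of (n, n') \<Rightarrow> real (gcd n n'))"
      by (simp add: sum.cartesian_product)
    also have "\<dots> = (\<Sum>p\<in>{p \<in> ?C. gcd (fst p) (snd p) \<le> G}. case p of (n, n') \<Rightarrow> real (gcd n n'))
       + (\<Sum>p\<in>{p \<in> ?C. \<not> gcd (fst p) (snd p) \<le> G}. case p of (n, n') \<Rightarrow> real (gcd n n'))"
      using fin by (subst sum.union_disjoint[symmetric]) (auto intro!: sum.cong)
    also have "{p \<in> ?C. gcd (fst p) (snd p) \<le> G} = {(n, n'). n \<in> bohr I \<alpha> \<gamma> (rad J) N \<and> n' \<in> bohr I \<alpha> \<gamma> (rad J') N' \<and> gcd n n' \<le> G}"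
      by (auto simp: cell_def N_def N'_def)
    also have "{p \<in> ?C. \<not> gcd (fst p) (snd p) \<le> G} = {(n, n'). n \<in> bohr I \<alpha> \<gamma> (rad J) N \<and> n' \<in> bohr I \<alpha> \<gamma> (rad J') N' \<and> G < gcd n n'}"
      by (auto simp: cell_def N_def N'_def)
    finally show ?thesis .
  qed
  define \<sigma> where "\<sigma> = \<kappa> / (2 * (real Q * real \<Lambda>) ^ W)"
  have \<sigma>0: "\<sigma> > 0" using kappa by (simp add: \<sigma>_def Q_def \<Lambda>_def)
  \<comment> \<open>The exponent needed per unit of \<open>t\<close> is
    \<open>4 * d + 1 + (12 * d + 9) * W\<close>, which is where \<open>par_u\<close> comes
    from.\<close>
  have err0: "1 / (2 * \<sigma>) \<le> (1 / 2) ^ (4 * t * d) * (real N / real G)"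
  proof -
    have "1 / (2 * \<sigma>) = (1 / \<kappa>) * (real Q * real \<Lambda>) ^ W" using kappa by (simp add: \<sigma>_def)
    also have "\<dots> \<le> 2 ^ t * (real Q * real \<Lambda>) ^ W" using \<kappa>t by (intro mult_right_mono) auto
    also have "\<dots> = 2 ^ (t + ((12 * d + 1) * t + 8 * t) * W)"
      by (simp only: Q_def \<Lambda>_def of_nat_power of_nat_numeral power_add[symmetric] power_mult[symmetric])
    also have "\<dots> = (1 / 2) ^ (4 * t * d) * 2 ^ (4 * t * d + (t + ((12 * d + 1) * t + 8 * t) * W))"
      by (simp add: power_add power_one_over)
    also have "\<dots> \<le> (1 / 2) ^ (4 * t * d) * 2 ^ (u * t)"
      by (intro mult_left_mono power_increasing) (auto simp: par_u_def algebra_simps)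
    finally show ?thesis by (simp only: NG)
  qed
  have P_ge: "(1 / 2) ^ (4 * t * d) \<le> P" "(1 / 2) ^ (4 * t * d) \<le> P'"
  proof -
    have "(1 / 2) ^ (4 * t * d) \<le> (1 / 2 :: real) ^ (2 * t * d)" by (intro power_decreasing) auto
    also have "\<dots> \<le> P" unfolding P_def by (rule prod_rad_ge[OF J(1)])
    finally show "(1 / 2) ^ (4 * t * d) \<le> P" .
    have "(1 / 2) ^ (4 * t * d) \<le> (1 / 2 :: real) ^ (2 * t' * d)" using t2 by (intro power_decreasing) auto
    also have "\<dots> \<le> P'" unfolding P'_def by (rule prod_rad_ge[OF J(2)])
    finally show "(1 / 2) ^ (4 * t * d) \<le> P'" .
  qed
  have "?S1 \<le> real N * real N' * (\<Sum>g = 1..G. 1 / real g) *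
        (9 * 256 ^ d * ((\<Prod>i\<in>I. rad J i) * (\<Prod>i\<in>I. rad J' i)) + 9 * (2 * real \<Lambda> + 1) ^ d / real Q)"
  proof (rule sum_gcd_small[OF finI _ \<open>G \<le> N\<close>])
    show "1 / (2 * \<sigma>) \<le> (\<Prod>i\<in>I. rad J i) * (real N / real G)"
      by (rule order_trans[OF err0], rule mult_right_mono) (use P_ge in \<open>auto simp: P_def\<close>)
    show "1 / (2 * \<sigma>) \<le> (\<Prod>i\<in>I. rad J' i) * (real N / real G)"
      by (rule order_trans[OF err0], rule mult_right_mono) (use P_ge in \<open>auto simp: P'_def\<close>)
    fix h :: "nat \<Rightarrow> int" and s assume h: "\<And>i. i \<in> I \<Longrightarrow> \<bar>h i\<bar> \<le> int \<Lambda>" "\<exists>i\<in>I. h i \<noteq> 0" "1 \<le> s" "s < Q"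
    have "\<kappa> / (real Q * real \<Lambda>) ^ W \<le> dist_int (\<Sum>i\<in>I. of_int (int s * h i) * \<alpha> i)"
    proof (rule far)
      fix i assume "i \<in> I"
      from h(1)[OF this] have "real_of_int \<bar>h i\<bar> \<le> real \<Lambda>" by linarith
      then have "real s * real_of_int \<bar>h i\<bar> \<le> real Q * real \<Lambda>" using h by (intro mult_mono) auto
      then show "real_of_int \<bar>int s * h i\<bar> \<le> real Q * real \<Lambda>" by (simp add: abs_mult)
    next
      have "1 \<le> real Q" "1 \<le> real \<Lambda>" by (simp_all add: Q_def \<Lambda>_def)
      then show "1 \<le> real Q * real \<Lambda>" using mult_mono[of 1 "real Q" 1 "real \<Lambda>"] by simp
    qed (use h in auto)
    also have "(\<Sum>i\<in>I. of_int (int s * h i) * \<alpha> i) = real s * (\<Sum>i\<in>I. of_int (h i) * \<alpha> i)"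
      by (simp add: sum_distrib_left mult_ac)
    finally show "2 * \<sigma> \<le> dist_int (real s * (\<Sum>i\<in>I. of_int (h i) * \<alpha> i))"
      by (simp add: \<sigma>_def)
  qed (use \<rho> \<rho>' \<sigma>0 T in \<open>auto simp: G_def NN' Q_def\<close>)
  also have "\<dots> \<le> real N * real N' * (real (m * t) + 2) * (9 * 256 ^ d * (E * (1 / 2) ^ t) + 9 * (E * (1 / 2) ^ t))"
  proof -
    have "(\<Sum>g = 1..G. 1 / real g) \<le> real ((m - u) * t) + 1" unfolding G_def by (rule harmonic_pow2_le)
    also have "real ((m - u) * t) \<le> real (m * t)" by (intro of_nat_mono mult_right_mono) auto
    finally have hG: "(\<Sum>g = 1..G. 1 / real g) \<le> real (m * t) + 2" by simp
    have hP: "(\<Prod>i\<in>I. rad J i) * (\<Prod>i\<in>I. rad J' i) \<le> E * (1 / 2) ^ t" using PPE by (simp add: P_def P'_def)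
    have "(2 * real \<Lambda> + 1) ^ d \<le> (2 ^ (9 * t)) ^ d"
    proof (rule power_mono)
      have "(1::real) \<le> 2 ^ (8 * t)" by simp
      then have "2 * real \<Lambda> + 1 \<le> 4 * 2 ^ (8 * t)" unfolding \<Lambda>_def of_nat_power of_nat_numeral by linarith
      also have "\<dots> \<le> 2 ^ t * 2 ^ (8 * t)" using power_increasing[of 2 t "2::real"] t by (intro mult_right_mono) auto
      finally show "2 * real \<Lambda> + 1 \<le> 2 ^ (9 * t)" by (simp add: power_add[symmetric])
    qed simp
    then have "9 * (2 * real \<Lambda> + 1) ^ d / real Q \<le> 9 * (2 ^ (9 * t)) ^ d / real Q"
      by (intro divide_right_mono mult_left_mono) auto
    also have "\<dots> = 9 * ((1 / 2) ^ (3 * d * t) * (1 / 2) ^ t)"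
    proof -
      have "(12 * d + 1) * t = 9 * t * d + 3 * d * t + t" by (simp add: algebra_simps)
      then have "real Q = 2 ^ (9 * t * d) * 2 ^ (3 * d * t) * 2 ^ t"
        by (simp only: Q_def of_nat_power of_nat_numeral of_nat_mult power_add)
      then show ?thesis unfolding power_mult[symmetric] by (simp add: power_one_over)
    qed
    also have "\<dots> \<le> 9 * (E * (1 / 2) ^ t)" using E2 by (intro mult_left_mono mult_right_mono) auto
    finally have hQ: "9 * (2 * real \<Lambda> + 1) ^ d / real Q \<le> 9 * (E * (1 / 2) ^ t)" .
    have "9 * 256 ^ d * ((\<Prod>i\<in>I. rad J i) * (\<Prod>i\<in>I. rad J' i)) + 9 * (2 * real \<Lambda> + 1) ^ d / real Q
      \<le> 9 * 256 ^ d * (E * (1 / 2) ^ t) + 9 * (E * (1 / 2) ^ t)"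
      by (rule add_mono[OF mult_left_mono[OF hP] hQ]) simp
    moreover have "0 \<le> 9 * 256 ^ d * ((\<Prod>i\<in>I. rad J i) * (\<Prod>i\<in>I. rad J' i)) + 9 * (2 * real \<Lambda> + 1) ^ d / real Q"
      by (intro add_nonneg_nonneg mult_nonneg_nonneg prod_nonneg divide_nonneg_nonneg) auto
    ultimately show ?thesis
      by (intro mult_mono[OF mult_left_mono[OF hG]]) auto
  qed
  also have "\<dots> \<le> real N * real N' * E * (18 * 256 ^ d) * ((real (m * t) + 2) * (1 / 2) ^ t)"
  proof -
    have "(1::real) \<le> 256 ^ d" by simp
    then have "real N * real N' * (real (m * t) + 2) * (E * (1 / 2) ^ t) * (9 * 256 ^ d + 9 * 1)
      \<le> real N * real N' * (real (m * t) + 2) * (E * (1 / 2) ^ t) * (9 * 256 ^ d + 9 * 256 ^ d)"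
      using E0 by (intro mult_left_mono add_left_mono) auto
    then show ?thesis by (simp add: algebra_simps)
  qed
  finally have S1: "?S1 \<le> real N * real N' * E * (18 * 256 ^ d) * ((real (m * t) + 2) * (1 / 2) ^ t)" .
  \<comment> \<open>A bound for \<open>4 * A * T * \<Lambda>\<close>, hence for all combinations
    \<open>a * h + b * h'\<close>: the exponents are \<open>u * t + 1\<close> for \<open>A\<close>,
    at most \<open>u * t\<close> for \<open>T\<close>, and \<open>8 * t\<close> for
    \<open>\<Lambda>\<close>.\<close>
  define H where "H = (2::real) ^ (2 * u * t + 3 + 8 * t)"
  define \<epsilon> where "\<epsilon> = \<kappa> / H ^ W"
  have \<epsilon>0: "\<epsilon> > 0" using kappa by (simp add: \<epsilon>_def H_def)
  have "?S2 \<le> 16 ^ d * (8 * real N * real N' * ((\<Sum>a = 1..A. 1 / real a) * (\<Prod>i\<in>I. 16 * rad J i * rad J' i)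
          + 2 * (\<Prod>i\<in>I. 16 * rad J i * rad J' i + 8 * min (rad J i) (rad J' i / real T))) + 2 * real N' * real A / \<epsilon>)"
  proof (rule sum_gcd_large[OF finI neI _ NN' T eq_refl[OF GA] \<open>A \<le> N\<close> \<rho>(1) \<rho>'(1) \<epsilon>0])
    show "1 \<le> N" by (simp add: N_def)
    fix h h' :: "nat \<Rightarrow> int" and a b 
    assume h: "\<And>i. i \<in> I \<Longrightarrow> real_of_int \<bar>h i\<bar> \<le> 1 / (16 * (rad J i)\<^sup>2)" "\<And>i. i \<in> I \<Longrightarrow> real_of_int \<bar>h' i\<bar> \<le> 1 / (16 * (rad J' i)\<^sup>2)"
      and ab: "1 \<le> a" "a \<le> A" "1 \<le> b" "b \<le> 2 * A * T" and ne: "\<exists>i\<in>I. int a * h i + int b * h' i \<noteq> 0"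
    show "\<epsilon> \<le> dist_int (\<Sum>i\<in>I. real_of_int (int a * h i + int b * h' i) * \<alpha> i)"
      unfolding \<epsilon>_def
    proof (rule far[OF _ _ ne])
      show "1 \<le> H" by (simp add: H_def)
      fix i assume i: "i \<in> I"
      have "\<bar>int a * h i + int b * h' i\<bar> \<le> int a * \<bar>h i\<bar> + int b * \<bar>h' i\<bar>"
        using abs_triangle_ineq[of "int a * h i" "int b * h' i"] by (simp add: abs_mult)
      then have "real_of_int \<bar>int a * h i + int b * h' i\<bar> \<le> real_of_int (int a * \<bar>h i\<bar> + int b * \<bar>h' i\<bar>)"
        by (simp only: of_int_le_iff)
      also have "\<dots> = real a * real_of_int \<bar>h i\<bar> + real b * real_of_int \<bar>h' i\<bar>" by simp
      also have "\<dots> \<le> real A * real \<Lambda> + real (2 * A * T) * real \<Lambda>"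
        using h(1)[OF i] h(2)[OF i] \<rho>(2)[OF i] \<rho>'(2)[OF i] ab
        by (intro add_mono mult_mono of_nat_mono) auto
      also have "\<dots> \<le> real (A * T) * real \<Lambda> + real (2 * A * T) * real \<Lambda>"
        using T by (intro add_right_mono mult_right_mono of_nat_mono) auto
      also have "\<dots> \<le> 4 * (real A * real T * real \<Lambda>)" by (simp add: mult_ac)
      also have "\<dots> = 2 ^ (2 + (u * t + 1) + m * (t' - t) + 8 * t)"
        by (simp add: A_def T_def \<Lambda>_def power_add)
      also have "\<dots> \<le> H"
      proof -
        have "m * (t' - t) = u * (z * (t' - t))" by (simp add: par_m_def)
        also have "\<dots> \<le> u * t" using t by (intro mult_left_mono) auto
        finally have "2 + (u * t + 1) + m * (t' - t) + 8 * t \<le> 2 * u * t + 3 + 8 * t" by linarith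
        then show ?thesis unfolding H_def by (rule power_increasing) simp
      qed
      finally show "real_of_int \<bar>int a * h i + int b * h' i\<bar> \<le> H" .
    qed
  qed
  also have "\<dots> \<le> 16 ^ d * (8 * real N * real N' * ((real (m * t) + 2) * (16 ^ d * (E * (1 / 2) ^ t))
          + 2 * (E * interaction (m * (t' - t)) J J')) + real N' * (real N * (E * (1 / 2) ^ t)))"
  proof -
    have "(\<Sum>a = 1..A. 1 / real a) \<le> real (u * t + 1) + 1" unfolding A_def by (rule harmonic_pow2_le)
    also have "real (u * t + 1) \<le> real (m * t) + 1" using mu by (simp add: mult_right_mono)
    finally have hA: "(\<Sum>a = 1..A. 1 / real a) \<le> real (m * t) + 2" by simp
    have "(\<Prod>i\<in>I. 16 * rad J i * rad J' i) = 16 ^ d * (P * P')"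
      by (simp add: prod.distrib P_def P'_def)
    also have "\<dots> \<le> 16 ^ d * (E * (1 / 2) ^ t)" using PPE by (intro mult_left_mono) auto
    finally have hP: "(\<Prod>i\<in>I. 16 * rad J i * rad J' i) \<le> 16 ^ d * (E * (1 / 2) ^ t)" .
    have hI: "(\<Prod>i\<in>I. 16 * rad J i * rad J' i + 8 * min (rad J i) (rad J' i / real T)) \<le> E * interaction (m * (t' - t)) J J'"
      unfolding T_def interaction_eq E_def by simp
    have "2 * real A / \<epsilon> = (1 / \<kappa>) * 2 ^ (u * t + 2) * H ^ W" using kappa by (simp add: \<epsilon>_def A_def)
    also have "\<dots> \<le> 2 ^ t * 2 ^ (u * t + 2) * H ^ W" using \<kappa>t by (intro mult_right_mono) (auto simp: H_def)
    also have "\<dots> = 2 ^ (t + (u * t + 2) + (2 * u * t + 3 + 8 * t) * W)"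
      by (simp only: H_def power_add[symmetric] power_mult[symmetric])
    \<comment> \<open>The error has to fall below \<open>N * E * (1 / 2) ^ t\<close>, where
      \<open>E\<close> may be as small as \<open>(1 / 2) ^ (3 * d * t)\<close>. The summands
      \<open>12 * W\<close> and \<open>3 * d\<close> of \<open>par_z\<close> serve this inequality,
      the first through \<open>2 * u + 10 \<le> 12 * u\<close>.\<close>
    also have "\<dots> \<le> 2 ^ (m * t - (3 * d * t + t))"
    proof (intro power_increasing)
      have a1: "2 \<le> t" "3 \<le> 2 * t" using t by auto
      have "t + (u * t + 2) + (2 * u * t + 3 + 8 * t) * W + (3 * d * t + t) 
          \<le> t + (u * t + t) + (2 * u * t + 2 * t + 8 * t) * W + (3 * d * t + t)"
        using a1 by (intro add_mono mult_right_mono) auto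
      also have "\<dots> = t * (u + 3 + (2 * u + 10) * W + 3 * d)" by (simp add: algebra_simps)
      also have "\<dots> \<le> t * (u * z)"
      proof (intro mult_left_mono)
        have "(2 * u + 10) * W \<le> (12 * u) * W" using u4 by (intro mult_right_mono) auto
        moreover have "3 * d \<le> u * (3 * d)" using u4 by simp
        moreover have "u * z = 12 * u * W + u * (3 * d) + 3 * u" by (simp add: par_z_def algebra_simps)
        ultimately show "u + 3 + (2 * u + 10) * W + 3 * d \<le> u * z" using u4 by linarith
      qed simp
      also have "\<dots> = m * t" by (simp add: par_m_def)
      finally show "t + (u * t + 2) + (2 * u * t + 3 + 8 * t) * W \<le> m * t - (3 * d * t + t)" by linarith
    qed auto
    also have "\<dots> = real N * ((1 / 2) ^ (3 * d * t) * (1 / 2) ^ t)"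
    proof -
      have "3 * d * t + t \<le> m * t"
      proof -
        have "3 * d + 1 \<le> z" by (simp add: par_z_def)
        also have "\<dots> \<le> m" using u4 by (simp add: par_m_def)
        finally have "(3 * d + 1) * t \<le> m * t" by (rule mult_right_mono) simp
        then show ?thesis by (simp add: algebra_simps)
      qed
      then show ?thesis by (simp add: N_def power_diff power_add power_one_over)
    qed
    also have "\<dots> \<le> real N * (E * (1 / 2) ^ t)" using E2 by (intro mult_left_mono mult_right_mono) auto
    finally have "real N' * (2 * real A / \<epsilon>) \<le> real N' * (real N * (E * (1 / 2) ^ t))" by (rule mult_left_mono) simp
    then have hE: "2 * real N' * real A / \<epsilon> \<le> real N' * (real N * (E * (1 / 2) ^ t))" by (simp add: mult_ac)
    have p0: "0 \<le> (\<Prod>i\<in>I. 16 * rad J i * rad J' i)" by (intro prod_nonneg) auto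
    have "(\<Sum>a = 1..A. 1 / real a) * (\<Prod>i\<in>I. 16 * rad J i * rad J' i) \<le> (real (m * t) + 2) * (16 ^ d * (E * (1 / 2) ^ t))"
      by (rule mult_mono[OF hA hP _ p0]) simp
    then have "8 * real N * real N' * ((\<Sum>a = 1..A. 1 / real a) * (\<Prod>i\<in>I. 16 * rad J i * rad J' i)
          + 2 * (\<Prod>i\<in>I. 16 * rad J i * rad J' i + 8 * min (rad J i) (rad J' i / real T)))
       \<le> 8 * real N * real N' * ((real (m * t) + 2) * (16 ^ d * (E * (1 / 2) ^ t)) + 2 * (E * interaction (m * (t' - t)) J J'))"
      by (intro mult_left_mono[OF add_mono[OF _ mult_left_mono[OF hI]]]) auto
    from mult_left_mono[OF add_mono[OF this hE], of "16 ^ d"] show ?thesis by simp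
  qed
  also have "\<dots> \<le> real N * real N' * E * (14 * 256 ^ d) * ((real (m * t) + 2) * (1 / 2) ^ t) + 
        real N * real N' * E * (32 * 256 ^ d) * interaction (m * (t' - t)) J J'"
  proof -
    have i0: "0 \<le> interaction (m * (t' - t)) J J'" unfolding interaction_def by (intro prod_nonneg) (simp add: sqrt_half_pos less_imp_le)
    define B where "B = real N * real N' * E"
    have B0: "B \<ge> 0" using E0 by (simp add: B_def)
    define x where "x = (1 / 2 :: real) ^ t"
    have x0: "x \<ge> 0" by (simp add: x_def)
    have c1: "(16::real) ^ d * 16 ^ d = 256 ^ d" by (simp flip: power_mult_distrib)
    have c2: "(16::real) ^ d \<le> 256 ^ d" by (intro power_mono) auto
    have "16 ^ d * (8 * real N * real N' * ((real (m * t) + 2) * (16 ^ d * (E * x))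
          + 2 * (E * interaction (m * (t' - t)) J J')) + real N' * (real N * (E * x)))
       = 8 * (16 ^ d * 16 ^ d) * (B * ((real (m * t) + 2) * x)) + 16 * 16 ^ d * (B * interaction (m * (t' - t)) J J') + 16 ^ d * (B * (1 * x))"
      by (simp add: B_def algebra_simps)
    also have "\<dots> \<le> 8 * (16 ^ d * 16 ^ d) * (B * ((real (m * t) + 2) * x)) + 16 * 256 ^ d * (B * interaction (m * (t' - t)) J J') + 256 ^ d * (B * ((real (m * t) + 2) * x))"
      using c2 B0 x0 i0 by (intro add_mono order_refl mult_mono mult_nonneg_nonneg) auto
    also have "\<dots> \<le> 14 * 256 ^ d * (B * ((real (m * t) + 2) * x)) + 32 * 256 ^ d * (B * interaction (m * (t' - t)) J J')"
    proof -
      have "0 \<le> 256 ^ d * (B * ((real (m * t) + 2) * x))" "0 \<le> 256 ^ d * (B * interaction (m * (t' - t)) J J')"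
        using B0 x0 i0 by simp_all
      then show ?thesis unfolding c1 by linarith
    qed
    finally show ?thesis by (simp add: B_def x_def mult_ac)
  qed
  finally have S2: "?S2 \<le> real N * real N' * E * (14 * 256 ^ d) * ((real (m * t) + 2) * (1 / 2) ^ t) + 
        real N * real N' * E * (32 * 256 ^ d) * interaction (m * (t' - t)) J J'" .
  have "?S1 + ?S2 \<le> real N * real N' * E * (32 * 256 ^ d) * ((real (m * t) + 2) * (1 / 2) ^ t + interaction (m * (t' - t)) J J')"
    using S1 S2 by (simp add: algebra_simps)
  then show ?thesis unfolding split by (simp add: N_def N'_def E_def)
qed

end

section \<open>The second moment inequality and geometric sums\<close>

lemma chung_erdos:
  fixes E :: "'a \<Rightarrow> real set"
  assumes fin: "finite A" and E: "\<And>a. a \<in> A \<Longrightarrow> E a \<in> fmeasurable lborel"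
    and K: "K > 0" and M: "(\<Sum>a\<in>A. measure lborel (E a)) > 0"
    and S: "(\<Sum>a\<in>A. \<Sum>b\<in>A. measure lborel (E a \<inter> E b)) \<le> K * (\<Sum>a\<in>A. measure lborel (E a))\<^sup>2"
  shows "measure lborel (\<Union>a\<in>A. E a) \<ge> 1 / K"
proof -
  define U where "U = (\<Union>a\<in>A. E a)"
  define M0 where "M0 = (\<Sum>a\<in>A. measure lborel (E a))"
  define S0 where "S0 = (\<Sum>a\<in>A. \<Sum>b\<in>A. measure lborel (E a \<inter> E b))"
  \<comment> \<open>Nonnegativity of the integral of
    \<open>(f x - c * indicator U x)\<^sup>2\<close> replaces Cauchy-Schwarz. The value
    \<open>K * M0\<close> is the optimal one when the union has measure exactly
    \<open>1 / K\<close>.\<close>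
  define c where "c = K * M0"
  have U: "U \<in> fmeasurable lborel" unfolding U_def using fin E by (intro fmeasurable.finite_UN) auto
  have EE: "E a \<inter> E b \<in> fmeasurable lborel" if "a \<in> A" "b \<in> A" for a b
    using fmeasurable_Int_fmeasurable[OF E fmeasurableD[OF E]] that by simp
  have ind: "has_bochner_integral lborel (indicator X) (measure lborel X :: real)" if "X \<in> fmeasurable lborel" for X :: "real set"
    using that by (intro has_bochner_integral_real_indicator) (auto simp: fmeasurable_def)
  define f where "f x = (\<Sum>a\<in>A. indicator (E a) x :: real)" for x
  have sq: "(f x - c * indicator U x)\<^sup>2 = (\<Sum>a\<in>A. \<Sum>b\<in>A. indicator (E a \<inter> E b) x) - 2 * c * f x + c\<^sup>2 * indicator U x" for x
  proof -
    have "(f x)\<^sup>2 = (\<Sum>a\<in>A. \<Sum>b\<in>A. indicator (E a \<inter> E b) x)"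
      by (simp add: f_def power2_eq_square sum_product indicator_inter_arith)
    moreover have "f x * indicator U x = f x"
    proof (cases "x \<in> U")
      case False
      then have "f x = 0" unfolding f_def by (intro sum.neutral) (auto simp: U_def)
      then show ?thesis by simp
    qed simp
    moreover have "(indicator U x)\<^sup>2 = (indicator U x :: real)" by (simp add: indicator_def)
    moreover have "(f x - c * indicator U x)\<^sup>2 = (f x)\<^sup>2 - 2 * c * (f x * indicator U x) + c\<^sup>2 * (indicator U x)\<^sup>2"
      by (simp add: power2_eq_square algebra_simps)
    ultimately show ?thesis by simp
  qed
  have "has_bochner_integral lborel (\<lambda>x. (f x - c * indicator U x)\<^sup>2) (S0 - 2 * c * M0 + c\<^sup>2 * measure lborel U)"
    unfolding sq unfolding S0_def M0_def f_def
    by (intro has_bochner_integral_add has_bochner_integral_diff has_bochner_integral_sum has_bochner_integral_mult_right ind EE E U)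
  then have "(\<integral>x. (f x - c * indicator U x)\<^sup>2 \<partial>lborel) = S0 - 2 * c * M0 + c\<^sup>2 * measure lborel U"
    by (rule has_bochner_integral_integral_eq)
  moreover have "0 \<le> (\<integral>x. (f x - c * indicator U x)\<^sup>2 \<partial>lborel)"
    by (rule Bochner_Integration.integral_nonneg) simp
  ultimately have "0 \<le> S0 - 2 * c * M0 + c\<^sup>2 * measure lborel U" by simp
  also have "\<dots> \<le> K * M0\<^sup>2 - 2 * c * M0 + c\<^sup>2 * measure lborel U"
    using S by (simp add: S0_def M0_def)
  also have "\<dots> = K * M0\<^sup>2 * (K * measure lborel U - 1)"
    by (simp add: c_def power2_eq_square algebra_simps)
  finally have nn: "0 \<le> K * M0\<^sup>2 * (K * measure lborel U - 1)" .
  have "K * M0\<^sup>2 > 0" using K M by (simp add: M0_def)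
  then have "K * measure lborel U - 1 \<ge> 0"
    using nn by (metis mult_pos_neg not_le)
  then show ?thesis using K by (simp add: U_def field_simps)
qed

lemma sqrt_half_less: "sqrt_half < 3 / 4"
  unfolding sqrt_half_def by (rule real_less_lsqrt) (auto simp: power2_eq_square)

lemma sum_sqrt_half_le:
  assumes "finite A" shows "(\<Sum>j\<in>A. sqrt_half ^ j) \<le> 4"
proof -
  have n: "norm sqrt_half < 1" using sqrt_half_pos sqrt_half_less by simp
  have "(\<Sum>j\<in>A. sqrt_half ^ j) \<le> (\<Sum>j. sqrt_half ^ j)"
    using assms n sqrt_half_pos by (intro sum_le_suminf summable_geometric) auto
  also have "\<dots> = 1 / (1 - sqrt_half)" using n by (rule suminf_geometric)
  also have "\<dots> \<le> 1 / (1 / 4)" using sqrt_half_less by (intro divide_left_mono) auto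
  finally show ?thesis by simp
qed

lemma sum_sqrt_half_dist_le:
  fixes A :: "nat set" and c :: int
  assumes "finite A" shows "(\<Sum>j\<in>A. sqrt_half ^ nat \<bar>int j - c\<bar>) \<le> 8"
proof -
  define A1 A2 where "A1 = {j \<in> A. c \<le> int j}" and "A2 = {j \<in> A. int j < c}"
  have "(\<Sum>j\<in>A. sqrt_half ^ nat \<bar>int j - c\<bar>) = (\<Sum>j\<in>A1. sqrt_half ^ nat \<bar>int j - c\<bar>) + (\<Sum>j\<in>A2. sqrt_half ^ nat \<bar>int j - c\<bar>)"
    using assms by (subst sum.union_disjoint[symmetric]) (auto simp: A1_def A2_def intro!: sum.cong)
  also have "(\<Sum>j\<in>A1. sqrt_half ^ nat \<bar>int j - c\<bar>) = (\<Sum>k\<in>(\<lambda>j. nat \<bar>int j - c\<bar>) ` A1. sqrt_half ^ k)"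
    by (subst sum.reindex) (auto simp: inj_on_def A1_def)
  also have "\<dots> \<le> 4" using assms by (intro sum_sqrt_half_le) (auto simp: A1_def)
  also have "(\<Sum>j\<in>A2. sqrt_half ^ nat \<bar>int j - c\<bar>) = (\<Sum>k\<in>(\<lambda>j. nat \<bar>int j - c\<bar>) ` A2. sqrt_half ^ k)"
    by (subst sum.reindex) (auto simp: inj_on_def A2_def)
  also have "\<dots> \<le> 4" using assms by (intro sum_sqrt_half_le) (auto simp: A2_def)
  finally show ?thesis by simp
qed

text \<open>The nonresonant part of the correlation with block \<open>t\<close>, counted for
  \<open>t ^ d\<close> cells and up to \<open>t + 1\<close> earlier blocks.\<close>

definition tail_weight :: "nat \<Rightarrow> nat \<Rightarrow> nat \<Rightarrow> real" where
  "tail_weight d W t = (real t + 1) * real t ^ d * (real (par_m d W * t) + 2) * sqrt_half ^ t"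

text \<open>Multiplying the derivative of the power series with coefficients \<open>n ^ k\<close> by
  \<open>x\<close> gives the series with coefficients \<open>n ^ (k + 1)\<close>, and
  differentiation keeps the radius of convergence.\<close>

lemma summable_monomial_geometric:
  fixes x :: real
  assumes "norm x < 1" shows "summable (\<lambda>n. real n ^ k * x ^ n)"
  using assms
proof (induction k arbitrary: x)
  case (Suc k)
  have "summable (\<lambda>n. diffs (\<lambda>n. real n ^ k) n * x ^ n)"
    by (rule termdiff_converges[of x 1]) (use Suc in auto)
  then have "summable (\<lambda>n. x * (diffs (\<lambda>n. real n ^ k) n * x ^ n))"
    by (rule summable_mult)
  then have "summable (\<lambda>n. real (Suc n) ^ Suc k * x ^ Suc n)"
    by (simp add: diffs_def mult_ac)
  then show ?case by (subst (asm) summable_Suc_iff)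
qed (simp add: summable_geometric)

lemma summable_tail_weight: "summable (tail_weight d W)"
proof -
  have n: "norm sqrt_half < 1" using sqrt_half_pos sqrt_half_less by simp
  have "tail_weight d W = (\<lambda>t. real (par_m d W) * (real t ^ (d + 2) * sqrt_half ^ t)
      + (real (par_m d W) + 2) * (real t ^ (d + 1) * sqrt_half ^ t) + 2 * (real t ^ d * sqrt_half ^ t))"
    by (rule ext) (simp add: tail_weight_def algebra_simps power2_eq_square)
  then show ?thesis
    by (simp only:) (intro summable_add summable_mult summable_monomial_geometric n)
qed

definition tail_const :: "nat \<Rightarrow> nat \<Rightarrow> real" where
  "tail_const d W = (\<Sum>t. tail_weight d W t)"

lemma tail_weight_nonneg: "tail_weight d W t \<ge> 0"
  unfolding tail_weight_def using sqrt_half_pos by (intro mult_nonneg_nonneg) auto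

lemma tail_const_nonneg: "tail_const d W \<ge> 0"
  unfolding tail_const_def using summable_tail_weight tail_weight_nonneg by (rule suminf_nonneg)

lemma sum_tail_weight_le:
  assumes "finite T" shows "(\<Sum>t\<in>T. tail_weight d W t) \<le> tail_const d W"
  unfolding tail_const_def
  using assms summable_tail_weight tail_weight_nonneg by (intro sum_le_suminf) auto

lemma tail_weight_le: "tail_weight d W t \<le> tail_const d W"
  using sum_tail_weight_le[of "{t}" d W] by simp


section \<open>Sizes of single cells\<close>

context dioph
begin

abbreviation "vol J \<equiv> \<Prod>i\<in>I. rad J i"

text \<open>The factor of \<open>card_box_ge\<close>, halved once more because half of the main term
  is spent on absorbing the error.\<close>

definition size_const :: real where "size_const = 1 / (4 * (2 * sqrt (2 * real d)) ^ d)"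

lemma par_m_ge: "12 * W + 7 * d + 7 \<le> m"
proof -
  have "4 * d + 4 \<le> u" by (simp add: par_u_def)
  moreover have "1 \<le> u" "z \<ge> 2" by (auto simp: par_u_def par_z_def)
  moreover have "12 * W + 7 * d + 7 \<le> (4 * d + 4) + z" by (simp add: par_z_def)
  moreover have "u + z \<le> u * z" 
  proof -
    have "u \<ge> 2" by (simp add: par_u_def)
    then obtain a where "u = a + 2" by (metis add.commute le_Suc_ex)
    moreover obtain b where "z = b + 2" using \<open>z \<ge> 2\<close> by (metis add.commute le_Suc_ex)
    ultimately show ?thesis by simp
  qed
  ultimately show ?thesis by (simp add: par_m_def)
qed

lemma vol_pos: "vol J > 0"
  by (intro prod_pos) simp

text \<open>The right side is the expected size of a cell. That it is a large power of
  \<open>2 ^ t\<close> lets it dominate the Diophantine errors in both counts below.\<close>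

lemma length_vol_ge:
  assumes "J \<in> cells t"
  shows "2 ^ ((m - 2 * d) * t) \<le> 2 ^ (m * t) * vol J"
proof -
  have "2 * d \<le> m" using par_m_ge by simp
  then have "2 ^ ((m - 2 * d) * t) = (2 :: real) ^ (m * t) * (1 / 2) ^ (2 * t * d)"
  proof -
    obtain k where k: "m = 2 * d + k" using le_Suc_ex[OF \<open>2 * d \<le> m\<close>] ..
    have "m * t = (m - 2 * d) * t + 2 * t * d" unfolding k by (simp add: algebra_simps)
    then have "(2 :: real) ^ (m * t) = 2 ^ ((m - 2 * d) * t) * 2 ^ (2 * t * d)" by (simp only: power_add)
    then show ?thesis by (simp add: power_one_over)
  qed
  also have "\<dots> \<le> 2 ^ (m * t) * vol J"
    using prod_rad_ge[OF assms] by (intro mult_left_mono) auto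
  finally show ?thesis .
qed

lemma card_cell_le:
  assumes t: "2 \<le> t" "1 / \<kappa> \<le> 2 ^ t" and J: "J \<in> cells t"
  shows "real (card (cell \<gamma> t J)) \<le> 3 * 16 ^ d * (2 ^ (m * t) * vol J)"
proof -
  define N :: nat where "N = 2 ^ (m * t)"
  define H where "H = (2 :: real) ^ (4 * t)"
  have "real (card {n \<in> bohr I \<alpha> \<gamma> (rad J) N. 1 dvd n}) \<le> 3 * 16 ^ card I * (\<Prod>i\<in>I. rad J i) * (real N / real 1)"
  proof (rule card_multiples_box_le[OF finI])
    show "0 < \<kappa> / H ^ W" using kappa by (simp add: H_def)
    show "0 < rad J i \<and> rad J i \<le> 1 / 4" if "i \<in> I" for i using rad_bounds[OF J t(1) that] by auto
    fix h :: "nat \<Rightarrow> int" assume h: "\<And>i. i \<in> I \<Longrightarrow> real_of_int \<bar>h i\<bar> \<le> 1 / (16 * (rad J i)\<^sup>2)" "\<exists>i\<in>I. h i \<noteq> 0"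
    have "\<kappa> / H ^ W \<le> dist_int (\<Sum>i\<in>I. of_int (h i) * \<alpha> i)"
    proof (rule far[OF _ _ h(2)])
      fix i assume i: "i \<in> I"
      show "real_of_int \<bar>h i\<bar> \<le> H" unfolding H_def using h(1)[OF i] rad_bounds(3)[OF J t(1) i] by linarith
    qed (simp add: H_def)
    then show "\<kappa> / H ^ W \<le> dist_int (real 1 * (\<Sum>i\<in>I. of_int (h i) * \<alpha> i))" by simp
  next
    have "1 / (2 * (\<kappa> / H ^ W)) = (1 / \<kappa>) * H ^ W / 2" by simp
    also have "\<dots> \<le> (1 / \<kappa>) * H ^ W"
    proof -
      have half: "x / 2 \<le> x" if "0 \<le> x" for x :: real using that by simp
      show ?thesis by (rule half) (use kappa in \<open>simp add: H_def\<close>)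
    qed
    also have "\<dots> \<le> 2 ^ t * H ^ W" using t by (intro mult_right_mono) (auto simp: H_def)
    also have "\<dots> = 2 ^ (t + 4 * t * W)" by (simp only: H_def power_add[symmetric] power_mult[symmetric])
    also have "\<dots> \<le> 2 ^ ((m - 2 * d) * t)"
    proof (intro power_increasing)
      have "(1 + 4 * W) * t \<le> (m - 2 * d) * t" using par_m_ge by (intro mult_right_mono) auto
      then show "t + 4 * t * W \<le> (m - 2 * d) * t" by (simp add: algebra_simps)
    qed auto
    also have "\<dots> \<le> 2 ^ (m * t) * vol J" by (rule length_vol_ge[OF J])
    finally show "1 / (2 * (\<kappa> / H ^ W)) \<le> vol J * (real N / real 1)" by (simp add: N_def mult.commute)
  qed (auto simp: N_def)
  then show ?thesis by (simp add: cell_def N_def mult_ac)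
qed

lemma card_cell_ge:
  assumes t: "2 \<le> t" "1 / \<kappa> \<le> 2 ^ t" "(2 * real d) ^ (W + 1) / size_const \<le> 2 ^ t" and J: "J \<in> cells t"
  shows "real (card (cell \<gamma> t J)) \<ge> size_const * (2 ^ (m * t) * vol J)"
proof -
  define N :: nat where "N = 2 ^ (m * t)"
  define X where "X = (2 :: real) ^ (4 * t)"
  define H where "H = 2 * real d * X"
  define c where "c = (2 * sqrt (2 * real d)) ^ d"
  have d1: "real d \<ge> 1" using d_ge_1 by simp
  have X1: "X \<ge> 1" by (simp add: X_def)
  have H1: "H \<ge> 1" using mult_mono[of 1 "2 * real d" 1 X] d1 X1 by (simp add: H_def)
  have c0: "c > 0" using d1 by (simp add: c_def)
  have \<epsilon>0: "\<kappa> / H ^ W > 0" using kappa H1 by simp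
  have b1: "real (card {n \<in> {N..<N + N}. \<forall>i\<in>I. dist_int (real n * \<alpha> i - \<gamma> i) \<le> rad J i})
     \<ge> real N / 2 * (\<Prod>i\<in>I. rad J i / (2 * sqrt (2 * card I))) - (1 + (\<Sum>i\<in>I. 1 / (rad J i)\<^sup>2)) / (\<kappa> / H ^ W)"
  proof (rule card_box_ge[OF finI _ \<epsilon>0])
    show "1 \<le> card I" by (rule d_ge_1)
    show "0 < rad J i \<and> rad J i \<le> 1 / 4" if "i \<in> I" for i using rad_bounds[OF J t(1) that] by auto
    fix h :: "nat \<Rightarrow> int" assume h: "\<And>i. i \<in> I \<Longrightarrow> real_of_int \<bar>h i\<bar> \<le> real (2 * card I) / (rad J i)\<^sup>2" "\<exists>i\<in>I. h i \<noteq> 0"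
    show "\<kappa> / H ^ W \<le> dist_int (\<Sum>i\<in>I. of_int (h i) * \<alpha> i)"
    proof (rule far[OF _ H1 h(2)])
      fix i assume i: "i \<in> I"
      have "real (2 * card I) / (rad J i)\<^sup>2 \<le> 2 * real d * X"
        using mult_left_mono[OF rad_bounds(4)[OF J t(1) i], of "2 * real d"] by (simp add: X_def)
      then show "real_of_int \<bar>h i\<bar> \<le> H" unfolding H_def using h(1)[OF i] by linarith
    qed
  qed
  have b2: "{n \<in> {N..<N + N}. \<forall>i\<in>I. dist_int (real n * \<alpha> i - \<gamma> i) \<le> rad J i} = cell \<gamma> t J"
    by (simp add: cell_def bohr_def N_def mult_2)
  have b3: "(\<Prod>i\<in>I. rad J i / (2 * sqrt (2 * card I))) = vol J / c"
    by (simp add: prod_dividef c_def)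
  have b4: "(1 + (\<Sum>i\<in>I. 1 / (rad J i)\<^sup>2)) / (\<kappa> / H ^ W) \<le> real N * vol J / (4 * c)"
  proof -
    have "(\<Sum>i\<in>I. 1 / (rad J i)\<^sup>2) \<le> (\<Sum>i\<in>I. X)"
      by (intro sum_mono) (use rad_bounds(4)[OF J t(1)] in \<open>simp add: X_def\<close>)
    then have "1 + (\<Sum>i\<in>I. 1 / (rad J i)\<^sup>2) \<le> 1 * 1 + real d * X" by simp
    also have "\<dots> \<le> real d * X + real d * X" using d1 X1 by (intro add_right_mono mult_mono) auto
    finally have s: "1 + (\<Sum>i\<in>I. 1 / (rad J i)\<^sup>2) \<le> H" by (simp add: H_def mult_ac)
    have "(1 + (\<Sum>i\<in>I. 1 / (rad J i)\<^sup>2)) / (\<kappa> / H ^ W) \<le> H / (\<kappa> / H ^ W)"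
      using s \<epsilon>0 by (intro divide_right_mono) auto
    also have "\<dots> = (1 / \<kappa>) * H ^ (W + 1)" using kappa H1 by simp
    also have "\<dots> \<le> 2 ^ t * H ^ (W + 1)" using t H1 by (intro mult_right_mono) auto
    also have "\<dots> = 2 ^ t * ((2 * real d) ^ (W + 1) * X ^ (W + 1))" unfolding H_def power_mult_distrib ..
    also have "\<dots> \<le> 2 ^ t * ((2 ^ t * size_const) * X ^ (W + 1))"
      using t(3) c0 X1 by (intro mult_left_mono mult_right_mono) (auto simp: size_const_def c_def field_simps)
    also have "\<dots> = 2 ^ (t + t + 4 * t * (W + 1)) * size_const"
      unfolding X_def power_mult[symmetric] power_add[of 2 "t + t"] power_add[of 2 t t] by (simp only: mult_ac)
    also have "\<dots> \<le> 2 ^ ((m - 2 * d) * t) * size_const"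
    proof (intro mult_right_mono power_increasing)
      have "(6 + 4 * W) * t \<le> (m - 2 * d) * t" using par_m_ge by (intro mult_right_mono) auto
      then show "t + t + 4 * t * (W + 1) \<le> (m - 2 * d) * t" by (simp add: algebra_simps)
    qed (use c0 in \<open>auto simp: size_const_def c_def\<close>)
    also have "\<dots> \<le> (2 ^ (m * t) * vol J) * size_const"
      using length_vol_ge[OF J] c0 by (intro mult_right_mono) (auto simp: size_const_def c_def)
    finally show ?thesis by (simp add: size_const_def N_def c_def)
  qed
  have "real (card (cell \<gamma> t J)) \<ge> real N / 2 * (vol J / c) - real N * vol J / (4 * c)"
    using b1[unfolded b2 b3] b4 by linarith
  also have "real N / 2 * (vol J / c) - real N * vol J / (4 * c) = size_const * (2 ^ (m * t) * vol J)"
  proof -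
    have "size_const = 1 / (4 * c)" by (simp add: size_const_def c_def)
    then show ?thesis using c0 by (simp add: N_def field_simps)
  qed
  finally show ?thesis .
qed

end

section \<open>Correlations of cells and the measure of finitely many blocks\<close>

context dioph
begin

text \<open>Normalised so that the events of one cell have total measure comparable to
  \<open>v t\<close>, whatever \<open>J\<close> is.\<close>

definition width :: "(nat \<Rightarrow> real) \<Rightarrow> nat \<Rightarrow> (nat \<Rightarrow> nat) \<Rightarrow> real" where
  "width v t J = v t / (2 ^ (m * t) * vol J)"

text \<open>The place where \<open>\<kappa>\<close> enters: it delays the first usable block but
  changes no constant.\<close>

definition large :: "nat \<Rightarrow> bool" where
  "large t \<longleftrightarrow> 2 \<le> t \<and> 1 / \<kappa> \<le> 2 ^ t \<and> (2 * real d) ^ (W + 1) / size_const \<le> 2 ^ t"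

text \<open>Meant for \<open>t \<le> t'\<close>: the nonresonant contribution, plus the resonant one
  if the blocks are near.\<close>

definition corr :: "nat \<Rightarrow> (nat \<Rightarrow> nat) \<Rightarrow> nat \<Rightarrow> (nat \<Rightarrow> nat) \<Rightarrow> real" where
  "corr t J t' J' = (real (m * t') + 2) * sqrt_half ^ t' + (if z * (t' - t) \<le> t then interaction (m * (t' - t)) J J' else 0)"

definition gcdsum :: "(nat \<Rightarrow> real) \<Rightarrow> (nat \<Rightarrow> real) \<Rightarrow> nat \<Rightarrow> (nat \<Rightarrow> nat) \<Rightarrow> nat \<Rightarrow> (nat \<Rightarrow> nat) \<Rightarrow> real" where
  "gcdsum \<gamma> v t J t' J' = (\<Sum>n\<in>cell \<gamma> t J. \<Sum>n'\<in>cell \<gamma> t' J'. real (gcd n n') * min (width v t J / n) (width v t' J' / n'))"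

lemma interaction_nonneg: "0 \<le> interaction s J J'"
  unfolding interaction_def by (intro prod_nonneg) (simp add: sqrt_half_pos less_imp_le)

lemma corr_nonneg: "0 \<le> corr t J t' J'"
  using interaction_nonneg sqrt_half_pos by (simp add: corr_def)

lemma gcdsum_commute: "gcdsum \<gamma> v t J t' J' = gcdsum \<gamma> v t' J' t J"
  unfolding gcdsum_def by (subst sum.swap) (simp add: gcd.commute min.commute)

lemma eventually_large: "\<exists>t0. \<forall>t\<ge>t0. large t"
proof -
  obtain t1 where t1: "1 / \<kappa> < 2 ^ t1" using real_arch_pow[of 2] by auto
  obtain t2 where t2: "(2 * real d) ^ (W + 1) / size_const < 2 ^ t2" using real_arch_pow[of 2] by auto
  have "large t" if "t \<ge> max 2 (max t1 t2)" for t
  proof -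
    have "(2::real) ^ t1 \<le> 2 ^ t" "(2::real) ^ t2 \<le> 2 ^ t" using that by (auto intro!: power_increasing)
    then show ?thesis unfolding large_def using t1 t2 that by (intro conjI) linarith+
  qed
  then show ?thesis by blast
qed

lemma card_cells: "card (cells t) = t ^ d"
  using finI by (simp add: card_PiE)

lemma finite_cells: "finite (cells t)"
  using finI by (intro finite_PiE) auto

text \<open>All \<open>n\<close> in a block are comparable, so the minimum can be taken out of the
  sum as \<open>\<mu>\<close>. For near blocks the geometric mean bounds \<open>\<mu>\<close> and
  cancels \<open>vol2\<close> in the gcd sum. For far blocks \<open>\<mu>\<close> is bounded by its
  second entry, and \<open>N / N'\<close> is so small that it outweighs the volume of
  \<open>J'\<close> in the denominator.\<close>

lemma gcdsum_le:
  assumes t: "large t" "t \<le> t'" and J: "J \<in> cells t" "J' \<in> cells t'" and v: "\<And>t. 0 < v t"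
  shows "gcdsum \<gamma> v t J t' J' \<le> 32 * 256 ^ d * ((v t + v t') * corr t J t' J')"
proof -
  define N N' where "N = (2 :: real) ^ (m * t)" and "N' = (2 :: real) ^ (m * t')"
  define S where "S = (\<Sum>n\<in>cell \<gamma> t J. \<Sum>n'\<in>cell \<gamma> t' J'. real (gcd n n'))"
  define \<mu> where "\<mu> = min (width v t J / N) (width v t' J' / N')"
  have N: "N > 0" "N' > 0" by (simp_all add: N_def N'_def)
  have w: "width v t J > 0" "width v t' J' > 0"
    unfolding width_def using v vol_pos by (auto intro!: divide_pos_pos mult_pos_pos)
  have \<mu>0: "\<mu> \<ge> 0" using w N by (simp add: \<mu>_def)
  have S0: "S \<ge> 0" by (auto simp: S_def intro!: sum_nonneg)
  have le: "gcdsum \<gamma> v t J t' J' \<le> \<mu> * S"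
    unfolding gcdsum_def S_def sum_distrib_left
  proof (intro sum_mono)
    fix n n' assume n: "n \<in> cell \<gamma> t J" "n' \<in> cell \<gamma> t' J'"
    have "2 ^ (m * t) \<le> n" "2 ^ (m * t') \<le> n'" using n by (auto simp: cell_def bohr_def)
    then have "N \<le> real n" "N' \<le> real n'"
      unfolding N_def N'_def by (metis of_nat_le_iff of_nat_numeral of_nat_power)+
    then have "min (width v t J / n) (width v t' J' / n') \<le> \<mu>"
      unfolding \<mu>_def using w N by (intro min.mono divide_left_mono) auto
    then show "real (gcd n n') * min (width v t J / n) (width v t' J' / n') \<le> \<mu> * real (gcd n n')"
      by (subst mult.commute[of \<mu>]) (rule mult_left_mono, auto)
  qed
  show ?thesis
  proof (cases "z * (t' - t) \<le> t")
    case True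
    have z1: "z \<ge> 1" by (simp add: par_z_def)
    have "1 * (t' - t) \<le> z * (t' - t)" using z1 by (intro mult_right_mono) auto
    then have t2: "t' \<le> 2 * t" using True t by linarith
    define B where "B = (real (m * t) + 2) * (1 / 2) ^ t + interaction (m * (t' - t)) J J'"
    have B0: "B \<ge> 0" using interaction_nonneg by (simp add: B_def)
    have S: "S \<le> N * N' * vol2 J J' * (32 * 256 ^ d) * B"
      unfolding S_def N_def N'_def B_def
      using t True J by (intro sum_gcd_near_blocks) (auto simp: large_def)
    \<comment> \<open>After squaring, \<open>\<mu> * \<mu>\<close> is at most the product of both
      entries, and lengths and volumes cancel to \<open>v t * v t'\<close>.\<close>
    have "\<mu> * (N * N' * vol2 J J') \<le> v t + v t'"
    proof (rule power2_le_imp_le)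
      have "\<mu> * \<mu> \<le> (width v t J / N) * (width v t' J' / N')"
        using \<mu>0 w N by (intro mult_mono) (auto simp: \<mu>_def)
      then have "(\<mu> * (N * N' * vol2 J J'))\<^sup>2 \<le> (width v t J / N) * (width v t' J' / N') * (N * N' * vol2 J J')\<^sup>2"
        unfolding power_mult_distrib[of \<mu>] by (intro mult_right_mono) (auto simp: power2_eq_square)
      also have "\<dots> = (width v t J * N) * (width v t' J' * N') * (vol2 J J' * vol2 J J')"
        using N by (simp add: power2_eq_square)
      also have "\<dots> = v t * v t'"
        unfolding vol2_sq width_def N_def N'_def using vol_pos[of J] vol_pos[of J'] by simp
      also have "\<dots> \<le> (v t + v t')\<^sup>2"
        using v[of t] v[of t'] by (simp add: power2_eq_square algebra_simps)
      finally show "(\<mu> * (N * N' * vol2 J J'))\<^sup>2 \<le> (v t + v t')\<^sup>2" .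
    qed (use v[of t] v[of t'] in auto)
    then have "\<mu> * (N * N' * vol2 J J') * (32 * 256 ^ d * B) \<le> (v t + v t') * (32 * 256 ^ d * B)"
      using B0 by (intro mult_right_mono) auto
    moreover have "\<mu> * S \<le> \<mu> * (N * N' * vol2 J J' * (32 * 256 ^ d) * B)"
      using S \<mu>0 by (rule mult_left_mono)
    ultimately have "gcdsum \<gamma> v t J t' J' \<le> (v t + v t') * (32 * 256 ^ d * B)"
      using le by (simp only: mult.assoc)
    also have "\<dots> \<le> (v t + v t') * (32 * 256 ^ d * corr t J t' J')"
    proof (intro mult_left_mono)
      \<comment> \<open>The decay must be expressed in the later index \<open>t'\<close> to be
        summable over it; \<open>t' \<le> 2 * t\<close> costs the square root.\<close>
      have "(1 / 2) ^ t \<le> sqrt_half ^ t'" unfolding sqrt_half_even[symmetric] using t2 by (rule sqrt_half_mono)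
      moreover have "real (m * t) \<le> real (m * t')" using t by (intro of_nat_mono mult_left_mono) auto
      ultimately have "(real (m * t) + 2) * (1 / 2) ^ t \<le> (real (m * t') + 2) * sqrt_half ^ t'"
        by (intro mult_mono) auto
      then show "B \<le> corr t J t' J'" using True by (simp add: B_def corr_def)
    qed (use v[of t] v[of t'] in auto)
    finally show ?thesis by (simp add: mult_ac)
  next
    case False
    have S: "S \<le> 9 * N * N' * (real (m * t) + 2)"
      unfolding S_def N_def N'_def using t by (intro sum_gcd_far_blocks) auto
    have "\<mu> * S \<le> (width v t' J' / N') * (9 * N * N' * (real (m * t) + 2))"
      using S S0 \<mu>0 w N by (intro mult_mono) (auto simp: \<mu>_def)
    also have "\<dots> = 9 * v t' * (real (m * t) + 2) * (N / (N' * vol J'))"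
    proof -
      define V where "V = vol J'"
      have V: "V > 0" "width v t' J' = v t' / (N' * V)" by (simp_all add: V_def vol_pos width_def N'_def)
      show ?thesis unfolding V_def[symmetric] V(2) using N V(1) by (simp add: mult_ac)
    qed
    also have "\<dots> \<le> 9 * v t' * (real (m * t') + 2) * sqrt_half ^ t'"
    proof (intro mult_mono)
      show "real (m * t) + 2 \<le> real (m * t') + 2" using t by (simp add: mult_left_mono)
      have "1 / vol J' \<le> 2 ^ (2 * t' * d)"
        using prod_rad_ge[OF J(2)] vol_pos[of J'] by (simp add: field_simps power_one_over)
      then have "(N / N') * (1 / vol J') \<le> (N / N') * 2 ^ (2 * t' * d)"
        using N by (intro mult_left_mono) auto
      also have "\<dots> = 2 ^ (2 * t' * d) / 2 ^ (m * (t' - t))"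
      proof -
        have "m * t' = m * t + m * (t' - t)" using t by (simp add: algebra_simps)
        then have "N' = N * 2 ^ (m * (t' - t))" unfolding N_def N'_def by (simp only: power_add)
        then show ?thesis using N by simp
      qed
      \<comment> \<open>Far blocks satisfy \<open>t < z * (t' - t)\<close>, hence
        \<open>t' \<le> 2 * z * (t' - t)\<close>, and \<open>4 * d + 2 \<le> u\<close> yields the
        exponent.\<close>
      also have "\<dots> \<le> 2 ^ (2 * t' * d) / 2 ^ (2 * t' * d + t')"
      proof (intro divide_left_mono power_increasing)
        have "t < z * (t' - t)" using False by simp
        moreover have "1 * (t' - t) \<le> z * (t' - t)" by (intro mult_right_mono) (auto simp: par_z_def)
        ultimately have "t' \<le> 2 * (z * (t' - t))" using t by linarith
        then have "(2 * d + 1) * t' \<le> (2 * d + 1) * (2 * (z * (t' - t)))" by (rule mult_left_mono) simp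
        also have "\<dots> = (4 * d + 2) * (z * (t' - t))" by simp
        also have "\<dots> \<le> u * (z * (t' - t))" by (intro mult_right_mono) (auto simp: par_u_def)
        finally show "2 * t' * d + t' \<le> m * (t' - t)" by (simp add: par_m_def algebra_simps)
      qed auto
      also have "\<dots> = (1 / 2) ^ t'" by (simp add: power_add power_one_over)
      also have "\<dots> \<le> sqrt_half ^ t'" unfolding sqrt_half_even[symmetric] by (rule sqrt_half_mono) simp
      finally show "N / (N' * vol J') \<le> sqrt_half ^ t'" by simp
    qed (use v[of t'] N vol_pos[of J'] in auto)
    also have "\<dots> = 9 * (v t' * corr t J t' J')" using False by (simp add: corr_def)
    also have "\<dots> \<le> 32 * 256 ^ d * ((v t + v t') * corr t J t' J')"
    proof (intro mult_mono mult_right_mono)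
      have "(1::real) \<le> 256 ^ d" by simp
      then show "9 \<le> 32 * (256::real) ^ d" by linarith
    qed (use v[of t] v[of t'] corr_nonneg in auto)
    finally show ?thesis using le by linarith
  qed
qed

text \<open>A sum over cells of a product over coordinates is a product of one-dimensional sums. The
  two geometric series in each give 64 times \<open>sqrt_half ^ \<tau>\<close>; of the
  \<open>d\<close> decaying factors only one is kept.\<close>

lemma sum_cells_interaction_le:
  assumes "\<tau> \<le> s" "\<And>i. i \<in> I \<Longrightarrow> \<tau> \<le> J i"
  shows "(\<Sum>J'\<in>cells t'. interaction s J J') \<le> 128 ^ d * sqrt_half ^ \<tau>" (is ?A)
    and "(\<Sum>J'\<in>cells t'. interaction s J' J) \<le> 128 ^ d * sqrt_half ^ \<tau>" (is ?B)
proof -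
  have a: "(\<Sum>j\<in>{t'..<2 * t'}. 16 * sqrt_half ^ (J i + j)) \<le> 64 * sqrt_half ^ \<tau>" if "i \<in> I" for i
  proof -
    have "(\<Sum>j\<in>{t'..<2 * t'}. 16 * sqrt_half ^ (J i + j)) = 16 * sqrt_half ^ J i * (\<Sum>j\<in>{t'..<2 * t'}. sqrt_half ^ j)"
      by (simp add: power_add sum_distrib_left mult_ac)
    also have "\<dots> \<le> 16 * sqrt_half ^ \<tau> * 4"
      using assms(2)[OF that] sqrt_half_pos by (intro mult_mono sum_sqrt_half_le mult_left_mono sqrt_half_mono) (auto intro!: sum_nonneg)
    finally show ?thesis by simp
  qed
  have b: "(\<Sum>j\<in>{t'..<2 * t'}. 8 * sqrt_half ^ s * sqrt_half ^ nat \<bar>int j - c\<bar>) \<le> 64 * sqrt_half ^ \<tau>" for c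
  proof -
    have "(\<Sum>j\<in>{t'..<2 * t'}. 8 * sqrt_half ^ s * sqrt_half ^ nat \<bar>int j - c\<bar>) = 8 * sqrt_half ^ s * (\<Sum>j\<in>{t'..<2 * t'}. sqrt_half ^ nat \<bar>int j - c\<bar>)"
      by (simp add: sum_distrib_left)
    also have "\<dots> \<le> 8 * sqrt_half ^ \<tau> * 8"
      using assms(1) sqrt_half_pos by (intro mult_mono sum_sqrt_half_dist_le mult_left_mono sqrt_half_mono) (auto intro!: sum_nonneg)
    finally show ?thesis by simp
  qed
  have pw: "(\<Prod>i\<in>I. 128 * sqrt_half ^ \<tau>) \<le> 128 ^ d * sqrt_half ^ \<tau>"
  proof -
    have "(sqrt_half ^ \<tau>) ^ d \<le> (sqrt_half ^ \<tau>) ^ 1"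
      using d_ge_1 sqrt_half_pos sqrt_half_le_1 by (intro power_decreasing power_le_one) auto
    then show ?thesis by (simp add: power_mult_distrib)
  qed
  have e1: "\<bar>int j + int s - int (J i)\<bar> = \<bar>int j - (int (J i) - int s)\<bar>" for i j by simp
  have e2: "\<bar>int (J i) + int s - int j\<bar> = \<bar>int j - (int (J i) + int s)\<bar>" for i j by simp
  have "(\<Sum>J'\<in>cells t'. interaction s J J') = (\<Prod>i\<in>I. \<Sum>j\<in>{t'..<2 * t'}. 16 * sqrt_half ^ (J i + j) + 8 * sqrt_half ^ s * sqrt_half ^ nat \<bar>int j + int s - int (J i)\<bar>)"
    unfolding interaction_def using finI by (subst prod_sum_PiE) auto
  also have "\<dots> \<le> (\<Prod>i\<in>I. 128 * sqrt_half ^ \<tau>)"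
  proof (intro prod_mono conjI)
    fix i assume i: "i \<in> I"
    show "(\<Sum>j\<in>{t'..<2 * t'}. 16 * sqrt_half ^ (J i + j) + 8 * sqrt_half ^ s * sqrt_half ^ nat \<bar>int j + int s - int (J i)\<bar>) \<le> 128 * sqrt_half ^ \<tau>"
      unfolding e1 sum.distrib using a[OF i] b[of "int (J i) - int s"] by linarith
  qed (auto intro!: sum_nonneg simp: sqrt_half_pos less_imp_le)
  also note pw
  finally show ?A .
  have "(\<Sum>J'\<in>cells t'. interaction s J' J) = (\<Prod>i\<in>I. \<Sum>j\<in>{t'..<2 * t'}. 16 * sqrt_half ^ (j + J i) + 8 * sqrt_half ^ s * sqrt_half ^ nat \<bar>int (J i) + int s - int j\<bar>)"
    unfolding interaction_def using finI by (subst prod_sum_PiE) auto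
  also have "\<dots> \<le> (\<Prod>i\<in>I. 128 * sqrt_half ^ \<tau>)"
  proof (intro prod_mono conjI)
    fix i assume i: "i \<in> I"
    show "(\<Sum>j\<in>{t'..<2 * t'}. 16 * sqrt_half ^ (j + J i) + 8 * sqrt_half ^ s * sqrt_half ^ nat \<bar>int (J i) + int s - int j\<bar>) \<le> 128 * sqrt_half ^ \<tau>"
      unfolding e2 sum.distrib add.commute[of _ "J i"] using a[OF i] b[of "int (J i) + int s"] by linarith
  qed (auto intro!: sum_nonneg simp: sqrt_half_pos less_imp_le)
  also note pw
  finally show ?B .
qed

definition corr_const :: real where "corr_const = tail_const d W + 4 * 128 ^ d"

text \<open>Provides the hypotheses of \<open>sum_cells_interaction_le\<close> for the exponent
  \<open>t' - t\<close>, which makes the sum over blocks geometric.\<close>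

lemma near_tau:
  assumes "z * (t' - t) \<le> t" "t \<le> t'" "J \<in> cells t" "J' \<in> cells t'"
  shows "t' - t \<le> m * (t' - t)" "i \<in> I \<Longrightarrow> t' - t \<le> J i" "i \<in> I \<Longrightarrow> t' - t \<le> J' i"
proof -
  have "1 * (t' - t) \<le> m * (t' - t)" using par_m_ge by (intro mult_right_mono) auto
  then show "t' - t \<le> m * (t' - t)" by simp
  have "1 * (t' - t) \<le> z * (t' - t)" by (intro mult_right_mono) (auto simp: par_z_def)
  then have "t' - t \<le> t" using assms by linarith
  then show "i \<in> I \<Longrightarrow> t' - t \<le> J i" "i \<in> I \<Longrightarrow> t' - t \<le> J' i"
    using assms by (force simp: PiE_iff)+
qed

lemma sum_corr_right_le:
  assumes "finite T" "J \<in> cells t"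
  shows "(\<Sum>t'\<in>{t'\<in>T. t \<le> t'}. \<Sum>J'\<in>cells t'. corr t J t' J') \<le> corr_const"
proof -
  have "(\<Sum>t'\<in>{t'\<in>T. t \<le> t'}. \<Sum>J'\<in>cells t'. corr t J t' J')
     \<le> (\<Sum>t'\<in>{t'\<in>T. t \<le> t'}. tail_weight d W t' + 128 ^ d * sqrt_half ^ (t' - t))"
  proof (rule sum_mono)
    fix t' assume t': "t' \<in> {t'\<in>T. t \<le> t'}"
    have "(\<Sum>J'\<in>cells t'. (real (m * t') + 2) * sqrt_half ^ t') = 1 * (real t' ^ d * (real (m * t') + 2) * sqrt_half ^ t')"
      by (simp add: card_cells)
    also have "\<dots> \<le> (real t' + 1) * (real t' ^ d * (real (m * t') + 2) * sqrt_half ^ t')"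
      using sqrt_half_pos by (intro mult_right_mono) auto
    finally have 1: "(\<Sum>J'\<in>cells t'. (real (m * t') + 2) * sqrt_half ^ t') \<le> tail_weight d W t'"
      by (simp add: tail_weight_def mult.assoc)
    have 2: "(\<Sum>J'\<in>cells t'. if z * (t' - t) \<le> t then interaction (m * (t' - t)) J J' else 0) \<le> 128 ^ d * sqrt_half ^ (t' - t)"
    proof (cases "z * (t' - t) \<le> t \<and> cells t' \<noteq> {}")
      case True
      then obtain J' where "J' \<in> cells t'" by auto
      with True show ?thesis using sum_cells_interaction_le(1)[of "t' - t" "m * (t' - t)" J t'] near_tau[of t' t J J'] assms t' by simp
    next
      case False
      then have "(\<Sum>J'\<in>cells t'. if z * (t' - t) \<le> t then interaction (m * (t' - t)) J J' else 0) = 0"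
        by (intro sum.neutral) auto
      then show ?thesis using sqrt_half_pos by simp
    qed
    show "(\<Sum>J'\<in>cells t'. corr t J t' J') \<le> tail_weight d W t' + 128 ^ d * sqrt_half ^ (t' - t)"
      unfolding corr_def sum.distrib using 1 2 by linarith
  qed
  also have "\<dots> = (\<Sum>t'\<in>{t'\<in>T. t \<le> t'}. tail_weight d W t') + 128 ^ d * (\<Sum>k\<in>(\<lambda>t'. t' - t) ` {t'\<in>T. t \<le> t'}. sqrt_half ^ k)"
    by (subst sum.reindex) (auto simp: inj_on_def sum.distrib sum_distrib_left)
  also have "\<dots> \<le> tail_const d W + 128 ^ d * 4"
    using assms by (intro add_mono mult_left_mono sum_tail_weight_le sum_sqrt_half_le) auto
  finally show ?thesis by (simp add: corr_const_def)
qed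

text \<open>With the later block fixed, the nonresonant term is constant in the summation variable.
  It is counted for at most \<open>t' + 1\<close> blocks of at most \<open>t' ^ d\<close> cells,
  which accounts for the extra factor in \<open>tail_weight\<close>.\<close>

lemma sum_corr_left_le:
  assumes "finite T" "J' \<in> cells t'"
  shows "(\<Sum>t\<in>{t\<in>T. t \<le> t'}. \<Sum>J\<in>cells t. corr t J t' J') \<le> corr_const"
proof -
  have "(\<Sum>t\<in>{t\<in>T. t \<le> t'}. \<Sum>J\<in>cells t. corr t J t' J')
     \<le> (\<Sum>t\<in>{t\<in>T. t \<le> t'}. real t' ^ d * ((real (m * t') + 2) * sqrt_half ^ t') + 128 ^ d * sqrt_half ^ (t' - t))"
  proof (rule sum_mono)
    fix t assume t: "t \<in> {t\<in>T. t \<le> t'}"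
    have 1: "(\<Sum>J\<in>cells t. (real (m * t') + 2) * sqrt_half ^ t') \<le> real t' ^ d * ((real (m * t') + 2) * sqrt_half ^ t')"
      using sqrt_half_pos t by (simp add: card_cells) (intro mult_right_mono power_mono, auto)
    have 2: "(\<Sum>J\<in>cells t. if z * (t' - t) \<le> t then interaction (m * (t' - t)) J J' else 0) \<le> 128 ^ d * sqrt_half ^ (t' - t)"
    proof (cases "z * (t' - t) \<le> t \<and> cells t \<noteq> {}")
      case True
      then obtain J where "J \<in> cells t" by auto
      with True show ?thesis using sum_cells_interaction_le(2)[of "t' - t" "m * (t' - t)" J' t] near_tau[of t' t J J'] assms t by simp
    next
      case False
      then have "(\<Sum>J\<in>cells t. if z * (t' - t) \<le> t then interaction (m * (t' - t)) J J' else 0) = 0"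
        by (intro sum.neutral) auto
      then show ?thesis using sqrt_half_pos by simp
    qed
    show "(\<Sum>J\<in>cells t. corr t J t' J') \<le> real t' ^ d * ((real (m * t') + 2) * sqrt_half ^ t') + 128 ^ d * sqrt_half ^ (t' - t)"
      unfolding corr_def sum.distrib using 1 2 by linarith
  qed
  also have "\<dots> = real (card {t\<in>T. t \<le> t'}) * (real t' ^ d * ((real (m * t') + 2) * sqrt_half ^ t')) + 128 ^ d * (\<Sum>k\<in>(\<lambda>t. t' - t) ` {t\<in>T. t \<le> t'}. sqrt_half ^ k)"
    by (subst sum.reindex) (auto simp: inj_on_def sum.distrib sum_distrib_left)
  also have "\<dots> \<le> (real t' + 1) * (real t' ^ d * ((real (m * t') + 2) * sqrt_half ^ t')) + 128 ^ d * 4"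
  proof (intro add_mono mult_left_mono mult_right_mono sum_sqrt_half_le)
    have "card {t\<in>T. t \<le> t'} \<le> card {..t'}" by (intro card_mono) auto
    then show "real (card {t\<in>T. t \<le> t'}) \<le> real t' + 1" by simp
  qed (use assms sqrt_half_pos in auto)
  also have "\<dots> = tail_weight d W t' + 128 ^ d * 4" by (simp add: tail_weight_def mult.assoc)
  also have "\<dots> \<le> tail_const d W + 128 ^ d * 4" using tail_weight_le by simp
  finally show ?thesis by (simp add: corr_const_def)
qed

text \<open>A squared lower bound for the first moment over an upper bound for the second:
  \<open>2304 = 256 * 9\<close> comes from the product terms and \<open>8192 = 64 * 128\<close> from
  the gcd terms. Neither \<open>\<alpha>\<close> nor \<open>\<kappa>\<close> occurs, as the dilation
  argument demands.\<close>

definition pos_const :: real where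
  "pos_const = size_const\<^sup>2 / (2304 * 256 ^ d + 8192 * 256 ^ d * corr_const)"

lemma pos_const_pos: "pos_const > 0"
proof -
  have "size_const > 0" using d_ge_1 by (simp add: size_const_def)
  moreover have "corr_const \<ge> 0" using tail_const_nonneg by (simp add: corr_const_def)
  ultimately show ?thesis by (simp add: pos_const_def add_pos_nonneg)
qed

text \<open>As in Schur's test, the part weighted by the first index is bounded through row sums of
  the correlation matrix and the part weighted by the second through column sums. The kernel
  \<open>k\<close> orders the two blocks, and both orders are added.\<close>

lemma sum_gcdsum_le:
  assumes T: "finite T" "\<And>t. t \<in> T \<Longrightarrow> large t" and v: "\<And>t. 0 < v t"
  defines "P \<equiv> SIGMA t:T. cells t"
  shows "(\<Sum>p\<in>P. \<Sum>p'\<in>P. gcdsum \<gamma> v (fst p) (snd p) (fst p') (snd p')) \<le> 128 * 256 ^ d * corr_const * (\<Sum>p\<in>P. v (fst p))"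
proof -
  define C where "C = 32 * (256 :: real) ^ d"
  define g where "g p p' = gcdsum \<gamma> v (fst p) (snd p) (fst p') (snd p')" for p p'
  define k where "k p p' = (if fst p \<le> fst p' then corr (fst p) (snd p) (fst p') (snd p') else 0)" for p p'
  have finP: "finite P" unfolding P_def using T finite_cells by (intro finite_SigmaI) auto
  have C0: "C \<ge> 0" by (simp add: C_def)
  have g_le: "g p p' \<le> C * ((v (fst p) + v (fst p')) * k p p') + C * ((v (fst p) + v (fst p')) * k p' p)"
    if "p \<in> P" "p' \<in> P" for p p'
  proof -
    have nn: "0 \<le> C * ((v (fst p) + v (fst p')) * k q q')" for q q'
      using C0 v[of "fst p"] v[of "fst p'"] corr_nonneg by (simp add: k_def)
    show ?thesis
    proof (cases "fst p \<le> fst p'")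
      case True
      have "g p p' \<le> C * ((v (fst p) + v (fst p')) * k p p')"
        using gcdsum_le[of "fst p" "fst p'" "snd p" "snd p'" v \<gamma>] that True T v by (auto simp: g_def k_def P_def C_def)
      with nn[of p' p] show ?thesis by linarith
    next
      case False
      have "g p p' = g p' p" by (simp add: g_def gcdsum_commute)
      also have "\<dots> \<le> C * ((v (fst p) + v (fst p')) * k p' p)"
        using gcdsum_le[of "fst p'" "fst p" "snd p'" "snd p" v \<gamma>] that False T v by (auto simp: g_def k_def P_def C_def add.commute)
      finally show ?thesis using nn[of p p'] by linarith
    qed
  qed
  have right: "(\<Sum>p'\<in>P. k p p') \<le> corr_const" if "p \<in> P" for p
  proof -
    have "(\<Sum>p'\<in>P. k p p') = (\<Sum>t'\<in>T. \<Sum>J'\<in>cells t'. k p (t', J'))"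
      unfolding P_def using T finite_cells by (subst sum.Sigma) auto
    also have "\<dots> = (\<Sum>t'\<in>{t'\<in>T. fst p \<le> t'}. \<Sum>J'\<in>cells t'. corr (fst p) (snd p) t' J')"
      using T by (intro sum.mono_neutral_cong_right) (auto simp: k_def finite_cells)
    also have "\<dots> \<le> corr_const" using that T by (intro sum_corr_right_le) (auto simp: P_def)
    finally show ?thesis .
  qed
  have left: "(\<Sum>p\<in>P. k p p') \<le> corr_const" if "p' \<in> P" for p'
  proof -
    have "(\<Sum>p\<in>P. k p p') = (\<Sum>t\<in>T. \<Sum>J\<in>cells t. k (t, J) p')"
      unfolding P_def using T finite_cells by (subst sum.Sigma) auto
    also have "\<dots> = (\<Sum>t\<in>{t\<in>T. t \<le> fst p'}. \<Sum>J\<in>cells t. corr t J (fst p') (snd p'))"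
      using T by (intro sum.mono_neutral_cong_right) (auto simp: k_def finite_cells)
    also have "\<dots> \<le> corr_const" using that T by (intro sum_corr_left_le) (auto simp: P_def)
    finally show ?thesis .
  qed
  define X where "X = (\<Sum>p\<in>P. v (fst p))"
  have one: "(\<Sum>p\<in>P. \<Sum>p'\<in>P. v (fst p) * k p p') \<le> X * corr_const"
    unfolding sum_distrib_left[symmetric] X_def sum_distrib_right
    using right v by (intro sum_mono mult_left_mono) (auto intro: less_imp_le)
  have two: "(\<Sum>p\<in>P. \<Sum>p'\<in>P. v (fst p') * k p p') \<le> X * corr_const"
  proof (subst sum.swap)
    show "(\<Sum>p'\<in>P. \<Sum>p\<in>P. v (fst p') * k p p') \<le> X * corr_const"
      unfolding sum_distrib_left[symmetric] X_def sum_distrib_right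
      using left v by (intro sum_mono mult_left_mono) (auto intro: less_imp_le)
  qed
  have three: "(\<Sum>p\<in>P. \<Sum>p'\<in>P. (v (fst p) + v (fst p')) * k p p') \<le> 2 * (X * corr_const)"
    using one two by (simp add: distrib_right sum.distrib)
  have four: "(\<Sum>p\<in>P. \<Sum>p'\<in>P. (v (fst p) + v (fst p')) * k p' p) \<le> 2 * (X * corr_const)"
    using three by (subst sum.swap) (simp add: add.commute)
  have "(\<Sum>p\<in>P. \<Sum>p'\<in>P. g p p') \<le> (\<Sum>p\<in>P. \<Sum>p'\<in>P. C * ((v (fst p) + v (fst p')) * k p p') + C * ((v (fst p) + v (fst p')) * k p' p))"
    by (intro sum_mono g_le)
  also have "\<dots> = C * (\<Sum>p\<in>P. \<Sum>p'\<in>P. (v (fst p) + v (fst p')) * k p p') + C * (\<Sum>p\<in>P. \<Sum>p'\<in>P. (v (fst p) + v (fst p')) * k p' p)"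
    by (simp add: sum.distrib sum_distrib_left)
  also have "\<dots> \<le> C * (2 * (X * corr_const)) + C * (2 * (X * corr_const))"
    using three four C0 by (intro add_mono mult_left_mono) auto
  finally show ?thesis by (simp add: g_def X_def C_def mult_ac)
qed

text \<open>The sum \<open>X\<close> of \<open>v\<close> over all cells is comparable to the first
  moment. In the second moment the products of widths give a multiple of its square and the gcd
  terms only a multiple of \<open>X\<close>.\<close>

lemma measure_blocks_ge:
  fixes \<gamma> :: "nat \<Rightarrow> real" and \<gamma>' :: real
  assumes T: "finite T" "\<And>t. t \<in> T \<Longrightarrow> large t" and v: "\<And>t. 0 < v t" "\<And>t. v t \<le> 1"
    and X: "(\<Sum>t\<in>T. real t ^ d * v t) \<ge> 1"
  shows "measure lborel (\<Union>t\<in>T. \<Union>J\<in>cells t. \<Union>n\<in>cell \<gamma> t J. {x \<in> {0..<1}. dist_int (real n * x - \<gamma>') < width v t J}) \<ge> pos_const"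
proof -
  define P where "P = (SIGMA t:T. cells t)"
  \<comment> \<open>The Bohr sets of one block are nested rather than disjoint, so the same
    \<open>n\<close> may occur with several \<open>J\<close>; indexing by pairs keeps these
    repetitions apart.\<close>
  define A where "A = (SIGMA p:P. cell \<gamma> (fst p) (snd p))"
  define y where "y p = width v (fst p) (snd p)" for p
  define E where "E a = {x \<in> {0..<1}. dist_int (real (snd a) * x - \<gamma>') < y (fst a)}" for a
  define X where "X = (\<Sum>p\<in>P. v (fst p))"
  define Cc where "Cc = 2304 * 256 ^ d + 8192 * 256 ^ d * corr_const"
  have finP: "finite P" unfolding P_def using T finite_cells by (intro finite_SigmaI) auto
  have fincell: "finite (cell \<gamma> t J)" for t J by (simp add: cell_def)
  have finA: "finite A" unfolding A_def using finP fincell by (intro finite_SigmaI) auto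
  have X1: "X \<ge> 1"
  proof -
    have "X = (\<Sum>t\<in>T. \<Sum>J\<in>cells t. v t)"
      unfolding X_def P_def using T finite_cells by (subst sum.Sigma) (auto simp: case_prod_unfold)
    then show ?thesis using X by (simp add: card_cells)
  qed
  have corr0: "corr_const \<ge> 0" using tail_const_nonneg by (simp add: corr_const_def)
  have Cc0: "Cc > 0" using corr0 by (simp add: Cc_def add_pos_nonneg)
  have sc0: "size_const > 0" using d_ge_1 by (simp add: size_const_def)
  have Pt: "large (fst p)" "snd p \<in> cells (fst p)" if "p \<in> P" for p using that T by (auto simp: P_def)
  have y: "0 < y p" "y p \<le> 1 / 4" if "p \<in> P" for p
  proof -
    show "0 < y p" using v vol_pos by (auto simp: y_def width_def intro!: divide_pos_pos mult_pos_pos)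
    have "2 \<le> (m - 2 * d) * fst p"
    proof -
      have "1 * 2 \<le> (m - 2 * d) * fst p" using par_m_ge Pt[OF that] by (intro mult_mono) (auto simp: large_def)
      then show ?thesis by simp
    qed
    then have "(2::real) ^ 2 \<le> 2 ^ ((m - 2 * d) * fst p)" by (intro power_increasing) auto
    also have "\<dots> \<le> 2 ^ (m * fst p) * vol (snd p)" using Pt[OF that] by (intro length_vol_ge)
    finally have "4 \<le> 2 ^ (m * fst p) * vol (snd p)" by simp
    then have "y p \<le> 1 / 4" unfolding y_def width_def using v by (intro frac_le) auto
    then show "y p \<le> 1 / 4" .
  qed
  have n1: "n \<ge> 1" if "(p, n) \<in> A" for p n
  proof -
    have "2 ^ (m * fst p) \<le> n" using that by (auto simp: A_def cell_def bohr_def)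
    then show ?thesis using order_trans[of 1 "2 ^ (m * fst p)" n] by simp
  qed
  have sumA: "(\<Sum>a\<in>A. y (fst a)) = (\<Sum>p\<in>P. real (card (cell \<gamma> (fst p) (snd p))) * y p)"
  proof -
    have "(\<Sum>a\<in>A. y (fst a)) = (\<Sum>p\<in>P. \<Sum>n\<in>cell \<gamma> (fst p) (snd p). y p)"
      unfolding A_def using finP fincell by (subst sum.Sigma) (auto simp: case_prod_unfold)
    then show ?thesis by simp
  qed
  have cy: "2 ^ (m * fst p) * vol (snd p) * y p = v (fst p)" for p
    unfolding y_def width_def using vol_pos[of "snd p"] by simp
  have low: "size_const * X \<le> (\<Sum>a\<in>A. y (fst a))"
    unfolding sumA X_def sum_distrib_left
  proof (rule sum_mono)
    fix p assume p: "p \<in> P"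
    have "size_const * (2 ^ (m * fst p) * vol (snd p)) * y p \<le> real (card (cell \<gamma> (fst p) (snd p))) * y p"
      using Pt[OF p] y(1)[OF p] by (intro mult_right_mono card_cell_ge) (auto simp: large_def)
    then show "size_const * v (fst p) \<le> real (card (cell \<gamma> (fst p) (snd p))) * y p"
      by (simp add: mult.assoc cy[unfolded mult.assoc])
  qed
  have up: "(\<Sum>a\<in>A. y (fst a)) \<le> 3 * 16 ^ d * X"
    unfolding sumA X_def sum_distrib_left
  proof (rule sum_mono)
    fix p assume p: "p \<in> P"
    have "real (card (cell \<gamma> (fst p) (snd p))) * y p \<le> 3 * 16 ^ d * (2 ^ (m * fst p) * vol (snd p)) * y p"
      using Pt[OF p] y(1)[OF p] by (intro mult_right_mono card_cell_le) (auto simp: large_def)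
    then show "real (card (cell \<gamma> (fst p) (snd p))) * y p \<le> 3 * 16 ^ d * v (fst p)"
      by (simp add: mult.assoc cy[unfolded mult.assoc])
  qed
  have AP: "fst a \<in> P" if "a \<in> A" for a using that by (auto simp: A_def)
  have M: "(\<Sum>a\<in>A. measure lborel (E a)) \<ge> size_const * X"
  proof -
    have "(\<Sum>a\<in>A. y (fst a)) \<le> (\<Sum>a\<in>A. measure lborel (E a))"
    proof (rule sum_mono)
      fix a assume a: "a \<in> A"
      then show "y (fst a) \<le> measure lborel (E a)"
        unfolding E_def using n1[of "fst a" "snd a"] y[OF AP[OF a]] by (intro measure_dist_int_less_ge) auto
    qed
    with low show ?thesis by linarith
  qed
  have "(\<Sum>a\<in>A. \<Sum>b\<in>A. measure lborel (E a \<inter> E b))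
     \<le> (\<Sum>a\<in>A. \<Sum>b\<in>A. 256 * (y (fst a) * y (fst b)) + 64 * (real (gcd (snd a) (snd b)) * min (y (fst a) / snd a) (y (fst b) / snd b)))"
  proof (intro sum_mono)
    fix a b assume ab: "a \<in> A" "b \<in> A"
    have "E a \<inter> E b = {x \<in> {0..<1}. dist_int (real (snd a) * x - \<gamma>') < y (fst a) \<and> dist_int (real (snd b) * x - \<gamma>') < y (fst b)}"
      by (auto simp: E_def)
    also have "measure lborel \<dots> \<le> 256 * y (fst a) * y (fst b) + 64 * real (gcd (snd a) (snd b)) * min (y (fst a) / snd a) (y (fst b) / snd b)"
      using ab n1[of "fst a" "snd a"] n1[of "fst b" "snd b"] y[OF AP[OF ab(1)]] y[OF AP[OF ab(2)]]
      by (intro measure_pair_le) auto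
    finally show "measure lborel (E a \<inter> E b) \<le> 256 * (y (fst a) * y (fst b)) + 64 * (real (gcd (snd a) (snd b)) * min (y (fst a) / snd a) (y (fst b) / snd b))"
      by (simp add: mult.assoc)
  qed
  also have "\<dots> = 256 * (\<Sum>a\<in>A. y (fst a))\<^sup>2 + 64 * (\<Sum>a\<in>A. \<Sum>b\<in>A. real (gcd (snd a) (snd b)) * min (y (fst a) / snd a) (y (fst b) / snd b))"
    unfolding power2_eq_square sum_product unfolding sum.distrib sum_distrib_left ..
  also have "(\<Sum>a\<in>A. \<Sum>b\<in>A. real (gcd (snd a) (snd b)) * min (y (fst a) / snd a) (y (fst b) / snd b))
      = (\<Sum>p\<in>P. \<Sum>p'\<in>P. gcdsum \<gamma> v (fst p) (snd p) (fst p') (snd p'))"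
  proof -
    have "(\<Sum>a\<in>A. \<Sum>b\<in>A. real (gcd (snd a) (snd b)) * min (y (fst a) / snd a) (y (fst b) / snd b))
      = (\<Sum>p\<in>P. \<Sum>n\<in>cell \<gamma> (fst p) (snd p). \<Sum>p'\<in>P. \<Sum>n'\<in>cell \<gamma> (fst p') (snd p'). real (gcd n n') * min (y p / n) (y p' / n'))"
    proof -
      have sA: "(\<Sum>a\<in>A. F a) = (\<Sum>p\<in>P. \<Sum>n\<in>cell \<gamma> (fst p) (snd p). F (p, n))" for F :: "(nat \<times> (nat \<Rightarrow> nat)) \<times> nat \<Rightarrow> real"
        unfolding A_def using finP fincell by (subst sum.Sigma) (auto simp: case_prod_unfold)
      show ?thesis unfolding sA by simp
    qed
    also have "\<dots> = (\<Sum>p\<in>P. \<Sum>p'\<in>P. \<Sum>n\<in>cell \<gamma> (fst p) (snd p). \<Sum>n'\<in>cell \<gamma> (fst p') (snd p'). real (gcd n n') * min (y p / n) (y p' / n'))"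
      by (intro sum.cong refl sum.swap)
    finally show ?thesis by (simp add: gcdsum_def y_def)
  qed
  finally have "(\<Sum>a\<in>A. \<Sum>b\<in>A. measure lborel (E a \<inter> E b))
     \<le> 256 * (\<Sum>a\<in>A. y (fst a))\<^sup>2 + 64 * (\<Sum>p\<in>P. \<Sum>p'\<in>P. gcdsum \<gamma> v (fst p) (snd p) (fst p') (snd p'))" .
  also have "\<dots> \<le> 256 * (3 * 16 ^ d * X)\<^sup>2 + 64 * (128 * 256 ^ d * corr_const * X)"
  proof (intro add_mono mult_left_mono power_mono up)
    show "(\<Sum>p\<in>P. \<Sum>p'\<in>P. gcdsum \<gamma> v (fst p) (snd p) (fst p') (snd p')) \<le> 128 * 256 ^ d * corr_const * X"
      unfolding X_def P_def by (rule sum_gcdsum_le[OF T v(1)])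
    show "0 \<le> (\<Sum>a\<in>A. y (fst a))" using y AP by (intro sum_nonneg) (force intro: less_imp_le)
  qed auto
  also have "\<dots> \<le> Cc * X\<^sup>2"
  proof -
    have "((16::real) ^ d)\<^sup>2 = 256 ^ d" by (simp add: power2_eq_square flip: power_mult_distrib)
    then have e: "256 * (3 * 16 ^ d * X)\<^sup>2 = 2304 * 256 ^ d * X\<^sup>2" by (simp add: power_mult_distrib)
    \<comment> \<open>Here the assumption that the sum is at least 1 is used: it lets the linear
      term be absorbed by the quadratic one.\<close>
    have "X * 1 \<le> X * X" using X1 by (intro mult_left_mono) auto
    then have "8192 * 256 ^ d * corr_const * X \<le> 8192 * 256 ^ d * corr_const * X\<^sup>2"
      using corr0 by (intro mult_left_mono) (auto simp: power2_eq_square)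
    then show ?thesis unfolding e Cc_def by (simp add: algebra_simps)
  qed
  also have "\<dots> = (Cc / size_const\<^sup>2) * (size_const * X)\<^sup>2" using sc0 by (simp add: power_mult_distrib)
  also have "\<dots> \<le> (Cc / size_const\<^sup>2) * (\<Sum>a\<in>A. measure lborel (E a))\<^sup>2"
    using M Cc0 sc0 X1 by (intro mult_left_mono power_mono) auto
  finally have "measure lborel (\<Union>a\<in>A. E a) \<ge> 1 / (Cc / size_const\<^sup>2)"
  proof (intro chung_erdos[OF finA])
    have "0 < size_const * X" using sc0 X1 by simp
    with M show "0 < (\<Sum>a\<in>A. measure lborel (E a))" by linarith
    show "0 < Cc / size_const\<^sup>2" using Cc0 sc0 by simp
    fix a
    have "{0..1::real} \<in> fmeasurable lborel" by (rule fmeasurableI) (auto simp: emeasure_lborel_Icc_eq)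
    then show "E a \<in> fmeasurable lborel" by (rule fmeasurableI2) (auto simp: E_def)
  qed
  also have "(\<Union>a\<in>A. E a) = (\<Union>t\<in>T. \<Union>J\<in>cells t. \<Union>n\<in>cell \<gamma> t J. {x \<in> {0..<1}. dist_int (real n * x - \<gamma>') < width v t J})"
    unfolding A_def P_def E_def y_def by (auto; blast)
  finally show ?thesis by (simp add: pos_const_def Cc_def)
qed

end


section \<open>Condensation and conull sets\<close>

text \<open>Cauchy condensation along powers of \<open>R\<close>. The truncation at 1 bounds the
  widths; it preserves divergence because a truncated term equals \<open>t ^ d\<close>. Sums beyond
  every \<open>t0\<close> and above every \<open>B\<close> are required, since blocks have to start
  late and dilation loses a factor.\<close>

lemma condensation_unbounded:
  fixes \<psi> :: "nat \<Rightarrow> real" and R d :: nat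
  assumes R: "R \<ge> 2" and d: "d \<ge> 1"
    and pos: "\<And>n. n \<ge> 1 \<Longrightarrow> \<psi> n > 0" and mono: "\<And>m n. 1 \<le> m \<Longrightarrow> m \<le> n \<Longrightarrow> \<psi> n \<le> \<psi> m"
    and div: "filterlim (\<lambda>N. \<Sum>n=1..N. \<psi> n * log1 (real n) ^ d) at_top sequentially"
  shows "\<exists>T. finite T \<and> T \<subseteq> {t0..} \<and> B \<le> (\<Sum>t\<in>T. real t ^ d * min (real R ^ t * \<psi> (R ^ (t + 1))) 1)"
proof (rule ccontr)
  define x where "x t = real R ^ t * \<psi> (R ^ (t + 1))" for t
  define F where "F n = \<psi> n * log1 (real n) ^ d" for n
  assume neg: "\<not> (\<exists>T. finite T \<and> T \<subseteq> {t0..} \<and> B \<le> (\<Sum>t\<in>T. real t ^ d * min (real R ^ t * \<psi> (R ^ (t + 1))) 1))"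
  have less: "(\<Sum>t\<in>T. real t ^ d * min (x t) 1) < B" if "finite T" "T \<subseteq> {t0..}" for T
  proof (rule ccontr)
    assume "\<not> (\<Sum>t\<in>T. real t ^ d * min (x t) 1) < B"
    then have "finite T \<and> T \<subseteq> {t0..} \<and> B \<le> (\<Sum>t\<in>T. real t ^ d * min (x t) 1)" using that by simp
    with neg show False unfolding x_def by blast
  qed
  \<comment> \<open>From \<open>t1\<close> on, one term with \<open>x t \<ge> 1\<close> would
    already contribute \<open>t ^ d\<close>, which is at least \<open>B\<close>; so the truncation
    is inactive there.\<close>
  define t1 where "t1 = max t0 (max 1 (nat \<lceil>B\<rceil>))"
  have t1: "t0 \<le> t1" "1 \<le> t1" "B \<le> real t1" unfolding t1_def by linarith+
  have x1: "x t < 1" if t: "t \<ge> t1" for t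
  proof (rule ccontr)
    assume "\<not> x t < 1"
    then have "(\<Sum>t\<in>{t}. real t ^ d * min (x t) 1) = real t ^ d" by (simp add: min_def)
    then have "real t ^ d < B" using less[of "{t}"] t t1 by (simp del: of_nat_power)
    moreover have "real t ^ 1 \<le> real t ^ d" using t t1 d by (intro power_increasing) auto
    moreover have "B \<le> real t" using t t1 by linarith
    ultimately show False unfolding power_one_right by linarith
  qed
  have Rpos: "R ^ t \<ge> 1" for t using R by (simp add: Suc_le_eq)
  \<comment> \<open>The value of \<open>\<psi>\<close> at the left end bounds the block, and the
    logarithm is at most \<open>(t + 2) * ln R\<close>, hence at most
    \<open>3 * t * R\<close>.\<close>
  have block: "(\<Sum>n\<in>{R ^ (t + 1)..<R ^ (t + 2)}. F n) \<le> real R ^ (d + 2) * 3 ^ d * (real t ^ d * x t)" if t: "t \<ge> t1" for t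
  proof -
    have "(\<Sum>n\<in>{R ^ (t + 1)..<R ^ (t + 2)}. F n) \<le> (\<Sum>n\<in>{R ^ (t + 1)..<R ^ (t + 2)}. \<psi> (R ^ (t + 1)) * (3 * real t * real R) ^ d)"
    proof (rule sum_mono)
      fix n assume n: "n \<in> {R ^ (t + 1)..<R ^ (t + 2)}"
      have n1: "n \<ge> 1" using order_trans[OF Rpos[of "t + 1"], of n] n by (simp only: atLeastLessThan_iff)
      have "n \<le> R ^ (t + 2)" using n by (simp only: atLeastLessThan_iff less_imp_le_nat)
      then have "real n \<le> real (R ^ (t + 2))" by (simp only: of_nat_le_iff)
      then have "ln (real n) \<le> ln (real R ^ (t + 2))" using n1 R by (simp del: ln_realpow)
      also have "\<dots> = (real t + 2) * ln (real R)" using R by (subst ln_realpow) auto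
      also have "\<dots> \<le> (real t + 2) * real R" using R ln_le_minus_one[of "real R"] by (intro mult_left_mono) auto
      also have "\<dots> \<le> 3 * real t * real R" using t t1 by (intro mult_right_mono) auto
      finally have "ln (real n) \<le> 3 * real t * real R" .
      moreover have "1 * 1 \<le> (3 * real t) * real R" using t t1 R by (intro mult_mono) auto
      ultimately have "log1 (real n) \<le> 3 * real t * real R" by (simp add: log1_def)
      moreover have "0 \<le> log1 (real n)" by (simp add: log1_def)
      ultimately show "F n \<le> \<psi> (R ^ (t + 1)) * (3 * real t * real R) ^ d"
        unfolding F_def using n Rpos[of "t + 1"] pos[OF n1] pos[OF Rpos[of "t + 1"]]
        by (intro mult_mono power_mono mono) (auto intro: less_imp_le)
    qed
    also have "\<dots> = real (R ^ (t + 2) - R ^ (t + 1)) * (\<psi> (R ^ (t + 1)) * (3 * real t * real R) ^ d)" by simp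
    also have "\<dots> \<le> real (R ^ (t + 2)) * (\<psi> (R ^ (t + 1)) * (3 * real t * real R) ^ d)"
    proof (rule mult_right_mono)
      show "real (R ^ (t + 2) - R ^ (t + 1)) \<le> real (R ^ (t + 2))" by (simp only: of_nat_le_iff diff_le_self)
      show "0 \<le> \<psi> (R ^ (t + 1)) * (3 * real t * real R) ^ d" using pos[OF Rpos[of "t + 1"]] by simp
    qed
    also have "\<dots> = real R ^ (d + 2) * 3 ^ d * (real t ^ d * x t)"
      by (simp add: x_def power_mult_distrib power_add power2_eq_square)
    finally show ?thesis .
  qed
  have F0: "F n \<ge> 0" if "n \<ge> 1" for n using pos[OF that] by (simp add: F_def log1_def)
  define K where "K = (\<Sum>n\<in>{1..<R ^ (t1 + 1)}. F n) + real R ^ (d + 2) * 3 ^ d * B"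
  have split: "(\<Sum>n\<in>{1..<R ^ (t1 + k + 1)}. F n) = (\<Sum>n\<in>{1..<R ^ (t1 + 1)}. F n) + (\<Sum>t\<in>{t1..<t1 + k}. \<Sum>n\<in>{R ^ (t + 1)..<R ^ (t + 2)}. F n)" for k
  proof (induction k)
    case (Suc k)
    have "(\<Sum>n\<in>{1..<R ^ (t1 + Suc k + 1)}. F n) = (\<Sum>n\<in>{1..<R ^ (t1 + k + 1)}. F n) + (\<Sum>n\<in>{R ^ (t1 + k + 1)..<R ^ (t1 + Suc k + 1)}. F n)"
    proof (rule sum.atLeastLessThan_concat[symmetric])
      show "R ^ (t1 + k + 1) \<le> R ^ (t1 + Suc k + 1)" using R by (intro power_increasing) auto
    qed (rule Rpos)
    then show ?case using Suc by (simp add: add_ac)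
  qed simp
  have bound: "(\<Sum>n=1..N. F n) \<le> K" for N
  proof -
    have "N < R ^ N" using R by (intro less_exp[THEN less_le_trans] power_mono) auto
    also have "\<dots> \<le> R ^ (t1 + N + 1)" using R by (intro power_increasing) auto
    finally have "{1..N} \<subseteq> {1..<R ^ (t1 + N + 1)}" by auto
    then have "(\<Sum>n=1..N. F n) \<le> (\<Sum>n\<in>{1..<R ^ (t1 + N + 1)}. F n)" using F0 by (intro sum_mono2) auto
    also have "\<dots> \<le> (\<Sum>n\<in>{1..<R ^ (t1 + 1)}. F n) + (\<Sum>t\<in>{t1..<t1 + N}. real R ^ (d + 2) * 3 ^ d * (real t ^ d * x t))"
      unfolding split using block by (intro add_left_mono sum_mono) auto
    also have "(\<Sum>t\<in>{t1..<t1 + N}. real R ^ (d + 2) * 3 ^ d * (real t ^ d * x t))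
        = real R ^ (d + 2) * 3 ^ d * (\<Sum>t\<in>{t1..<t1 + N}. real t ^ d * min (x t) 1)"
      unfolding sum_distrib_left using x1 by (intro sum.cong refl) (auto simp: min_def not_le less_imp_le)
    also have "\<dots> \<le> real R ^ (d + 2) * 3 ^ d * B"
    proof (intro mult_left_mono)
      have "{t1..<t1 + N} \<subseteq> {t0..}" using t1 by auto
      then show "(\<Sum>t\<in>{t1..<t1 + N}. real t ^ d * min (x t) 1) \<le> B" using less[of "{t1..<t1 + N}"] by simp
    qed simp
    finally show ?thesis by (simp add: K_def)
  qed
  have "eventually (\<lambda>N. K + 1 \<le> (\<Sum>n=1..N. \<psi> n * log1 (real n) ^ d)) sequentially"
    using div by (simp add: filterlim_at_top)
  then obtain N where "K + 1 \<le> (\<Sum>n=1..N. F n)"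
    unfolding F_def by (auto simp: eventually_sequentially)
  with bound[of N] show False by simp
qed

text \<open>Approximate the complement of \<open>G\<close> from outside by an open set and exhaust that set by grid cells.\<close>
lemma conull_if_grid_measure_ge:
  fixes G :: "real set" and c :: real and R :: nat
  assumes G: "G \<in> sets borel" and c: "c > 0" and R: "R \<ge> 2"
    and cells: "\<And>(p::int) j. measure lborel (G \<inter> {of_int p / real R ^ j..<(of_int p + 1) / real R ^ j}) \<ge> c / real R ^ j"
  shows "AE x in lborel. x \<in> G"
proof -
  define Z where "Z = - G"
  have Z: "Z \<in> sets borel" using G by (simp add: Z_def)
  define cl where "cl p j = {of_int p / real R ^ j..<(of_int p + 1) / real R ^ j}" for p :: int and j :: nat
  have Rj: "real R ^ j > 0" for j using R by simp
  have in_cl: "x \<in> cl p j \<longleftrightarrow> \<lfloor>x * real R ^ j\<rfloor> = p" for x p j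
    unfolding cl_def using Rj[of j] by (auto simp: field_simps floor_eq_iff)
  have cl_meas: "cl p j \<in> fmeasurable lborel" for p j
  proof (rule fmeasurableI2)
    show "{of_int p / real R ^ j..(of_int p + 1) / real R ^ j} \<in> fmeasurable lborel"
      by (rule fmeasurableI) (auto simp: emeasure_lborel_Icc_eq)
  qed (auto simp: cl_def)
  have cl_sets [simp]: "cl p j \<in> sets borel" for p j by (simp add: cl_def)
  have mcl: "measure lborel (cl p j) = 1 / real R ^ j" for p j
    using Rj[of j] by (simp add: cl_def add_divide_distrib)
  have ZG: "measure lborel (Z \<inter> cl p j) \<le> (1 - c) / real R ^ j" for p j
  proof -
    have "measure lborel (cl p j) = measure lborel (G \<inter> cl p j) + measure lborel (Z \<inter> cl p j)"
    proof -
      have fm: "X \<inter> cl p j \<in> fmeasurable lborel" if "X \<in> sets borel" for X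
        by (subst Int_commute) (rule fmeasurable_Int_fmeasurable[OF cl_meas], use that in simp)
      have "measure lborel ((G \<inter> cl p j) \<union> (Z \<inter> cl p j)) = measure lborel (G \<inter> cl p j) + measure lborel (Z \<inter> cl p j)"
        using fm[OF G] fm[OF Z] by (intro measure_Union) (auto simp: fmeasurable_def Z_def)
      moreover have "(G \<inter> cl p j) \<union> (Z \<inter> cl p j) = cl p j" by (auto simp: Z_def)
      ultimately show ?thesis by simp
    qed
    then show ?thesis using cells[of j p] by (simp add: mcl cl_def[symmetric] diff_divide_distrib)
  qed
  have "c \<le> 1"
  proof -
    have "measure lborel (Z \<inter> cl 0 0) \<le> 1 - c" using ZG[of 0 0] by simp
    then show ?thesis using measure_nonneg[of lborel "Z \<inter> cl 0 0"] by linarith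
  qed
  have null: "emeasure lborel (Z \<inter> {- real n<..<real n}) = 0" for n :: nat
  proof -
    define K where "K = Z \<inter> {- real n<..<real n}"
    have K: "K \<in> sets borel" using Z by (simp add: K_def)
    have bnd: "X \<in> fmeasurable lborel" if "X \<in> sets borel" "X \<subseteq> {- real n<..<real n}" for X
      by (rule fmeasurableI2[of "{- real n..real n}"]) (use that in \<open>auto intro!: fmeasurableI simp: emeasure_lborel_Icc_eq\<close>)
    have Kf: "K \<in> fmeasurable lborel" using K by (intro bnd) (auto simp: K_def)
    \<comment> \<open>Every grid cell has at most the proportion \<open>1 - c\<close> in
      \<open>Z\<close>. Filling the open set \<open>U\<close> with cells carries this over to
      \<open>U\<close>, whose measure exceeds that of \<open>K\<close> by at most
      \<open>\<epsilon>\<close>.\<close>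
    have le: "measure lborel K \<le> (1 - c) * (measure lborel K + \<epsilon>)" if \<epsilon>: "\<epsilon> > 0" for \<epsilon>
    proof -
      obtain U0 where U0: "open U0" "K \<subseteq> U0" "emeasure lborel (U0 - K) < ennreal \<epsilon>"
        using outer_regular_lborel[OF K \<epsilon>] by blast
      define U where "U = U0 \<inter> {- real n<..<real n}"
      have U: "open U" "K \<subseteq> U" "U \<subseteq> {- real n<..<real n}" using U0 by (auto simp: U_def K_def)
      have Uf: "U \<in> fmeasurable lborel" using U by (intro bnd) auto
      have "measure lborel U \<le> measure lborel K + \<epsilon>"
      proof -
        have "emeasure lborel (U - K) \<le> emeasure lborel (U0 - K)"
          using U0 K by (intro emeasure_mono) (auto simp: U_def)
        then have "emeasure lborel (U - K) < ennreal \<epsilon>" using U0 by simp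
        then have "measure lborel (U - K) \<le> \<epsilon>"
          unfolding measure_def using \<epsilon> by (intro enn2real_leI) auto
        moreover have "measure lborel (U - K) = measure lborel U - measure lborel K"
          using Uf Kf U by (intro measurable_measure_Diff) (auto simp: K)
        ultimately show ?thesis by simp
      qed
      define S where "S j = {p. cl p j \<subseteq> U}" for j
      define V where "V j = (\<Union>p\<in>S j. cl p j)" for j
      have finS: "finite (S j)" for j
      proof (rule finite_subset)
        show "S j \<subseteq> {\<lfloor>- real n * real R ^ j\<rfloor>..\<lfloor>real n * real R ^ j\<rfloor>}"
        proof
          fix p assume "p \<in> S j"
          moreover have "of_int p / real R ^ j \<in> cl p j" using Rj[of j] by (simp add: in_cl)
          ultimately have "of_int p / real R ^ j \<in> {- real n<..<real n}" using U by (auto simp: S_def)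
          then have "- real n * real R ^ j < of_int p" "of_int p < real n * real R ^ j"
            using Rj[of j] by (auto simp: field_simps)
          then show "p \<in> {\<lfloor>- real n * real R ^ j\<rfloor>..\<lfloor>real n * real R ^ j\<rfloor>}" by (auto simp: floor_le_iff le_floor_iff)
        qed
      qed simp
      have disj: "disjoint_family_on (\<lambda>p. cl p j) (S j)" for j
        unfolding disjoint_family_on_def by (auto simp: in_cl)
      have VU: "V j \<subseteq> U" for j by (auto simp: V_def S_def)
      have mV: "measure lborel (V j) = real (card (S j)) / real R ^ j" for j
        unfolding V_def using finS disj cl_meas
        by (subst measure_finite_Union) (use fmeasurableD2[OF cl_meas] in \<open>auto simp: mcl fmeasurableD\<close>)
      have mZV: "measure lborel (Z \<inter> V j) \<le> (1 - c) * measure lborel U" for j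
      proof -
        have "Z \<inter> V j = (\<Union>p\<in>S j. Z \<inter> cl p j)" by (auto simp: V_def)
        also have "measure lborel \<dots> \<le> (\<Sum>p\<in>S j. measure lborel (Z \<inter> cl p j))"
          using finS Z cl_meas by (intro measure_UNION_le) (auto simp: fmeasurableD)
        also have "\<dots> \<le> (\<Sum>p\<in>S j. (1 - c) / real R ^ j)" by (intro sum_mono ZG)
        also have "\<dots> = (1 - c) * measure lborel (V j)" by (simp add: mV)
        also have "\<dots> \<le> (1 - c) * measure lborel U"
        proof (intro mult_left_mono measure_mono_fmeasurable VU Uf)
          show "V j \<in> sets lborel" unfolding V_def using finS cl_meas by (intro sets.finite_UN) (auto simp: fmeasurableD)
        qed (use \<open>c \<le> 1\<close> in auto)
        finally show ?thesis .
      qed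
      have "incseq V"
      proof (rule incseq_SucI, rule subsetI)
        fix j x assume "x \<in> V j"
        then have cx: "cl \<lfloor>x * real R ^ j\<rfloor> j \<subseteq> U" by (auto simp: V_def S_def in_cl)
        \<comment> \<open>The grids are nested: dividing the floor of \<open>w * R\<close> by the
          integer \<open>R\<close> gives the floor of \<open>w\<close>, so the finer cell of
          \<open>x\<close> lies in the coarser one.\<close>
        define q where "q = \<lfloor>x * real R ^ Suc j\<rfloor>"
        have "cl q (Suc j) \<subseteq> cl \<lfloor>x * real R ^ j\<rfloor> j"
        proof
          fix y assume "y \<in> cl q (Suc j)"
          then have yq: "\<lfloor>y * real R ^ j * of_int (int R)\<rfloor> = \<lfloor>x * real R ^ j * of_int (int R)\<rfloor>"
            by (simp add: in_cl q_def mult_ac)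
          have fl: "\<lfloor>w\<rfloor> = \<lfloor>w * of_int (int R)\<rfloor> div int R" for w :: real
            using floor_divide_real_eq_div[of "int R" "w * of_int (int R)"] R by simp
          show "y \<in> cl \<lfloor>x * real R ^ j\<rfloor> j"
            unfolding in_cl using yq fl[of "y * real R ^ j"] fl[of "x * real R ^ j"] by simp
        qed
        then have "q \<in> S (Suc j)" using cx by (auto simp: S_def)
        moreover have "x \<in> cl q (Suc j)" by (simp add: in_cl q_def)
        ultimately show "x \<in> V (Suc j)" by (auto simp: V_def)
      qed
      have UV: "(\<Union>j. V j) = U"
      proof
        show "U \<subseteq> (\<Union>j. V j)"
        proof
          fix x assume "x \<in> U"
          then obtain \<delta> where \<delta>: "\<delta> > 0" "ball x \<delta> \<subseteq> U" using U open_contains_ball by blast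
          obtain j where j: "1 / \<delta> < real R ^ j" using real_arch_pow[of "real R" "1 / \<delta>"] R by auto
          define p where "p = \<lfloor>x * real R ^ j\<rfloor>"
          have xp: "x \<in> cl p j" by (simp add: in_cl p_def)
          have "cl p j \<subseteq> ball x \<delta>"
          proof
            fix y assume "y \<in> cl p j"
            with xp have "\<bar>x - y\<bar> < 1 / real R ^ j"
              unfolding cl_def by (auto simp: add_divide_distrib abs_if)
            also have "\<dots> < \<delta>" using j \<delta> Rj[of j] by (simp add: field_simps)
            finally show "y \<in> ball x \<delta>" by (simp add: dist_real_def)
          qed
          then have "p \<in> S j" using \<delta> by (auto simp: S_def)
          then show "x \<in> (\<Union>j. V j)" using xp by (auto simp: V_def)
        qed
      qed (use VU in auto)
      have Vs: "V j \<in> sets lborel" for j unfolding V_def using finS cl_meas by (intro sets.finite_UN) (auto simp: fmeasurableD)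
      have ZU: "Z \<inter> U \<in> fmeasurable lborel" using Z U by (intro bnd) auto
      have "(\<lambda>j. measure lborel (Z \<inter> V j)) \<longlonglongrightarrow> measure lborel (\<Union>j. Z \<inter> V j)"
      proof (rule Lim_measure_incseq)
        show "range (\<lambda>j. Z \<inter> V j) \<subseteq> sets lborel" using Z Vs by auto
        show "incseq (\<lambda>j. Z \<inter> V j)" using \<open>incseq V\<close> by (auto simp: incseq_def)
        have "(\<Union>j. Z \<inter> V j) = Z \<inter> U" using UV by auto
        then show "emeasure lborel (\<Union>j. Z \<inter> V j) \<noteq> \<infinity>" using ZU by (auto simp: fmeasurable_def)
      qed
      then have "measure lborel (\<Union>j. Z \<inter> V j) \<le> (1 - c) * measure lborel U"
        by (rule LIMSEQ_le_const2) (use mZV in auto)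
      moreover have "measure lborel K \<le> measure lborel (\<Union>j. Z \<inter> V j)"
      proof (rule measure_mono_fmeasurable)
        show "K \<subseteq> (\<Union>j. Z \<inter> V j)" using UV U(2) by (auto simp: K_def)
        have "(\<Union>j. Z \<inter> V j) = Z \<inter> U" using UV by auto
        then show "(\<Union>j. Z \<inter> V j) \<in> fmeasurable lborel" using ZU by simp
      qed (use K in simp)
      moreover have "(1 - c) * measure lborel U \<le> (1 - c) * (measure lborel K + \<epsilon>)"
        using \<open>c \<le> 1\<close> \<open>measure lborel U \<le> measure lborel K + \<epsilon>\<close> by (intro mult_left_mono) auto
      ultimately show ?thesis by linarith
    qed
    \<comment> \<open>Letting \<open>\<epsilon>\<close> tend to 0; for finite measure and
      \<open>c > 0\<close> this forces measure zero.\<close>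
    have "measure lborel K \<le> (1 - c) * measure lborel K"
    proof (rule field_le_epsilon)
      fix e :: real assume e: "e > 0"
      have "measure lborel K \<le> (1 - c) * (measure lborel K + e)" by (rule le[OF e])
      also have "\<dots> \<le> (1 - c) * measure lborel K + 1 * e"
        unfolding distrib_left using c e by (intro add_left_mono mult_right_mono) auto
      finally show "measure lborel K \<le> (1 - c) * measure lborel K + e" by simp
    qed
    then have "c * measure lborel K \<le> 0" by (simp add: algebra_simps)
    then have "measure lborel K = 0" using c measure_nonneg[of lborel K] by (simp add: mult_le_0_iff)
    then show ?thesis using Kf by (simp add: K_def[symmetric] emeasure_eq_measure2 fmeasurableD2)
  qed
  have "(\<Union>n::nat. Z \<inter> {- real n<..<real n}) \<in> null_sets lborel"
    using Z null by (intro null_sets_UN) (auto simp: null_sets_def)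
  moreover have "(\<Union>n::nat. Z \<inter> {- real n<..<real n}) = Z"
  proof -
    have "\<exists>n::nat. - real n < x \<and> x < real n" for x :: real
      using reals_Archimedean2[of "\<bar>x\<bar>"] by (metis abs_less_iff minus_less_iff)
    then show ?thesis by auto
  qed
  ultimately have "Z \<in> null_sets lborel" by simp
  then show ?thesis by (rule AE_I') (auto simp: Z_def)
qed


section \<open>Transference\<close>

lemma dist_int_pos_iff: "dist_int x = 0 \<longleftrightarrow> (\<exists>m. x = of_int m)"
  using dist_int_of_int by (metis dist_int_obtain abs_0_eq eq_iff_diff_eq_0)

lemma exists_positive_lower_bound:
  fixes f :: "'a \<Rightarrow> real"
  assumes "finite A" "\<And>a. a \<in> A \<Longrightarrow> f a > 0"
  obtains \<mu> where "\<mu> > 0" "\<mu> \<le> 1" "\<And>a. a \<in> A \<Longrightarrow> \<mu> \<le> f a"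
proof
  define \<mu> where "\<mu> = Min (insert 1 (f ` A))"
  show "\<mu> > 0" "\<mu> \<le> 1" "\<And>a. a \<in> A \<Longrightarrow> \<mu> \<le> f a" using assms by (auto simp: \<mu>_def)
qed

text \<open>Outside the finite exceptional set the distance is at least \<open>n\<close> to the
  power \<open>- w\<close>. On it the distances are positive by irrationality, so their minimum
  serves as \<open>\<kappa>\<close>.\<close>

lemma dioph_singleton:
  assumes irr: "\<alpha> i \<notin> \<rat>" and w: "w > 0" and fin: "finite {n::nat. n \<ge> 1 \<and> dist_int (real n * \<alpha> i) < real n powr (- w)}"
  shows "\<exists>W \<kappa>. dioph {i} \<alpha> W \<kappa>"
proof -
  let ?F = "{n::nat. n \<ge> 1 \<and> dist_int (real n * \<alpha> i) < real n powr (- w)}"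
  have pos: "dist_int (real n * \<alpha> i) > 0" if "n \<ge> 1" for n
  proof -
    have "dist_int (real n * \<alpha> i) \<noteq> 0"
    proof
      assume "dist_int (real n * \<alpha> i) = 0"
      then obtain m where "real n * \<alpha> i = of_int m" by (auto simp: dist_int_pos_iff)
      then have "\<alpha> i = of_int m / of_nat n" using that by (simp add: field_simps)
      then show False using irr by simp
    qed
    then show ?thesis using dist_int_nonneg[of "real n * \<alpha> i"] by linarith
  qed
  obtain \<mu> where \<mu>: "\<mu> > 0" "\<mu> \<le> 1" "\<And>n. n \<in> ?F \<Longrightarrow> \<mu> \<le> dist_int (real n * \<alpha> i)"
    using exists_positive_lower_bound[OF fin, of "\<lambda>n. dist_int (real n * \<alpha> i)"] pos by auto
  define W where "W = nat \<lceil>w\<rceil>"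
  have "w \<le> real W" unfolding W_def using w by linarith
  have "dioph {i} \<alpha> W \<mu>"
  proof
    fix h :: "nat \<Rightarrow> int" and H :: real
    assume h: "\<And>j. j \<in> {i} \<Longrightarrow> real_of_int \<bar>h j\<bar> \<le> H" "1 \<le> H" "\<exists>j\<in>{i}. h j \<noteq> 0"
    define n where "n = nat \<bar>h i\<bar>"
    have n: "n \<ge> 1" "real n \<le> H" using h by (auto simp: n_def)
    have "dist_int (real n * \<alpha> i) = dist_int (of_int (h i) * \<alpha> i)"
      by (cases "h i \<ge> 0") (auto simp: n_def)
    moreover have "\<mu> / H ^ W \<le> dist_int (real n * \<alpha> i)"
    proof (cases "n \<in> ?F")
      case True
      have "\<mu> / H ^ W \<le> \<mu> / 1" using \<mu> h by (intro divide_left_mono) auto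
      then show ?thesis using \<mu>(3)[OF True] by simp
    next
      case False
      have "\<mu> / H ^ W \<le> 1 / H ^ W" using \<mu> h by (intro divide_right_mono) auto
      also have "\<dots> \<le> 1 / real n ^ W" using n by (intro divide_left_mono power_mono) auto
      also have "\<dots> = real n powr (- real W)" using n by (simp add: powr_minus powr_realpow divide_inverse)
      also have "\<dots> \<le> real n powr (- w)" using n \<open>w \<le> real W\<close> by (intro powr_mono) auto
      also have "\<dots> \<le> dist_int (real n * \<alpha> i)" using False n by auto
      finally show ?thesis .
    qed
    ultimately show "\<mu> / H ^ W \<le> dist_int (\<Sum>j\<in>{i}. real_of_int (h j) * \<alpha> j)" by simp
  qed (use \<mu> in auto)
  then show ?thesis by blast
qed

text \<open>A Khintchine-type transference: if \<open>h \<cdot> \<alpha>\<close> is very close to an integer, then simultaneous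
  approximation of the coordinates other than the one where \<open>\<bar>h i\<bar>\<close> is largest makes all
  \<open>\<parallel>n \<alpha> i\<parallel>\<close> small at once.\<close>
lemma dioph_multiplicative:
  fixes d :: nat
  assumes d: "d \<ge> 2" and w: "w > 0" "w * (real d - 1) < real d"
    and fin: "finite {n::nat. n \<ge> 1 \<and> (\<Prod>i=1..d. dist_int (real n * \<alpha> i)) < real n powr (- w)}"
  shows "\<exists>W \<kappa>. dioph {1..d} \<alpha> W \<kappa>"
proof -
  let ?F = "{n::nat. n \<ge> 1 \<and> (\<Prod>i=1..d. dist_int (real n * \<alpha> i)) < real n powr (- w)}"
  \<comment> \<open>If one distance vanished, it would vanish for all multiples of \<open>n\<close>,
    and these would be infinitely many members of \<open>?F\<close>.\<close>
  have pos: "dist_int (real n * \<alpha> i) > 0" if n: "n \<ge> 1" and i: "i \<in> {1..d}" for n i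
  proof (rule ccontr)
    assume "\<not> dist_int (real n * \<alpha> i) > 0"
    then have z: "dist_int (real n * \<alpha> i) = 0" using dist_int_nonneg[of "real n * \<alpha> i"] by linarith
    have "range (\<lambda>k. Suc k * n) \<subseteq> ?F"
    proof clarify
      fix k
      have "dist_int (real (Suc k * n) * \<alpha> i) \<le> real (Suc k) * dist_int (real n * \<alpha> i)"
        using dist_int_of_nat_mult[of "Suc k" "real n * \<alpha> i"] by (simp only: of_nat_mult mult.assoc)
      then have "dist_int (real (Suc k * n) * \<alpha> i) \<le> 0" by (simp only: z mult_zero_right)
      then have "dist_int (real (Suc k * n) * \<alpha> i) = 0" by (rule antisym) (rule dist_int_nonneg)
      then have "(\<Prod>i=1..d. dist_int (real (Suc k * n) * \<alpha> i)) = 0" using i by (intro prod_zero) auto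
      moreover have N: "1 \<le> Suc k * n" using n by (simp add: Suc_le_eq)
      then have "real (Suc k * n) \<noteq> 0" by (metis not_one_le_zero of_nat_eq_0_iff)
      then have "real (Suc k * n) powr (- w) > 0" by (simp only: powr_gt_zero simp_thms)
      ultimately show "1 \<le> Suc k * n \<and> (\<Prod>i=1..d. dist_int (real (Suc k * n) * \<alpha> i)) < real (Suc k * n) powr (- w)"
        using N by linarith
    qed
    moreover have "infinite (range (\<lambda>k. Suc k * n))"
      using n by (intro range_inj_infinite) (auto simp: inj_on_def)
    ultimately show False using fin finite_subset by blast
  qed
  obtain \<mu> where \<mu>: "\<mu> > 0" "\<mu> \<le> 1" "\<And>n i. n \<in> ?F \<Longrightarrow> i \<in> {1..d} \<Longrightarrow> \<mu> \<le> dist_int (real n * \<alpha> i)"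
  proof -
    define S where "S = ?F \<times> {1..d}"
    have "finite S" using fin by (simp add: S_def)
    then obtain \<mu> where \<mu>: "\<mu> > 0" "\<mu> \<le> 1" "\<And>p. p \<in> S \<Longrightarrow> \<mu> \<le> dist_int (real (fst p) * \<alpha> (snd p))"
      by (rule exists_positive_lower_bound[of S "\<lambda>p. dist_int (real (fst p) * \<alpha> (snd p))"]) (use pos in \<open>auto simp: S_def\<close>)
    show ?thesis
    proof (rule that[OF \<mu>(1,2)])
      fix n i assume "n \<in> ?F" "i \<in> {1..d}"
      then have "(n, i) \<in> S" by (simp add: S_def)
      from \<mu>(3)[OF this] show "\<mu> \<le> dist_int (real n * \<alpha> i)" by simp
    qed
  qed
  \<comment> \<open>Positive precisely by the hypothesis on \<open>w\<close>. The final
    contradiction compares \<open>Q\<close> to the power \<open>e\<close> with \<open>d\<close>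
    times \<open>H\<close> to the power \<open>d + w\<close>; \<open>A\<close> is chosen for the
    power of \<open>H\<close> and \<open>C\<close> for the factor \<open>d\<close>.\<close>
  define e where "e = real d - w * (real d - 1)"
  have e0: "e > 0" using w by (simp add: e_def)
  define A where "A = nat \<lceil>(real d + w) / e\<rceil> + 1"
  have A: "A \<ge> 1" "real A * e \<ge> real d + w"
  proof -
    have "(real d + w) / e \<le> real A" unfolding A_def by linarith
    then show "real A * e \<ge> real d + w" using e0 by (simp add: field_simps)
  qed (simp add: A_def)
  \<comment> \<open>The second summand makes \<open>C\<close> exceed \<open>1 / \<mu>\<close>, which
    keeps the integer \<open>n\<close> constructed below out of the exceptional set.\<close>
  define C where "C = nat \<lceil>(real d + 1) powr (1 / e)\<rceil> + nat \<lceil>1 / \<mu>\<rceil> + 1"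
  have C: "C \<ge> 1" "real C powr e > real d" "real C > 1 / \<mu>"
  proof -
    have "(real d + 1) powr (1 / e) \<le> real C" "0 \<le> real (nat \<lceil>1 / \<mu>\<rceil>)" unfolding C_def by linarith+
    then have "((real d + 1) powr (1 / e)) powr e \<le> real C powr e" using e0 by (intro powr_mono2) auto
    then show "real C powr e > real d" using e0 by (simp add: powr_powr)
    show "real C > 1 / \<mu>" unfolding C_def by linarith
  qed (simp add: C_def)
  \<comment> \<open>The lower bound will be \<open>1 / Q ^ d\<close> with
    \<open>Q = C * H' ^ A\<close>; the power of 2 pays for rounding \<open>H\<close> up to an
    integer \<open>H' \<le> 2 * H\<close>.\<close>
  define \<kappa> where "\<kappa> = 1 / real (C ^ d * 2 ^ (A * d))"
  have C0: "real C > 0" using C by simp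
  have "dioph {1..d} \<alpha> (A * d) \<kappa>"
  proof
    show "0 < \<kappa>" using C0 by (simp add: \<kappa>_def)
    have "1 \<le> C ^ d * 2 ^ (A * d)" using C by (simp add: Suc_le_eq)
    then show "\<kappa> \<le> 1" unfolding \<kappa>_def by (metis divide_le_eq_1_pos of_nat_1 of_nat_le_iff of_nat_0_less_iff less_le_trans zero_less_one)
    show "{1..d} \<noteq> {}" using d by auto
    fix h :: "nat \<Rightarrow> int" and H :: real
    assume h: "\<And>i. i \<in> {1..d} \<Longrightarrow> real_of_int \<bar>h i\<bar> \<le> H" "1 \<le> H" "\<exists>i\<in>{1..d}. h i \<noteq> 0"
    define \<Theta> where "\<Theta> = (\<Sum>i\<in>{1..d}. of_int (h i) * \<alpha> i)"
    define H' where "H' = nat \<lceil>H\<rceil>"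
    have H': "H \<le> real H'" "real H' \<le> 2 * H" "H' \<ge> 1" unfolding H'_def using h(2) by linarith+
    define Q where "Q = C * H' ^ A"
    have Q1: "Q \<ge> 1" using C H' by (simp add: Q_def Suc_le_eq)
    have "\<kappa> / H ^ (A * d) \<le> 1 / real Q ^ d"
    proof -
      have "real Q ^ d = real C ^ d * real H' ^ (A * d)" by (simp add: Q_def power_mult_distrib power_mult)
      also have "\<dots> \<le> real C ^ d * (2 * H) ^ (A * d)" using H' by (intro mult_left_mono power_mono) auto
      finally have "1 / (real C ^ d * (2 * H) ^ (A * d)) \<le> 1 / real Q ^ d"
        using Q1 C0 h(2) by (intro divide_left_mono) auto
      then show ?thesis by (simp add: \<kappa>_def power_mult_distrib)
    qed
    also have "1 / real Q ^ d \<le> dist_int \<Theta>"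
    proof (rule ccontr)
      assume "\<not> 1 / real Q ^ d \<le> dist_int \<Theta>"
      then have small: "dist_int \<Theta> < 1 / real Q ^ d" by simp
      define hs where "hs = (\<lambda>i. \<bar>h i\<bar>) ` {1..d}"
      have "finite hs" "hs \<noteq> {}" using d by (auto simp: hs_def)
      from Max_in[OF this] obtain i0 where i0': "i0 \<in> {1..d}" "Max hs = \<bar>h i0\<bar>" unfolding hs_def by (rule imageE)
      have i0: "i0 \<in> {1..d}" "\<And>i. i \<in> {1..d} \<Longrightarrow> \<bar>h i\<bar> \<le> \<bar>h i0\<bar>"
        using i0' Max_ge[OF \<open>finite hs\<close>] by (auto simp: hs_def)
      define a where "a = nat \<bar>h i0\<bar>"
      have a: "a \<ge> 1" "real a \<le> H"
        using h(3) i0(2) h(1)[OF i0(1)] by (auto simp: a_def Suc_le_eq zero_less_nat_eq)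
      \<comment> \<open>Lists the \<open>d - 1\<close> coordinates other than \<open>i0\<close>,
        starting at \<open>j = 0\<close>, for use with Dirichlet's theorem.\<close>
      define en where "en j = (if j + 1 < i0 then j + 1 else j + 2)" for j
      obtain q p where q: "0 < q" "q \<le> int (Q ^ (d - 1))" "\<And>j. j < d - 1 \<Longrightarrow> \<bar>of_int q * \<alpha> (en j) - of_int (p j)\<bar> < 1 / real Q"
        by (rule Dirichlet_approx_simult[of Q "d - 1" "\<lambda>j. \<alpha> (en j)"]) (use Q1 in auto)
      define q' where "q' = nat q"
      have qq: "q = int q'" using q(1) by (simp add: q'_def)
      then have "q' \<le> Q ^ (d - 1)" using q(2) by (simp only: of_nat_le_iff)
      then have "real q' \<le> real (Q ^ (d - 1))" by (simp only: of_nat_le_iff)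
      then have q': "q' \<ge> 1" "real q' \<le> real Q ^ (d - 1)" "of_int q = real q'"
        using q(1) by (simp_all add: qq)
      have qi: "dist_int (real q' * \<alpha> i) \<le> 1 / real Q" if i: "i \<in> {1..d}" "i \<noteq> i0" for i
      proof -
        define j where "j = (if i < i0 then i - 1 else i - 2)"
        have "en j = i" "j < d - 1" using i i0(1) by (auto simp: j_def en_def)
        then show ?thesis using q(3)[of j] dist_int_le[of "real q' * \<alpha> i" "p j"] q'(3) by simp
      qed
      \<comment> \<open>Multiplying by the coefficient at \<open>i0\<close> makes that coordinate
        expressible through \<open>q' * \<Theta>\<close> and the other coordinates, so no division
        by \<open>h i0\<close> is needed.\<close>
      define n where "n = a * q'"
      have n1: "n \<ge> 1" using a q' by (simp add: n_def Suc_le_eq)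
      have nle: "real n \<le> H * real Q ^ (d - 1)"
        unfolding n_def of_nat_mult using a q' by (intro mult_mono) auto
      have ni: "dist_int (real n * \<alpha> i) \<le> H / real Q" if i: "i \<in> {1..d}" "i \<noteq> i0" for i
      proof -
        have "dist_int (real n * \<alpha> i) \<le> real a * dist_int (real q' * \<alpha> i)"
          using dist_int_of_nat_mult[of a "real q' * \<alpha> i"] by (simp add: n_def mult.assoc)
        also have "\<dots> \<le> H * (1 / real Q)" using a qi[OF i] h(2) by (intro mult_mono) auto
        finally show ?thesis by simp
      qed
      have ni0: "dist_int (real n * \<alpha> i0) \<le> real d * H / real Q"
      proof -
        have "dist_int (real n * \<alpha> i0) = dist_int (of_int (h i0) * (real q' * \<alpha> i0))"
          by (cases "h i0 \<ge> 0") (auto simp: n_def a_def mult.assoc)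
        also have "of_int (h i0) * (real q' * \<alpha> i0) = real q' * \<Theta> + - (\<Sum>i\<in>{1..d} - {i0}. of_int (h i) * (real q' * \<alpha> i))"
          unfolding \<Theta>_def using i0(1) by (subst sum.remove[of "{1..d}" i0]) (auto simp: algebra_simps sum_distrib_left)
        also have "dist_int \<dots> \<le> dist_int (real q' * \<Theta>) + dist_int (\<Sum>i\<in>{1..d} - {i0}. of_int (h i) * (real q' * \<alpha> i))"
          using dist_int_triangle[of "real q' * \<Theta>" "- (\<Sum>i\<in>{1..d} - {i0}. of_int (h i) * (real q' * \<alpha> i))"] by simp
        also have "\<dots> \<le> real q' * dist_int \<Theta> + (\<Sum>i\<in>{1..d} - {i0}. dist_int (of_int (h i) * (real q' * \<alpha> i)))"
          by (intro add_mono dist_int_of_nat_mult dist_int_sum)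
        also have "\<dots> \<le> real Q ^ (d - 1) * (1 / real Q ^ d) + (\<Sum>i\<in>{1..d} - {i0}. H * (1 / real Q))"
        proof (intro add_mono sum_mono mult_mono)
          fix i assume i: "i \<in> {1..d} - {i0}"
          have "dist_int (of_int (h i) * (real q' * \<alpha> i)) \<le> \<bar>of_int (h i)\<bar> * dist_int (real q' * \<alpha> i)"
            by (rule dist_int_of_int_mult)
          also have "\<dots> \<le> H * (1 / real Q)"
            using h(1)[of i] i qi[of i] h(2) by (intro mult_mono) auto
          finally show "dist_int (of_int (h i) * (real q' * \<alpha> i)) \<le> H * (1 / real Q)" .
        qed (use q' small in auto)
        also have "real Q ^ (d - 1) * (1 / real Q ^ d) = 1 / real Q"
        proof -
          have "real Q ^ d = real Q * real Q ^ (d - 1)" using d by (metis power_eq_if not_numeral_le_zero)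
          then show ?thesis using Q1 by simp
        qed
        also have "1 / real Q + (\<Sum>i\<in>{1..d} - {i0}. H * (1 / real Q)) = (1 + (real d - 1) * H) / real Q"
          using i0(1) d by (simp add: of_nat_diff add_divide_distrib)
        also have "\<dots> \<le> (H + (real d - 1) * H) / real Q" using h(2) by (intro divide_right_mono) auto
        finally show ?thesis by (simp add: algebra_simps)
      qed
      \<comment> \<open>In a coordinate other than \<open>i0\<close> a member of \<open>?F\<close>
        has distance at least \<open>\<mu>\<close>, but here the distance is at most
        \<open>H / Q\<close>, which is less than \<open>\<mu>\<close> by the choice of
        \<open>C\<close>.\<close>
      have "n \<notin> ?F"
      proof
        assume nF: "n \<in> ?F"
        obtain i where i: "i \<in> {1..d}" "i \<noteq> i0"
        proof (cases "i0 = 1")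
          case True then show ?thesis using that[of 2] d by auto
        next
          case False then show ?thesis using that[of 1] d by auto
        qed
        have "\<mu> \<le> H / real Q" using \<mu>(3)[OF nF i(1)] ni[OF i] by linarith
        then have "real Q * \<mu> \<le> H" using Q1 by (simp add: field_simps)
        moreover have "real Q \<ge> real C * H"
        proof -
          have "real C * H \<le> real C * real H' ^ 1" using H' by (simp add: mult_left_mono)
          also have "\<dots> \<le> real C * real H' ^ A" using H' A by (intro mult_left_mono power_increasing) auto
          finally show ?thesis by (simp add: Q_def)
        qed
        then have "real C * H * \<mu> \<le> real Q * \<mu>" using \<mu> by (intro mult_right_mono) auto
        moreover have "real C * H * \<mu> > H"
        proof -
          have "1 < real C * \<mu>" using C(3) \<mu> by (simp add: field_simps)
          then have "H * 1 < H * (real C * \<mu>)" using h(2) by (intro mult_strict_left_mono) auto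
          then show ?thesis by (simp add: mult_ac)
        qed
        ultimately show False by linarith
      qed
      then have "real n powr (- w) \<le> (\<Prod>i=1..d. dist_int (real n * \<alpha> i))" using n1 by auto
      also have "\<dots> = dist_int (real n * \<alpha> i0) * (\<Prod>i\<in>{1..d} - {i0}. dist_int (real n * \<alpha> i))"
        using i0(1) by (intro prod.remove) auto
      also have "\<dots> \<le> (real d * H / real Q) * (\<Prod>i\<in>{1..d} - {i0}. H / real Q)"
        using ni0 ni h(2) by (intro mult_mono prod_mono) (auto intro!: prod_nonneg)
      also have "\<dots> = real d * (H / real Q) ^ d"
      proof -
        have "card ({1..d} - {i0}) = d - 1" using i0(1) by simp
        moreover have "(H / real Q) * (H / real Q) ^ (d - 1) = (H / real Q) ^ d" using d by (metis power_eq_if not_numeral_le_zero)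
        moreover have "(real d * H / real Q) * (\<Prod>i\<in>{1..d} - {i0}. H / real Q) = real d * ((H / real Q) * (H / real Q) ^ card ({1..d} - {i0}))"
          by (simp add: mult.assoc)
        ultimately show ?thesis by (simp only:)
      qed
      finally have 1: "real n powr (- w) \<le> real d * (H / real Q) ^ d" .
      have "(H * real Q ^ (d - 1)) powr (- w) \<le> real n powr (- w)"
        using nle n1 w by (intro powr_mono2') auto
      with 1 have 2: "(H * real Q ^ (d - 1)) powr (- w) \<le> real d * (H / real Q) ^ d" by linarith
      have Qp: "real Q > 0" "H > 0" using Q1 h(2) by auto
      \<comment> \<open>With \<open>n\<close> at most \<open>H * Q ^ (d - 1)\<close>, the exponent
        \<open>e\<close> is what remains of \<open>Q ^ d\<close> after the loss of \<open>n\<close>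
        to the power \<open>w\<close>.\<close>
      have "real Q powr e = (real Q powr (real d)) * (H powr w) * ((H * real Q ^ (d - 1)) powr (- w))"
      proof -
        have "real Q ^ (d - 1) = real Q powr (real d - 1)" using Qp d by (simp add: powr_realpow[symmetric] of_nat_diff)
        then have "(H * real Q ^ (d - 1)) powr (- w) = H powr (- w) * real Q powr (- w * (real d - 1))"
          using Qp by (simp add: powr_mult powr_powr mult.commute)
        then have "(real Q powr (real d)) * (H powr w) * ((H * real Q ^ (d - 1)) powr (- w))
           = (H powr w * H powr (- w)) * (real Q powr (real d) * real Q powr (- w * (real d - 1)))" by simp
        also have "\<dots> = real Q powr e" using Qp unfolding powr_add[symmetric] e_def by simp
        finally show ?thesis ..
      qed
      also have "\<dots> \<le> (real Q powr (real d)) * (H powr w) * (real d * (H / real Q) ^ d)"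
        using 2 by (intro mult_left_mono) auto
      also have "\<dots> = real d * H powr (real d + w)"
        using Qp by (simp add: powr_realpow power_divide powr_add)
      also have "\<dots> \<le> real d * real H' powr (real d + w)"
        using H' Qp w by (intro mult_left_mono powr_mono2) auto
      also have "\<dots> \<le> real d * real H' powr (real A * e)"
        using A H' by (intro mult_left_mono powr_mono) auto
      also have "\<dots> < real C powr e * real H' powr (real A * e)"
        using C H' by (intro mult_strict_right_mono) auto
      also have "\<dots> = real Q powr e"
        using H' C0 by (simp add: Q_def powr_mult powr_powr[symmetric] powr_realpow)
      finally show False by simp
    qed
    finally show "\<kappa> / H ^ (A * d) \<le> dist_int (\<Sum>i\<in>{1..d}. real_of_int (h i) * \<alpha> i)" by (simp add: \<Theta>_def)
  qed simp
  then show ?thesis by blast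
qed


section \<open>Almost every fibre\<close>

text \<open>Shifting \<open>t\<close> by \<open>j\<close> turns the values of \<open>\<psi>\<close>
  at multiples of \<open>R ^ j\<close> into the original ones. The shift costs \<open>R ^ j\<close>
  in the power of \<open>R\<close> and, for \<open>t\<close> beyond \<open>2 * j\<close>, at most
  \<open>2 ^ d\<close> in the power of \<open>t\<close>; both are covered by taking \<open>B\<close>
  large.\<close>

lemma condensation_dilate:
  fixes \<psi> :: "nat \<Rightarrow> real" and R d j :: nat
  assumes R: "R \<ge> 2"
    and unb: "\<And>t0 B. \<exists>T. finite T \<and> T \<subseteq> {t0..} \<and> B \<le> (\<Sum>t\<in>T. real t ^ d * min (real R ^ t * \<psi> (R ^ (t + 1))) 1)"
    and pos: "\<And>n. n \<ge> 1 \<Longrightarrow> \<psi> n > 0"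
  shows "\<exists>T. finite T \<and> T \<subseteq> {t0..} \<and> 1 \<le> (\<Sum>t\<in>T. real t ^ d * min (real R ^ t * \<psi> (R ^ j * R ^ (t + 1))) 1)"
proof -
  obtain T where T: "finite T" "T \<subseteq> {t0 + 2 * j..}" "real R ^ j * 2 ^ d \<le> (\<Sum>t\<in>T. real t ^ d * min (real R ^ t * \<psi> (R ^ (t + 1))) 1)"
    using unb by blast
  have inj: "inj_on (\<lambda>s. s - j) T"
  proof (rule inj_onI)
    fix s s' assume "s \<in> T" "s' \<in> T" "s - j = s' - j"
    moreover from this T(2) have "j \<le> s" "j \<le> s'" by force+
    ultimately show "s = s'" by simp
  qed
  have "1 \<le> (\<Sum>t\<in>T. real t ^ d * min (real R ^ t * \<psi> (R ^ (t + 1))) 1) / (real R ^ j * 2 ^ d)"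
    using T(3) R by (subst le_divide_eq_1_pos) auto
  also have "\<dots> = (\<Sum>s\<in>T. (real s / 2) ^ d * (min (real R ^ s * \<psi> (R ^ (s + 1))) 1 / real R ^ j))"
    by (simp add: sum_divide_distrib power_divide mult.commute)
  also have "\<dots> \<le> (\<Sum>s\<in>T. real (s - j) ^ d * min (real R ^ (s - j) * \<psi> (R ^ j * R ^ (s - j + 1))) 1)"
  proof (rule sum_mono)
    fix s assume "s \<in> T"
    then have s: "2 * j \<le> s" using T(2) by force
    have Rj: "real R ^ j \<ge> 1" using R by (intro one_le_power) auto
    have e: "R ^ j * R ^ (s - j + 1) = R ^ (s + 1)" using s by (simp flip: power_add)
    have e2: "real R ^ (s - j) = real R ^ s / real R ^ j" using s R by (simp add: power_diff)
    have p: "\<psi> (R ^ (s + 1)) > 0" using R by (intro pos) (simp add: Suc_le_eq)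
    have "min (real R ^ s * \<psi> (R ^ (s + 1))) 1 / real R ^ j \<le> min (real R ^ (s - j) * \<psi> (R ^ (s + 1))) 1"
    proof (rule min.boundedI)
      have "min (real R ^ s * \<psi> (R ^ (s + 1))) 1 / real R ^ j \<le> (real R ^ s * \<psi> (R ^ (s + 1))) / real R ^ j"
        by (intro divide_right_mono) auto
      then show "min (real R ^ s * \<psi> (R ^ (s + 1))) 1 / real R ^ j \<le> real R ^ (s - j) * \<psi> (R ^ (s + 1))" by (simp add: e2)
      have "min (real R ^ s * \<psi> (R ^ (s + 1))) 1 / real R ^ j \<le> 1 / 1" using Rj by (intro frac_le) auto
      then show "min (real R ^ s * \<psi> (R ^ (s + 1))) 1 / real R ^ j \<le> 1" by simp
    qed
    then show "(real s / 2) ^ d * (min (real R ^ s * \<psi> (R ^ (s + 1))) 1 / real R ^ j)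
        \<le> real (s - j) ^ d * min (real R ^ (s - j) * \<psi> (R ^ j * R ^ (s - j + 1))) 1"
      unfolding e using s p by (intro mult_mono power_mono) (auto simp: of_nat_diff)
  qed
  also have "\<dots> = (\<Sum>t\<in>(\<lambda>s. s - j) ` T. real t ^ d * min (real R ^ t * \<psi> (R ^ j * R ^ (t + 1))) 1)"
    by (simp add: sum.reindex[OF inj])
  finally have "1 \<le> (\<Sum>t\<in>(\<lambda>s. s - j) ` T. real t ^ d * min (real R ^ t * \<psi> (R ^ j * R ^ (t + 1))) 1)" .
  moreover have "(\<lambda>s. s - j) ` T \<subseteq> {t0..}" using T(2) by force
  ultimately show ?thesis using T(1) by blast
qed

definition solutions :: "nat set \<Rightarrow> (nat \<Rightarrow> real) \<Rightarrow> (nat \<Rightarrow> real) \<Rightarrow> real \<Rightarrow> (nat \<Rightarrow> real) \<Rightarrow> real \<Rightarrow> nat set" where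
  "solutions I \<alpha> \<gamma> \<gamma>' \<psi> x = {n. n \<ge> 1 \<and> (\<Prod>i\<in>I. dist_int (real n * \<alpha> i - \<gamma> i)) * dist_int (real n * x - \<gamma>') < \<psi> n}"

lemma measurable_infinite_solutions: "{x. infinite (solutions I \<alpha> \<gamma> \<gamma>' \<psi> x)} \<in> sets borel"
proof -
  have "{x. infinite (solutions I \<alpha> \<gamma> \<gamma>' \<psi> x)} = {x. \<forall>k. \<exists>n\<ge>k. n \<ge> 1 \<and> (\<Prod>i\<in>I. dist_int (real n * \<alpha> i - \<gamma> i)) * dist_int (real n * x - \<gamma>') < \<psi> n}"
    by (simp add: infinite_nat_iff_unbounded_le solutions_def)
  also have "\<dots> \<in> sets borel" by measurable
  finally show ?thesis .
qed

section \<open>From positive measure in the unit interval to full measure\<close>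

context dioph
begin

text \<open>Blocks beyond \<open>k\<close> alone give the lower bound for the set \<open>A k\<close>
  of points with a solution \<open>n \<ge> k\<close>. These sets decrease to the limsup set within a
  bounded interval, so the bound passes to the intersection.\<close>

lemma limsup_measure_ge:
  fixes \<psi> :: "nat \<Rightarrow> real"
  assumes pos: "\<And>n. n \<ge> 1 \<Longrightarrow> \<psi> n > 0" and mono: "\<And>m n. 1 \<le> m \<Longrightarrow> m \<le> n \<Longrightarrow> \<psi> n \<le> \<psi> m"
    and unb: "\<And>t0. \<exists>T. finite T \<and> T \<subseteq> {t0..} \<and> 1 \<le> (\<Sum>t\<in>T. real t ^ d * min (real (2 ^ m) ^ t * \<psi> ((2 ^ m) ^ (t + 1))) 1)"
  shows "pos_const \<le> measure lborel ({x. infinite (solutions I \<alpha> \<gamma> \<gamma>' \<psi> x)} \<inter> {0..<1})"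
proof -
  define A where "A k = {x \<in> {0..<1}. \<exists>n\<ge>k. n \<in> solutions I \<alpha> \<gamma> \<gamma>' \<psi> x}" for k
  define v where "v t = min (real (2 ^ m) ^ t * \<psi> ((2 ^ m) ^ (t + 1))) 1" for t
  have v: "0 < v t" "v t \<le> 1" for t
    unfolding v_def using pos[of "(2 ^ m) ^ (t + 1)"] by auto
  have Am: "A k \<in> sets lborel" for k
    unfolding A_def solutions_def by measurable
  have Af: "A k \<in> fmeasurable lborel" for k
  proof (rule fmeasurableI2[of "{0..1}"])
    show "{0..1::real} \<in> fmeasurable lborel" by (rule fmeasurableI) (auto simp: emeasure_lborel_Icc_eq)
    show "A k \<subseteq> {0..1}" unfolding A_def by force
  qed (rule Am)
  have ge: "pos_const \<le> measure lborel (A k)" for k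
  proof -
    from eventually_large obtain t0 where t0: "\<forall>t\<ge>t0. large t" ..
    have "\<exists>T. finite T \<and> T \<subseteq> {max t0 k..} \<and> 1 \<le> (\<Sum>t\<in>T. real t ^ d * v t)"
      unfolding v_def by (rule unb)
    then obtain T where T: "finite T" "T \<subseteq> {max t0 k..}" "1 \<le> (\<Sum>t\<in>T. real t ^ d * v t)"
      by (elim exE conjE)
    have lg: "large t" if "t \<in> T" for t using T(2) that t0 by force
    have "pos_const \<le> measure lborel (\<Union>t\<in>T. \<Union>J\<in>cells t. \<Union>n\<in>cell \<gamma> t J. {x \<in> {0..<1}. dist_int (real n * x - \<gamma>') < width v t J})"
      by (rule measure_blocks_ge[OF T(1) lg v T(3)])
    also have "\<dots> \<le> measure lborel (A k)"
    proof (rule measure_mono_fmeasurable[OF _ _ Af])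
      show "(\<Union>t\<in>T. \<Union>J\<in>cells t. \<Union>n\<in>cell \<gamma> t J. {x \<in> {0..<1}. dist_int (real n * x - \<gamma>') < width v t J}) \<in> sets lborel"
        using T(1) finite_cells by (intro sets.finite_UN) (auto simp: cell_def)
      show "(\<Union>t\<in>T. \<Union>J\<in>cells t. \<Union>n\<in>cell \<gamma> t J. {x \<in> {0..<1}. dist_int (real n * x - \<gamma>') < width v t J}) \<subseteq> A k"
      proof clarify
        fix x t J n assume t: "t \<in> T" and J: "J \<in> cells t" and n: "n \<in> cell \<gamma> t J" and x: "x \<in> {0..<1}"
          and less: "dist_int (real n * x - \<gamma>') < width v t J"
        define N :: nat where "N = 2 ^ (m * t)"
        have N: "N \<le> n" "n < 2 * N" "\<And>i. i \<in> I \<Longrightarrow> dist_int (real n * \<alpha> i - \<gamma> i) \<le> rad J i"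
          using n by (auto simp: cell_def bohr_def N_def)
        have m1: "m \<ge> 1" using par_m_ge by simp
        have "k \<le> t" using t T(2) by force
        also have "t \<le> m * t" using m1 by simp
        also have "m * t < N" unfolding N_def by (rule less_exp)
        finally have kn: "k \<le> n" using N by simp
        have n1: "1 \<le> n" by (rule order_trans[OF _ N(1)]) (simp add: N_def)
        \<comment> \<open>The block ends before the next power of \<open>R = 2 ^ m\<close>, so
          monotonicity allows passing from the sampled value of \<open>\<psi>\<close> to
          \<open>\<psi> n\<close>.\<close>
        have "2 * N \<le> 2 ^ m * N" using power_increasing[of 1 m "2::nat"] m1 by simp
        also have "2 ^ m * N = (2 ^ m) ^ (t + 1)" by (simp add: N_def power_mult)
        finally have nR: "n \<le> (2 ^ m) ^ (t + 1)" using N by linarith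
        have "(\<Prod>i\<in>I. dist_int (real n * \<alpha> i - \<gamma> i)) * dist_int (real n * x - \<gamma>') \<le> vol J * dist_int (real n * x - \<gamma>')"
          using N(3) by (intro mult_right_mono prod_mono) auto
        also have "\<dots> < vol J * width v t J" using less vol_pos by (intro mult_strict_left_mono) auto
        also have "\<dots> = v t / real N"
          using vol_pos[of J] by (simp add: width_def N_def)
        also have "\<dots> \<le> (real (2 ^ m) ^ t * \<psi> ((2 ^ m) ^ (t + 1))) / real N"
          by (intro divide_right_mono) (auto simp: v_def)
        also have "\<dots> = \<psi> ((2 ^ m) ^ (t + 1))" by (simp add: N_def power_mult)
        also have "\<dots> \<le> \<psi> n" by (rule mono[OF n1 nR])
        finally have "n \<in> solutions I \<alpha> \<gamma> \<gamma>' \<psi> x" using n1 by (simp add: solutions_def)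
        with kn x show "x \<in> A k" by (auto simp: A_def)
      qed
    qed
    finally show ?thesis .
  qed
  have "(\<lambda>k. measure lborel (A k)) \<longlonglongrightarrow> measure lborel (\<Inter>k. A k)"
  proof (rule Lim_measure_decseq)
    show "range A \<subseteq> sets lborel" using Am by auto
    show "decseq A" by (auto simp: decseq_def A_def intro: order_trans)
    show "emeasure lborel (A k) \<noteq> \<infinity>" for k using Af by (simp add: fmeasurableD2)
  qed
  then have "pos_const \<le> measure lborel (\<Inter>k. A k)"
    by (rule LIMSEQ_le_const) (use ge in auto)
  also have "(\<Inter>k. A k) = {x. infinite (solutions I \<alpha> \<gamma> \<gamma>' \<psi> x)} \<inter> {0..<1}"
    by (auto simp: A_def infinite_nat_iff_unbounded_le)
  finally show ?thesis .
qed

text \<open>A combination of the dilated numbers with coefficients \<open>h\<close> is one of the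
  original numbers with coefficients \<open>D * h\<close>; the exponent \<open>W\<close>, and with
  it \<open>pos_const\<close>, is unchanged.\<close>

lemma dioph_dilate:
  assumes "D \<ge> 1" shows "dioph I (\<lambda>i. real D * \<alpha> i) W (\<kappa> / real D ^ W)"
proof
  have D: "real D ^ W \<ge> 1" "0 < real D ^ W" using assms by (auto intro!: one_le_power)
  show "0 < \<kappa> / real D ^ W" by (rule divide_pos_pos[OF kappa(1) D(2)])
  show "\<kappa> / real D ^ W \<le> 1" using kappa D by (simp add: divide_le_eq_1)
  fix h :: "nat \<Rightarrow> int" and H :: real
  assume h: "\<And>i. i \<in> I \<Longrightarrow> real_of_int \<bar>h i\<bar> \<le> H" "1 \<le> H" "\<exists>i\<in>I. h i \<noteq> 0"
  have "\<kappa> / (real D * H) ^ W \<le> dist_int (\<Sum>i\<in>I. of_int (int D * h i) * \<alpha> i)"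
  proof (rule far)
    fix i assume "i \<in> I"
    then have "real D * real_of_int \<bar>h i\<bar> \<le> real D * H" using h(1) by (intro mult_left_mono) auto
    then show "real_of_int \<bar>int D * h i\<bar> \<le> real D * H" by (simp add: abs_mult)
  next
    show "1 \<le> real D * H" using mult_mono[of 1 "real D" 1 H] assms h(2) by simp
  qed (use h(3) assms in auto)
  then show "\<kappa> / real D ^ W / H ^ W \<le> dist_int (\<Sum>i\<in>I. real_of_int (h i) * (real D * \<alpha> i))"
    by (simp add: power_mult_distrib mult_ac)
qed (use finI neI in auto)

lemma AE_infinite_solutions:
  fixes \<psi> :: "nat \<Rightarrow> real"
  assumes pos: "\<And>n. n \<ge> 1 \<Longrightarrow> \<psi> n > 0" and mono: "\<And>m n. 1 \<le> m \<Longrightarrow> m \<le> n \<Longrightarrow> \<psi> n \<le> \<psi> m"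
    and div: "filterlim (\<lambda>N. \<Sum>n=1..N. \<psi> n * log1 (real n) ^ d) at_top sequentially"
  shows "AE x in lborel. infinite (solutions I \<alpha> \<gamma> \<gamma>' \<psi> x)"
proof -
  define R :: nat where "R = 2 ^ m"
  have "m \<ge> 1" using par_m_ge by simp
  then have R: "R \<ge> 2" unfolding R_def using power_increasing[of 1 m "2::nat"] by simp
  define G where "G = {x. infinite (solutions I \<alpha> \<gamma> \<gamma>' \<psi> x)}"
  have G: "G \<in> sets borel" unfolding G_def by (rule measurable_infinite_solutions)
  have unb: "\<exists>T. finite T \<and> T \<subseteq> {t0..} \<and> B \<le> (\<Sum>t\<in>T. real t ^ d * min (real R ^ t * \<psi> (R ^ (t + 1))) 1)" for t0 B
    using condensation_unbounded[OF R d_ge_1 pos mono div] by blast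
  have "AE x in lborel. x \<in> G"
  proof (rule conull_if_grid_measure_ge[OF G pos_const_pos R])
    fix p :: int and j :: nat
    define D where "D = R ^ j"
    have D1: "D \<ge> 1" using R by (simp add: D_def Suc_le_eq)
    \<comment> \<open>As \<open>pos_const\<close> depends on \<open>I\<close> and \<open>W\<close>
      only, its instance for the dilated numbers is the same constant, uniformly in
      \<open>j\<close>.\<close>
    interpret D: dioph I "\<lambda>i. real D * \<alpha> i" W "\<kappa> / real D ^ W" by (rule dioph_dilate[OF D1])
    define \<psi>D where "\<psi>D n = \<psi> (D * n)" for n
    define V where "V = {x. infinite (solutions I (\<lambda>i. real D * \<alpha> i) \<gamma> \<gamma>' \<psi>D x)}"
    have V: "V \<in> sets borel" unfolding V_def by (rule measurable_infinite_solutions)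
    have per: "x + 1 \<in> V \<longleftrightarrow> x \<in> V" for x
    proof -
      have "dist_int (real n * (x + 1) - \<gamma>') = dist_int (real n * x - \<gamma>')" for n
        using dist_int_add_of_int[of "real n * x - \<gamma>'" "int n"] by (simp add: algebra_simps)
      then show ?thesis by (simp add: V_def solutions_def)
    qed
    have "pos_const \<le> measure lborel (V \<inter> {0..<1})"
      unfolding V_def
    proof (rule D.limsup_measure_ge)
      show "0 < \<psi>D n" if "1 \<le> n" for n using that D1 by (auto simp: \<psi>D_def Suc_le_eq intro!: pos)
      show "\<psi>D n' \<le> \<psi>D n" if "1 \<le> n" "n \<le> n'" for n n' using that D1 by (auto simp: \<psi>D_def Suc_le_eq intro!: mono)
      show "\<exists>T. finite T \<and> T \<subseteq> {t0..} \<and> 1 \<le> (\<Sum>t\<in>T. real t ^ d * min (real (2 ^ m) ^ t * \<psi>D ((2 ^ m) ^ (t + 1))) 1)" for t0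
        using condensation_dilate[OF R unb pos, of t0 j] by (simp only: \<psi>D_def D_def R_def)
    qed
    then have "pos_const / real D \<le> measure lborel (V \<inter> {0..<1}) / real D" by (intro divide_right_mono) auto
    also have "\<dots> = measure lborel {x \<in> {of_int p / real D..<(of_int p + 1) / real D}. real D * x \<in> V}"
      by (rule measure_periodic_cell[OF V per D1, symmetric])
    also have "\<dots> \<le> measure lborel (G \<inter> {of_int p / real D..<(of_int p + 1) / real D})"
    proof (rule measure_mono_fmeasurable)
      have [measurable]: "V \<in> sets borel" by (rule V)
      show "{x \<in> {of_int p / real D..<(of_int p + 1) / real D}. real D * x \<in> V} \<in> sets lborel"
        by measurable
      have "{of_int p / real D..(of_int p + 1) / real D} \<in> fmeasurable lborel"
        by (rule fmeasurableI) (auto simp: emeasure_lborel_Icc_eq)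
      then show "G \<inter> {of_int p / real D..<(of_int p + 1) / real D} \<in> fmeasurable lborel"
        by (rule fmeasurableI2) (use G in auto)
      show "{x \<in> {of_int p / real D..<(of_int p + 1) / real D}. real D * x \<in> V} \<subseteq> G \<inter> {of_int p / real D..<(of_int p + 1) / real D}"
      proof
        fix x assume "x \<in> {x \<in> {of_int p / real D..<(of_int p + 1) / real D}. real D * x \<in> V}"
        then have x: "x \<in> {of_int p / real D..<(of_int p + 1) / real D}"
          and inf: "infinite (solutions I (\<lambda>i. real D * \<alpha> i) \<gamma> \<gamma>' \<psi>D (real D * x))" by (auto simp: V_def)
        \<comment> \<open>A solution \<open>n\<close> of the dilated problem at \<open>D * x\<close>
          gives the solution \<open>D * n\<close> of the original problem at
          \<open>x\<close>.\<close>
        have "(\<lambda>n. D * n) ` solutions I (\<lambda>i. real D * \<alpha> i) \<gamma> \<gamma>' \<psi>D (real D * x) \<subseteq> solutions I \<alpha> \<gamma> \<gamma>' \<psi> x"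
          using D1 by (auto simp: solutions_def \<psi>D_def Suc_le_eq mult_ac)
        moreover have "infinite ((\<lambda>n. D * n) ` solutions I (\<lambda>i. real D * \<alpha> i) \<gamma> \<gamma>' \<psi>D (real D * x))"
          using inf D1 by (subst finite_image_iff) (auto simp: inj_on_def)
        ultimately have "infinite (solutions I \<alpha> \<gamma> \<gamma>' \<psi> x)" using finite_subset by blast
        then show "x \<in> G \<inter> {of_int p / real D..<(of_int p + 1) / real D}" using x by (simp add: G_def)
      qed
    qed
    finally show "pos_const / real R ^ j \<le> measure lborel (G \<inter> {of_int p / real R ^ j..<(of_int p + 1) / real R ^ j})"
      by (simp add: D_def)
  qed
  then show ?thesis by (simp add: G_def)
qed

end

theorem theorem1p7:
  fixes k :: nat and \<alpha> \<gamma> :: "nat \<Rightarrow> real" and \<psi> :: "nat \<Rightarrow> real"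
  assumes "k \<ge> 2"
    and "k = 2 \<Longrightarrow> \<alpha> 1 \<notin> \<rat> \<and> \<not> liouville (\<alpha> 1)"
    and "k \<ge> 3 \<Longrightarrow> mult_exponent (k - 1) \<alpha> < ereal ((real k - 1) / (real k - 2))"
    and "\<And>n. n \<ge> 1 \<Longrightarrow> \<psi> n > 0"
    and "\<And>m n. 1 \<le> m \<Longrightarrow> m \<le> n \<Longrightarrow> \<psi> n \<le> \<psi> m"
    and "filterlim (\<lambda>N. \<Sum>n=1..N. \<psi> n * log1 (real n) ^ (k - 1)) at_top sequentially"
  shows "AE \<alpha>\<^sub>k in (lebesgue :: real measure).
           infinite {n::nat. n \<ge> 1 \<and>
             (\<Prod>i=1..k-1. dist_int (real n * \<alpha> i - \<gamma> i)) * dist_int (real n * \<alpha>\<^sub>k - \<gamma> k) < \<psi> n}"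
proof -
  have "\<exists>W \<kappa>. dioph {1..k - 1} \<alpha> W \<kappa>"
  proof (cases "k = 2")
    case True
    with assms(2) obtain w where "w > 0" "finite {n::nat. n \<ge> 1 \<and> dist_int (real n * \<alpha> 1) < real n powr (- w)}"
      by (auto simp: liouville_def)
    then have "\<exists>W \<kappa>. dioph {1} \<alpha> W \<kappa>" using assms(2) True by (intro dioph_singleton) auto
    then show ?thesis using True by simp
  next
    case False
    with assms(1) have k: "k \<ge> 3" by simp
    define s where "s = mult_exponent (k - 1) \<alpha>"
    \<comment> \<open>The supremum of the empty set is minus infinity, so the maximum with 0
      guarantees that the intermediate exponent \<open>w\<close> is positive.\<close>
    have "max s 0 < ereal ((real k - 1) / (real k - 2))"
      using assms(3)[OF k] k by (simp add: s_def)
    then obtain w where w: "max s 0 < ereal w" "ereal w < ereal ((real k - 1) / (real k - 2))"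
      using ereal_dense2 by blast
    have w0: "w > 0" "s < ereal w" using w(1) by auto
    have "finite {n::nat. n \<ge> 1 \<and> (\<Prod>i=1..k - 1. dist_int (real n * \<alpha> i)) < real n powr (- w)}"
    proof (rule ccontr)
      assume "infinite {n::nat. n \<ge> 1 \<and> (\<Prod>i=1..k - 1. dist_int (real n * \<alpha> i)) < real n powr (- w)}"
      then have "ereal w \<le> s"
        unfolding s_def mult_exponent_def using w0 by (intro Sup_upper) auto
      with w0 show False by simp
    qed
    moreover have "w * (real (k - 1) - 1) < real (k - 1)"
      using w(2) k by (simp add: of_nat_diff field_simps)
    ultimately show ?thesis using k w0 by (intro dioph_multiplicative) auto
  qed
  then obtain W \<kappa> where "dioph {1..k - 1} \<alpha> W \<kappa>" by blast
  then interpret dioph "{1..k - 1}" \<alpha> W \<kappa> .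
  have "AE x in lborel. infinite (solutions {1..k - 1} \<alpha> \<gamma> (\<gamma> k) \<psi> x)"
    using assms(6) by (intro AE_infinite_solutions assms(4,5)) auto
  then show ?thesis unfolding solutions_def by (rule AE_completion)
qed

end
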